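(* 1. For every rigid computable structure $\mathcal A$ there is a computable sequence of differences of c.e. sets $\{C_i=A_i\setminus B_i\}_{i\in\omega}$ such that for each Turing degree $\mathbf x$ the structure $\mathcal A$ is relatively $\mathbf x$-computably categorical if and only if there is an $\mathbf x$-computable weak selector function for $\{C_i\}_{i\in\omega}$. 2. For every computable sequence of differences of c.e. sets $\{C_i=A_i\setminus B_i\}_{i\in\omega}$ there is a rigid computable structure $\mathcal A$ such that for each Turing degree $\mathbf x$ the structure $\mathcal A$ is relatively $\mathbf x$-computably categorical if and only if there is an $\mathbf x$-computable weak selector function for $\{C_i\}_{i\in\omega}$.
   Context: A computable sequence of differences of c.e. sets $\{C_i\}_{i\in\omega}$ is given by two uniformly c.e. sequences $\{A_i\}_{i\in\omega}$, $\{B_i\}_{i\in\omega}$ of subsets of $\omega$, with $C_i=A_i\setminus B_i$ (the $C_i$ are allowed to be empty). A selector function for $\{C_i\}_{i\in\omega}$ is any function $f:\omega\to\omega$ such that $f(i)\in C_i$ for every $i\in\omega$. Let $\{D_n\}_{n\in\omega}$ be the canonical numbering of all finite subsets of $\omega$, $n=\sum_{x\in D_n}2^x$. A weak selector function for $\{C_i=A_i\setminus B_i\}_{i\in\omega}$ is a selector function for the sequence $\{\widehat C_i=\widehat A_i\setminus\widehat B_i\}_{i\in\omega}$, where $\widehat A_i=\{n\mid D_n\subseteq A_i\}$ and $\widehat B_i=\{n\mid D_n\subseteq B_i\}$ (so it depends on the given presentation by $A_i$, $B_i$). Computable structures have domain $\omega$, a computable (possibly infinite) language, and a computable atomic diagram.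 A structure is rigid if it has no nontrivial automorphisms. For a Turing degree $\mathbf x$, a computable structure $\mathcal A$ is relatively $\mathbf x$-computably categorical if for every isomorphic copy $\mathcal B\cong\mathcal A$ (with domain $\omega$) there is a $(\deg(\mathcal B)\cup\mathbf x)$-computable isomorphism from $\mathcal B$ onto $\mathcal A$, where $\deg(\mathcal B)$ is the Turing degree of the atomic diagram of $\mathcal B$ and $\cup$ denotes the join of Turing degrees. *)

theory Defs
  imports "HOL-Library.Nat_Bijection"
begin

text \<open>Programs for the partial \<open>\<mu>\<close>-recursive functions with an oracle for a set of natural
  numbers. \<open>PrimRec\<close> recurses on the first argument, and \<open>Mu\<close> searches for a value of the first
  argument.\<close>

datatype prog =
    Zero
  | Succ
  | Oracle
  | Proj nat
  | Comp prog "prog list"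
  | PrimRec prog prog
  | Mu prog

text \<open>\<open>runs X p xs y\<close>: the program \<open>p\<close> with oracle \<open>X\<close> halts on the argument list \<open>xs\<close> with
  value \<open>y\<close>.\<close>

inductive runs :: "nat set \<Rightarrow> prog \<Rightarrow> nat list \<Rightarrow> nat \<Rightarrow> bool" for X :: "nat set" where
  runs_Zero: "runs X Zero xs 0"
| runs_Succ: "runs X Succ [x] (Suc x)"
| runs_Oracle: "runs X Oracle [x] (of_bool (x \<in> X))"
| runs_Proj: "i < length xs \<Longrightarrow> runs X (Proj i) xs (xs ! i)"
| runs_Comp: "list_all2 (\<lambda>g y. runs X g xs y) gs ys \<Longrightarrow> runs X f ys z \<Longrightarrow> runs X (Comp f gs) xs z"
| runs_PrimRec_0: "runs X f xs y \<Longrightarrow> runs X (PrimRec f g) (0 # xs) y"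
| runs_PrimRec_Suc: "runs X (PrimRec f g) (n # xs) y \<Longrightarrow> runs X g (n # y # xs) z
    \<Longrightarrow> runs X (PrimRec f g) (Suc n # xs) z"
| runs_Mu: "runs X f (n # xs) 0 \<Longrightarrow> (\<forall>m<n. \<exists>y>0. runs X f (m # xs) y) \<Longrightarrow> runs X (Mu f) xs n"

definition computable_in :: "nat set \<Rightarrow> (nat \<Rightarrow> nat) \<Rightarrow> bool" where
  "computable_in X f \<longleftrightarrow> (\<exists>p. \<forall>n. runs X p [n] (f n))"

definition turing_reducible :: "nat set \<Rightarrow> nat set \<Rightarrow> bool"  (infix "\<le>\<^sub>T" 50) where
  "Y \<le>\<^sub>T X \<longleftrightarrow> computable_in X (\<lambda>n. of_bool (n \<in> Y))"

definition turing_equiv :: "nat set \<Rightarrow> nat set \<Rightarrow> bool"  (infix "\<equiv>\<^sub>T" 50) where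
  "X \<equiv>\<^sub>T Y \<longleftrightarrow> X \<le>\<^sub>T Y \<and> Y \<le>\<^sub>T X"

definition computable_fun :: "(nat \<Rightarrow> nat) \<Rightarrow> bool" where
  "computable_fun f \<longleftrightarrow> computable_in {} f"

definition computable_set :: "nat set \<Rightarrow> bool" where
  "computable_set S \<longleftrightarrow> computable_fun (\<lambda>n. of_bool (n \<in> S))"

definition ce_set :: "nat set \<Rightarrow> bool" where
  "ce_set S \<longleftrightarrow> (\<exists>p. \<forall>n. n \<in> S \<longleftrightarrow> (\<exists>y. runs {} p [n] y))"

definition uniformly_ce :: "(nat \<Rightarrow> nat set) \<Rightarrow> bool" where
  "uniformly_ce A \<longleftrightarrow> ce_set {prod_encode (i, n) | i n. n \<in> A i}"

text \<open>Values are unique, so the one-sided condition in \<open>computable_in\<close> determines \<open>f\<close> from \<open>p\<close> and \<open>X\<close>.\<close>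

lemma runs_deterministic: "runs X p xs y \<Longrightarrow> runs X p xs z \<Longrightarrow> y = z"
proof (induction p xs y arbitrary: z rule: runs.induct)
  case (runs_Comp xs gs ys f z z')
  from runs_Comp.prems obtain ys' where
    ys': "list_all2 (\<lambda>g y. runs X g xs y) gs ys'" "runs X f ys' z'"
    by (cases rule: runs.cases) auto
  have "ys = ys'"
    by (rule nth_equalityI)
      (use runs_Comp.IH(1) ys'(1) in \<open>auto simp: list_all2_conv_all_nth\<close>)
  then show ?case using runs_Comp.IH(2) ys'(2) by simp
next
  case (runs_PrimRec_0 f xs y g)
  from runs_PrimRec_0.prems show ?case
    by (cases rule: runs.cases) (auto intro: runs_PrimRec_0.IH)
next
  case (runs_PrimRec_Suc f g n xs y z z')
  from runs_PrimRec_Suc.prems obtain y' where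
    "runs X (PrimRec f g) (n # xs) y'" "runs X g (n # y' # xs) z'"
    by (cases rule: runs.cases) auto
  then show ?case using runs_PrimRec_Suc.IH by blast
next
  case (runs_Mu f n xs n')
  from runs_Mu.prems have n': "runs X f (n' # xs) 0" "\<forall>m<n'. \<exists>y>0. runs X f (m # xs) y"
    by (cases rule: runs.cases; auto)+
  show ?case
  proof (rule linorder_cases[of n n'])
    assume "n < n'"
    then show ?thesis using n'(2) runs_Mu.IH(1) by fastforce
  next
    assume "n' < n"
    then show ?thesis using n'(1) runs_Mu.IH(2) by fastforce
  qed
qed (auto elim: runs.cases)

primrec subst_oracle :: "prog \<Rightarrow> prog \<Rightarrow> prog" where
  "subst_oracle q Zero = Zero"
| "subst_oracle q Succ = Succ"
| "subst_oracle q Oracle = q"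
| "subst_oracle q (Proj i) = Proj i"
| "subst_oracle q (Comp f gs) = Comp (subst_oracle q f) (map (subst_oracle q) gs)"
| "subst_oracle q (PrimRec f g) = PrimRec (subst_oracle q f) (subst_oracle q g)"
| "subst_oracle q (Mu f) = Mu (subst_oracle q f)"

lemma runs_subst_oracle:
  assumes q: "\<And>n. runs X q [n] (of_bool (n \<in> Y))"
  shows "runs Y p xs y \<Longrightarrow> runs X (subst_oracle q p) xs y"
proof (induction p xs y rule: runs.induct)
  case (runs_Comp xs gs ys f z)
  have "list_all2 (\<lambda>g y. runs X g xs y) (map (subst_oracle q) gs) ys"
    using runs_Comp.IH(1) by (auto simp: list_all2_conv_all_nth)
  then show ?case using runs_Comp.IH(2) by (auto intro: runs.intros)
next
  case (runs_Mu f n xs)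
  then show ?case by (auto intro!: runs.intros)
qed (auto simp: q intro: runs.intros)

lemma computable_in_trans: "computable_in Y f \<Longrightarrow> Y \<le>\<^sub>T X \<Longrightarrow> computable_in X f"
  unfolding computable_in_def turing_reducible_def by (metis runs_subst_oracle)

lemma turing_reducible_refl: "X \<le>\<^sub>T X"
  unfolding turing_reducible_def computable_in_def by (blast intro: runs_Oracle)

lemma turing_reducible_trans: "Z \<le>\<^sub>T Y \<Longrightarrow> Y \<le>\<^sub>T X \<Longrightarrow> Z \<le>\<^sub>T X"
  unfolding turing_reducible_def[of Z] by (rule computable_in_trans)

quotient_type turing_degree = "nat set" / turing_equiv
  by (rule equivpI)
    (auto simp: reflp_def symp_def transp_def turing_equiv_def
      intro: turing_reducible_refl turing_reducible_trans)

lift_definition degree :: "nat set \<Rightarrow> turing_degree" is "\<lambda>X. X" .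

lift_definition degree_computes :: "turing_degree \<Rightarrow> (nat \<Rightarrow> nat) \<Rightarrow> bool" is computable_in
  by (auto simp: turing_equiv_def fun_eq_iff intro: computable_in_trans)

definition set_join :: "nat set \<Rightarrow> nat set \<Rightarrow> nat set"  (infixl "\<oplus>\<^sub>T" 65) where
  "X \<oplus>\<^sub>T Y = (\<lambda>n. 2 * n) ` X \<union> (\<lambda>n. 2 * n + 1) ` Y"

lemma computable_in_comp: "computable_in X f \<Longrightarrow> computable_in X g \<Longrightarrow> computable_in X (\<lambda>n. f (g n))"
  unfolding computable_in_def
proof (elim exE)
  fix p q assume "\<forall>n. runs X p [n] (f n)" "\<forall>n. runs X q [n] (g n)"
  then have "runs X (Comp p [q]) [n] (f (g n))" for n
    by (intro runs_Comp[where ys = "[g n]"]) auto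
  then show "\<exists>p. \<forall>n. runs X p [n] (f (g n))" by blast
qed

lemma computable_in_rec:
  assumes p: "\<And>n y. runs X p [n, y] (h n y)" and f: "f 0 = 0" "\<And>n. f (Suc n) = h n (f n)"
  shows "computable_in X f"
proof -
  have "runs X (PrimRec Zero p) [n] (f n)" for n
    by (induction n) (auto simp: f intro: runs.intros p)
  then show ?thesis unfolding computable_in_def by blast
qed

lemma runs_not: "runs X (Comp (PrimRec (Comp Succ [Zero]) Zero) [Proj 1]) [n, y] (of_bool (y = 0))"
proof (rule runs_Comp[where ys = "[y]"])
  have one: "runs X (Comp Succ [Zero]) [] 1"
    by (rule runs_Comp[where ys = "[0]"])
      (auto intro: runs_Zero runs_Succ[of X 0, simplified])
  show "runs X (PrimRec (Comp Succ [Zero]) Zero) [y] (of_bool (y = 0))"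
    by (induction y) (use one in \<open>auto intro: runs.intros\<close>)
qed (auto intro: runs_Proj[of 1 "[n, y]" X, simplified])

lemma computable_in_mod2: "computable_in X (\<lambda>n. n mod 2)"
  by (rule computable_in_rec[OF runs_not]) (auto simp: mod_Suc)

lemma computable_in_if:
  assumes b: "computable_in X b" and f: "computable_in X f" and g: "computable_in X g"
  shows "computable_in X (\<lambda>n. if b n = 0 then f n else g n)"
proof -
  obtain pb pf pg where p: "\<And>n. runs X pb [n] (b n)" "\<And>n. runs X pf [n] (f n)"
      "\<And>n. runs X pg [n] (g n)"
    using assms unfolding computable_in_def by blast
  let ?c = "PrimRec (Proj 0) (Proj 3)"
  have c: "runs X ?c [k, u, v] (if k = 0 then u else v)" for k u v
  proof (induction k)
    case 0
    show ?case using runs_PrimRec_0[OF runs_Proj[of 0 "[u, v]" X]] by simp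
  next
    case (Suc k)
    show ?case
      using runs_PrimRec_Suc[OF Suc runs_Proj[of 3 "[k, if k = 0 then u else v, u, v]" X]]
      by (simp add: numeral_3_eq_3)
  qed
  have "runs X (Comp ?c [pb, pf, pg]) [n] (if b n = 0 then f n else g n)" for n
    by (rule runs_Comp[OF _ c]) (simp add: p)
  then show ?thesis unfolding computable_in_def by blast
qed

lemma computable_in_div2: "computable_in X (\<lambda>n. n div 2)"
proof -
  obtain p where p: "\<And>n. runs X p [n] (n mod 2)"
    using computable_in_mod2 unfolding computable_in_def by blast
  let ?c = "PrimRec (Proj 0) (Comp Succ [Proj 2])"
  have c: "runs X ?c [k, u] (if k = 0 then u else Suc u)" for k u
  proof (induction k)
    case 0
    show ?case using runs_PrimRec_0[OF runs_Proj[of 0 "[u]" X]] by simp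
  next
    case (Suc k)
    have "runs X (Comp Succ [Proj 2]) [k, v, u] (Suc u)" for v
      by (rule runs_Comp[where ys = "[u]"])
        (use runs_Proj[of 2 "[k, v, u]" X] in \<open>auto intro: runs_Succ\<close>)
    then show ?case using runs_PrimRec_Suc[OF Suc] by simp
  qed
  have m: "runs X (Comp p [Proj 0]) [n, y] (n mod 2)" for n y
    by (rule runs_Comp[OF _ p]) (use runs_Proj[of 0 "[n, y]" X] in auto)
  have "runs X (Comp ?c [Comp p [Proj 0], Proj 1]) [n, y] (if n mod 2 = 0 then y else Suc y)" for n y
    by (rule runs_Comp[OF _ c]) (use m runs_Proj[of 1 "[n, y]" X] in auto)
  then show ?thesis
    by (rule computable_in_rec) (auto simp: div_Suc mod_Suc)
qed

lemma mem_set_join: "n \<in> X \<oplus>\<^sub>T Y \<longleftrightarrow> (if n mod 2 = 0 then n div 2 \<in> X else n div 2 \<in> Y)"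
proof -
  have "\<exists>m. n = 2 * m \<or> n = 2 * m + 1" by presburger
  then obtain m where "n = 2 * m \<or> n = 2 * m + 1" by blast
  then show ?thesis unfolding set_join_def by (auto; presburger)
qed

lemma computable_in_Suc: "computable_in X Suc"
  unfolding computable_in_def by (blast intro: runs_Succ)

lemma computable_in_double: "computable_in X (\<lambda>n. 2 * n)"
proof -
  have s: "runs X (Comp Succ [Proj 1]) [n, y] (Suc y)" for n y
    by (rule runs_Comp[where ys = "[y]"])
      (use runs_Proj[of 1 "[n, y]" X] in \<open>auto intro: runs_Succ\<close>)
  have "runs X (Comp Succ [Comp Succ [Proj 1]]) [n, y] (Suc (Suc y))" for n y
    by (rule runs_Comp[where ys = "[Suc y]"]) (use s in \<open>auto intro: runs_Succ\<close>)
  then show ?thesis by (rule computable_in_rec) auto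
qed

lemma set_join_upper1: "X \<le>\<^sub>T X \<oplus>\<^sub>T Y"
  using computable_in_comp[OF turing_reducible_refl[of "X \<oplus>\<^sub>T Y", unfolded turing_reducible_def]
      computable_in_double]
  by (simp add: turing_reducible_def mem_set_join)

lemma set_join_upper2: "Y \<le>\<^sub>T X \<oplus>\<^sub>T Y"
  using computable_in_comp[OF turing_reducible_refl[of "X \<oplus>\<^sub>T Y", unfolded turing_reducible_def]
      computable_in_comp[OF computable_in_Suc computable_in_double]]
  by (simp add: turing_reducible_def mem_set_join mod_Suc div_Suc)

lemma set_join_least:
  assumes "X \<le>\<^sub>T Z" "Y \<le>\<^sub>T Z"
  shows "X \<oplus>\<^sub>T Y \<le>\<^sub>T Z"
  using computable_in_if[OF computable_in_mod2
      computable_in_comp[OF assms(1)[unfolded turing_reducible_def] computable_in_div2]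
      computable_in_comp[OF assms(2)[unfolded turing_reducible_def] computable_in_div2]]
  unfolding turing_reducible_def mem_set_join by (simp add: if_distrib)

lift_definition degree_join :: "turing_degree \<Rightarrow> turing_degree \<Rightarrow> turing_degree"
  (infixl "\<squnion>\<^sub>T" 65) is set_join
  unfolding turing_equiv_def
  by (meson set_join_least set_join_upper1 set_join_upper2 turing_reducible_trans)

text \<open>The symbols of a language are natural numbers; function and relation symbols are numbered
  separately, and an arity of \<open>None\<close> means that there is no such symbol. Constants are the function
  symbols of arity 0.\<close>

record language =
  fun_arity :: "nat \<Rightarrow> nat option"
  rel_arity :: "nat \<Rightarrow> nat option"

definition wf_language :: "language \<Rightarrow> bool" where
  "wf_language L \<longleftrightarrow> (\<forall>r. rel_arity L r \<noteq> Some 0)"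

text \<open>The coding below decides which symbols exist and computes their arities at once.\<close>

definition computable_language :: "language \<Rightarrow> bool" where
  "computable_language L \<longleftrightarrow> wf_language L \<and>
     computable_fun (\<lambda>s. case fun_arity L s of None \<Rightarrow> 0 | Some k \<Rightarrow> Suc k) \<and>
     computable_fun (\<lambda>r. case rel_arity L r of None \<Rightarrow> 0 | Some k \<Rightarrow> Suc k)"

text \<open>The domain is always the full type of natural numbers. Only the interpretation of symbols of
  the language on argument lists of the right length is ever relevant.\<close>

record struct =
  fun_interp :: "nat \<Rightarrow> nat list \<Rightarrow> nat"
  rel_interp :: "nat \<Rightarrow> nat list \<Rightarrow> bool"

definition is_isomorphism :: "language \<Rightarrow> struct \<Rightarrow> struct \<Rightarrow> (nat \<Rightarrow> nat) \<Rightarrow> bool" where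
  "is_isomorphism L M N h \<longleftrightarrow> bij h \<and>
     (\<forall>s xs. fun_arity L s = Some (length xs) \<longrightarrow>
        h (fun_interp M s xs) = fun_interp N s (map h xs)) \<and>
     (\<forall>r xs. rel_arity L r = Some (length xs) \<longrightarrow>
        (rel_interp M r xs \<longleftrightarrow> rel_interp N r (map h xs)))"

definition isomorphic :: "language \<Rightarrow> struct \<Rightarrow> struct \<Rightarrow> bool" where
  "isomorphic L M N \<longleftrightarrow> (\<exists>h. is_isomorphism L M N h)"

definition rigid :: "language \<Rightarrow> struct \<Rightarrow> bool" where
  "rigid L M \<longleftrightarrow> (\<forall>h. is_isomorphism L M M h \<longrightarrow> h = id)"

text \<open>Closed terms and atomic sentences of the language expanded by a constant \<open>Elem a\<close> for each
  element \<open>a\<close> of the domain, together with their Goedel numbers.\<close>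

datatype tm = Elem nat | Fun nat "tm list"

datatype atom = Eq tm tm | Rel nat "tm list"

datatype literal = Pos atom | Neg atom

fun wf_tm :: "language \<Rightarrow> tm \<Rightarrow> bool" where
  "wf_tm L (Elem a) \<longleftrightarrow> True"
| "wf_tm L (Fun s ts) \<longleftrightarrow> fun_arity L s = Some (length ts) \<and> (\<forall>t\<in>set ts. wf_tm L t)"

primrec wf_atom :: "language \<Rightarrow> atom \<Rightarrow> bool" where
  "wf_atom L (Eq t u) \<longleftrightarrow> wf_tm L t \<and> wf_tm L u"
| "wf_atom L (Rel r ts) \<longleftrightarrow> rel_arity L r = Some (length ts) \<and> (\<forall>t\<in>set ts. wf_tm L t)"

primrec wf_literal :: "language \<Rightarrow> literal \<Rightarrow> bool" where
  "wf_literal L (Pos \<phi>) \<longleftrightarrow> wf_atom L \<phi>"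
| "wf_literal L (Neg \<phi>) \<longleftrightarrow> wf_atom L \<phi>"

primrec tm_value :: "struct \<Rightarrow> tm \<Rightarrow> nat" where
  "tm_value M (Elem a) = a"
| "tm_value M (Fun s ts) = fun_interp M s (map (tm_value M) ts)"

primrec sat_atom :: "struct \<Rightarrow> atom \<Rightarrow> bool" where
  "sat_atom M (Eq t u) \<longleftrightarrow> tm_value M t = tm_value M u"
| "sat_atom M (Rel r ts) \<longleftrightarrow> rel_interp M r (map (tm_value M) ts)"

primrec sat_literal :: "struct \<Rightarrow> literal \<Rightarrow> bool" where
  "sat_literal M (Pos \<phi>) \<longleftrightarrow> sat_atom M \<phi>"
| "sat_literal M (Neg \<phi>) \<longleftrightarrow> \<not> sat_atom M \<phi>"

primrec tm_code :: "tm \<Rightarrow> nat" where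
  "tm_code (Elem a) = prod_encode (0, a)"
| "tm_code (Fun s ts) = prod_encode (Suc s, list_encode (map tm_code ts))"

primrec atom_code :: "atom \<Rightarrow> nat" where
  "atom_code (Eq t u) = prod_encode (0, prod_encode (tm_code t, tm_code u))"
| "atom_code (Rel r ts) = prod_encode (Suc r, list_encode (map tm_code ts))"

primrec literal_code :: "literal \<Rightarrow> nat" where
  "literal_code (Pos \<phi>) = prod_encode (0, atom_code \<phi>)"
| "literal_code (Neg \<phi>) = prod_encode (1, atom_code \<phi>)"

definition atomic_diagram :: "language \<Rightarrow> struct \<Rightarrow> nat set" where
  "atomic_diagram L M = {literal_code l | l. wf_literal L l \<and> sat_literal M l}"

definition computable_structure :: "language \<Rightarrow> struct \<Rightarrow> bool" where
  "computable_structure L M \<longleftrightarrow> computable_language L \<and> computable_set (atomic_diagram L M)"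

definition structure_degree :: "language \<Rightarrow> struct \<Rightarrow> turing_degree" where
  "structure_degree L M = degree (atomic_diagram L M)"

definition relatively_computably_categorical :: "turing_degree \<Rightarrow> language \<Rightarrow> struct \<Rightarrow> bool" where
  "relatively_computably_categorical x L M \<longleftrightarrow>
     (\<forall>N. isomorphic L N M \<longrightarrow>
        (\<exists>h. is_isomorphism L N M h \<and> degree_computes (structure_degree L N \<squnion>\<^sub>T x) h))"

definition computable_difference_sequence :: "(nat \<Rightarrow> nat set) \<Rightarrow> (nat \<Rightarrow> nat set) \<Rightarrow> bool" where
  "computable_difference_sequence A B \<longleftrightarrow> uniformly_ce A \<and> uniformly_ce B"

definition selector :: "(nat \<Rightarrow> nat set) \<Rightarrow> (nat \<Rightarrow> nat) \<Rightarrow> bool" where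
  "selector C f \<longleftrightarrow> (\<forall>i. f i \<in> C i)"

text \<open>\<open>set_decode\<close> is the canonical numbering of the finite sets of natural numbers.\<close>

definition finite_subset_codes :: "nat set \<Rightarrow> nat set" where
  "finite_subset_codes S = {n. set_decode n \<subseteq> S}"

definition weak_selector ::
  "(nat \<Rightarrow> nat set) \<Rightarrow> (nat \<Rightarrow> nat set) \<Rightarrow> (nat \<Rightarrow> nat) \<Rightarrow> bool" where
  "weak_selector A B f \<longleftrightarrow>
     selector (\<lambda>i. finite_subset_codes (A i) - finite_subset_codes (B i)) f"

end

(*
  In a rigid structure, relative categoricity means that every element is defined by an existential
  formula over fixed finitely many parameters. If, for every copy of M, the isomorphism onto M is
  computable from the copy and an oracle X, then some program e and some finite sequence p force
  this for all copies given by permutations extending p: a generic permutation would defeat all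
  programs otherwise. The finite part of the diagram that e uses to find an element then defines
  that element over p. So for part 1 one takes for A a the formulas true of a and for B a the
  formulas true of some other element; a weak selector finds formulas of which one defines a.

  For part 2, each index i gets infinitely many copies of a chain of type omega. The first element
  carries the labels in A i, all later ones carry those in B i, and a label is the existence of a
  witness. An existential formula that holds of the first element mentions a finite set D of its
  labels, contained in A i. If D is contained in B i, then the formula also holds of the second
  element. The successor relation makes the chain rigid even if A i = B i, and the infinitely many
  copies leave, for every i, a copy that contains no parameters.
*)

theory Submission
  imports Defs "HOL-Library.Countable" "HOL-Combinatorics.Transposition"
begin

section \<open>Computable functions\<close>

text \<open>The sequence in part 1 must serve all degrees at once, but the parameters found by
  forcing depend on the oracle. They are therefore taken from one oracle. For any other oracle, the
  additional parameters are recovered from finitely many bits of the diagram over the chosen ones,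
  because the program found for the chosen oracle already computes the isomorphism from such bits.
  If no oracle works at all, empty sets satisfy the equivalence.

  Existential formulas are given no syntax: a formula is a bound \<open>u\<close> together with a
  finite set that describes the diagram of a tuple below \<open>u\<close>. This rests on the fact
  that the code of a literal bounds the elements it mentions, so these bits depend only on the first
  \<open>u\<close> entries of the tuple.

  In part 2 the domain consists of all numbers, while labels are enumerated at unpredictable stages.
  A potential witness therefore contains a stage that the label relations do not show, and numbers
  with a wrong stage are named individually.\<close>

abbreviation pair :: "nat \<Rightarrow> nat \<Rightarrow> nat" where
  "pair m n \<equiv> prod_encode (m, n)"

definition pfst :: "nat \<Rightarrow> nat" where "pfst n = fst (prod_decode n)"

definition psnd :: "nat \<Rightarrow> nat" where "psnd n = snd (prod_decode n)"

lemma pfst_pair [simp]: "pfst (pair m n) = m" by (simp add: pfst_def)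

lemma psnd_pair [simp]: "psnd (pair m n) = n" by (simp add: psnd_def)

lemma pair_pfst_psnd [simp]: "pair (pfst n) (psnd n) = n" by (simp add: pfst_def psnd_def)

lemma pair_exhaust: obtains m k where "n = pair m k" by (metis pair_pfst_psnd)

lemma runs_Comp1: "runs X g xs a \<Longrightarrow> runs X f [a] b \<Longrightarrow> runs X (Comp f [g]) xs b"
  by (rule runs_Comp[where ys = "[a]"]) auto

lemma runs_Comp2:
  "runs X g xs a \<Longrightarrow> runs X h xs b \<Longrightarrow> runs X f [a, b] c \<Longrightarrow> runs X (Comp f [g, h]) xs c"
  by (rule runs_Comp[where ys = "[a, b]"]) auto

lemma runs_Proj': "i < length xs \<Longrightarrow> y = xs ! i \<Longrightarrow> runs X (Proj i) xs y"
  by (simp add: runs_Proj)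

definition computable2 :: "nat set \<Rightarrow> (nat \<Rightarrow> nat \<Rightarrow> nat) \<Rightarrow> bool" where
  "computable2 X f \<longleftrightarrow> (\<exists>p. \<forall>m n. runs X p [m, n] (f m n))"

lemma computable2I: "(\<And>m n. runs X p [m, n] (f m n)) \<Longrightarrow> computable2 X f"
  unfolding computable2_def by blast

lemma computable2_swap: "computable2 X f \<Longrightarrow> computable2 X (\<lambda>m n. f n m)"
proof -
  assume "computable2 X f"
  then obtain p where "\<And>m n. runs X p [m, n] (f m n)" unfolding computable2_def by blast
  then have "runs X (Comp p [Proj 1, Proj 0]) [m, n] (f n m)" for m n
    by (auto intro!: runs_Comp2 runs_Proj')
  then show ?thesis by (rule computable2I)
qed

lemma computable2_comp:
  assumes "computable2 X f" "computable2 X g" "computable2 X h"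
  shows "computable2 X (\<lambda>m n. f (g m n) (h m n))"
proof -
  obtain p q r where "\<And>m n. runs X p [m, n] (f m n)" "\<And>m n. runs X q [m, n] (g m n)"
      "\<And>m n. runs X r [m, n] (h m n)"
    using assms unfolding computable2_def by blast
  then have "runs X (Comp p [q, r]) [m, n] (f (g m n) (h m n))" for m n by (intro runs_Comp2)
  then show ?thesis by (rule computable2I)
qed

lemma computable_in_comp2:
  assumes "computable2 X f" "computable_in X g" "computable_in X h"
  shows "computable_in X (\<lambda>n. f (g n) (h n))"
proof -
  obtain p q r where "\<And>m n. runs X p [m, n] (f m n)" "\<And>n. runs X q [n] (g n)"
      "\<And>n. runs X r [n] (h n)"
    using assms unfolding computable2_def computable_in_def by blast
  then have "runs X (Comp p [q, r]) [n] (f (g n) (h n))" for n by (intro runs_Comp2)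
  then show ?thesis unfolding computable_in_def by blast
qed

lemma computable2_comp1:
  assumes "computable_in X f" "computable2 X g"
  shows "computable2 X (\<lambda>m n. f (g m n))"
proof -
  obtain p q where "\<And>n. runs X p [n] (f n)" "\<And>m n. runs X q [m, n] (g m n)"
    using assms unfolding computable2_def computable_in_def by blast
  then have "runs X (Comp p [q]) [m, n] (f (g m n))" for m n by (intro runs_Comp1)
  then show ?thesis by (rule computable2I)
qed

lemma computable2_fst: "computable2 X (\<lambda>m n. m)"
  by (rule computable2I[of _ "Proj 0"]) (auto intro!: runs_Proj')

lemma computable2_snd: "computable2 X (\<lambda>m n. n)"
  by (rule computable2I[of _ "Proj 1"]) (auto intro!: runs_Proj')

lemma computable_in_id [intro]: "computable_in X (\<lambda>x. x)"
  unfolding computable_in_def by (rule exI[of _ "Proj 0"]) (auto intro!: runs_Proj')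

lemma computable_in_const: "computable_in X (\<lambda>x. c)"
proof (induction c)
  case 0
  then show ?case unfolding computable_in_def by (blast intro: runs_Zero)
next
  case (Suc c)
  then show ?case by (rule computable_in_comp[OF computable_in_Suc])
qed

lemma computable_in_rec2:
  assumes "computable2 X h"
  shows "computable_in X (rec_nat 0 h)"
proof -
  obtain p where "\<And>m n. runs X p [m, n] (h m n)" using assms unfolding computable2_def by blast
  then show ?thesis by (rule computable_in_rec) auto
qed

lemma computable2_funpow:
  assumes "computable_in X h"
  shows "computable2 X (\<lambda>m n. (h ^^ m) n)"
proof -
  obtain p where p: "\<And>n. runs X p [n] (h n)" using assms unfolding computable_in_def by blast
  have "runs X (PrimRec (Proj 0) (Comp p [Proj 1])) [m, n] ((h ^^ m) n)" for m n
  proof (induction m)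
    case 0
    show ?case by (auto intro!: runs_PrimRec_0 runs_Proj')
  next
    case (Suc m)
    show ?case
      by (rule runs_PrimRec_Suc[OF Suc]) (auto intro!: runs_Comp1 runs_Proj' p)
  qed
  then show ?thesis by (rule computable2I)
qed

lemma computable2_plus: "computable2 X (+)"
proof -
  have "(Suc ^^ m) n = m + n" for m n by simp
  then show ?thesis using computable2_funpow[OF computable_in_Suc, of X] by simp
qed

lemma computable_in_pred: "computable_in X (\<lambda>n. n - 1)"
proof -
  have "rec_nat 0 (\<lambda>m n. m) = (\<lambda>n. n - 1)" 
  proof
    show "rec_nat 0 (\<lambda>m n. m) n = n - 1" for n by (cases n) auto
  qed
  then show ?thesis using computable_in_rec2[OF computable2_fst, of X] by simp
qed

lemma computable2_minus: "computable2 X (-)"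
proof -
  have "((\<lambda>n. n - 1) ^^ m) n = n - m" for m n by (induction m) auto
  then show ?thesis using computable2_swap[OF computable2_funpow[OF computable_in_pred, of X]] by simp
qed

lemma computable_in_triangle: "computable_in X triangle"
proof -
  have "triangle = rec_nat 0 (\<lambda>n y. y + Suc n)"
  proof
    show "triangle n = rec_nat 0 (\<lambda>n y. y + Suc n) n" for n by (induction n) auto
  qed
  then show ?thesis
    using computable_in_rec2[OF computable2_comp[OF computable2_plus computable2_snd
          computable2_comp1[OF computable_in_Suc computable2_fst]], of X] by simp
qed

lemma computable2_pair: "computable2 X pair"
  using computable2_comp[OF computable2_plus
      computable2_comp1[OF computable_in_triangle computable2_plus] computable2_fst, of X]
  by (simp add: prod_encode_def)

text \<open>This is the largest \<open>y\<close> with \<open>triangle y \<le> n\<close>, which is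
  the sum of the two components coded by \<open>n\<close>. The value increases when the truncated
  difference vanishes. With it both projections become arithmetical, without a search.\<close>

definition triangle_root :: "nat \<Rightarrow> nat" where
  "triangle_root = rec_nat 0 (\<lambda>n y. if triangle (Suc y) - Suc n = 0 then Suc y else y)"

lemma triangle_mono: "m \<le> n \<Longrightarrow> triangle m \<le> triangle n"
  by (induction rule: dec_induct) auto

lemma triangle_root: "triangle (triangle_root n) \<le> n \<and> n < triangle (Suc (triangle_root n))"
proof (induction n)
  case 0
  then show ?case by (simp add: triangle_root_def)
next
  case (Suc n)
  have step: "triangle_root (Suc n) =
      (if triangle (Suc (triangle_root n)) - Suc n = 0 then Suc (triangle_root n) else triangle_root n)"
    by (simp add: triangle_root_def)
  show ?case unfolding step using Suc by auto
qed

lemma triangle_root_pair: "triangle_root (pair m n) = m + n"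
proof (rule ccontr)
  assume "triangle_root (pair m n) \<noteq> m + n"
  then have "Suc (triangle_root (pair m n)) \<le> m + n \<or> Suc (m + n) \<le> triangle_root (pair m n)"
    by auto
  then show False
    using triangle_root[of "pair m n"] triangle_mono[of "Suc (triangle_root (pair m n))" "m + n"]
      triangle_mono[of "Suc (m + n)" "triangle_root (pair m n)"]
    by (auto simp: prod_encode_def)
qed

lemma computable2_if_0:
  assumes "computable2 X f" "computable2 X g" "computable2 X h"
  shows "computable2 X (\<lambda>m n. if f m n = 0 then g m n else h m n)"
proof -
  obtain pf pg ph where p: "\<And>m n. runs X pf [m, n] (f m n)" "\<And>m n. runs X pg [m, n] (g m n)"
      "\<And>m n. runs X ph [m, n] (h m n)"
    using assms unfolding computable2_def by blast
  let ?c = "PrimRec (Proj 0) (Proj 3)"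
  have c: "runs X ?c [k, u, v] (if k = 0 then u else v)" for k u v
  proof (induction k)
    case 0
    show ?case by (auto intro!: runs_PrimRec_0 runs_Proj')
  next
    case (Suc k)
    show ?case by (rule runs_PrimRec_Suc[OF Suc]) (auto intro!: runs_Proj' simp: numeral_3_eq_3)
  qed
  have "runs X (Comp ?c [pf, pg, ph]) [m, n] (if f m n = 0 then g m n else h m n)" for m n
    by (rule runs_Comp[OF _ c]) (simp add: p)
  then show ?thesis by (rule computable2I)
qed

lemma computable_in_triangle_root: "computable_in X triangle_root"
  unfolding triangle_root_def
  by (intro computable_in_rec2 computable2_if_0 computable2_comp[OF computable2_minus]
      computable2_comp1[OF computable_in_triangle] computable2_comp1[OF computable_in_Suc]
      computable2_fst computable2_snd)

lemma computable_in_pfst': "computable_in X pfst"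
proof -
  have "pfst = (\<lambda>n. n - triangle (triangle_root n))"
  proof
    show "pfst n = n - triangle (triangle_root n)" for n
      by (rule pair_exhaust[of n]) (simp add: triangle_root_pair, simp add: prod_encode_def)
  qed
  show ?thesis unfolding \<open>pfst = _\<close>
    by (auto intro!: computable_in_comp2[OF computable2_minus]
      computable_in_comp[OF computable_in_triangle] computable_in_triangle_root)
qed

lemma computable_in_psnd': "computable_in X psnd"
proof -
  have "psnd = (\<lambda>n. triangle_root n - pfst n)"
  proof
    show "psnd n = triangle_root n - pfst n" for n
      by (rule pair_exhaust[of n]) (simp add: triangle_root_pair)
  qed
  show ?thesis unfolding \<open>psnd = _\<close>
    by (auto intro!: computable_in_comp2[OF computable2_minus]
      computable_in_pfst' computable_in_triangle_root)
qed

lemmas computable_in_pfst = computable_in_comp[OF computable_in_pfst']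
lemmas computable_in_psnd = computable_in_comp[OF computable_in_psnd']
lemmas computable_in_pair = computable_in_comp2[OF computable2_pair]
lemmas computable_in_plus = computable_in_comp2[OF computable2_plus]
lemmas computable_in_minus = computable_in_comp2[OF computable2_minus]
lemmas computable_in_Suc' = computable_in_comp[OF computable_in_Suc]

text \<open>Bound, start value and step may all depend on the parameter \<open>z\<close>; the step
  is assumed computable on a coded triple. Rules of this shape decompose a goal about
  \<open>\<lambda>z. ...\<close> along the syntax of its body.\<close>

lemma computable_in_rec_nat:
  assumes a: "computable_in X a" and g: "computable_in X g"
    and h: "computable_in X (\<lambda>x. h (pfst x) (pfst (psnd x)) (psnd (psnd x)))"
  shows "computable_in X (\<lambda>z. rec_nat (g z) (\<lambda>n y. h n y z) (a z))"
proof -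
  obtain pa pg ph pp where p: "\<And>n. runs X pa [n] (a n)" "\<And>n. runs X pg [n] (g n)"
      "\<And>x. runs X ph [x] (h (pfst x) (pfst (psnd x)) (psnd (psnd x)))"
      "\<And>m n. runs X pp [m, n] (pair m n)"
    using assms computable2_pair[of X] unfolding computable2_def computable_in_def by blast
  let ?q = "PrimRec pg (Comp ph [Comp pp [Proj 0, Comp pp [Proj 1, Proj 2]]])"
  have "runs X ?q [m, z] (rec_nat (g z) (\<lambda>n y. h n y z) m)" for m z
  proof (induction m)
    case 0
    show ?case using p by (auto intro!: runs_PrimRec_0)
  next
    case (Suc m)
    have "runs X (Comp pp [Proj 0, Comp pp [Proj 1, Proj 2]]) [m, y, z] (pair m (pair y z))" for y
      by (rule runs_Comp2[OF _ runs_Comp2[OF _ _ p(4)] p(4)]) (auto intro!: runs_Proj')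
    then have "runs X (Comp ph [Comp pp [Proj 0, Comp pp [Proj 1, Proj 2]]]) [m, y, z] (h m y z)" for y
      using p(3)[of "pair m (pair y z)"] by (auto intro: runs_Comp1)
    then show ?case using runs_PrimRec_Suc[OF Suc] by (simp del: One_nat_def)
  qed
  then have "runs X (Comp ?q [pa, Proj 0]) [z] (rec_nat (g z) (\<lambda>n y. h n y z) (a z))" for z
    by (auto intro!: runs_Comp2 p runs_Proj')
  then show ?thesis unfolding computable_in_def by blast
qed

lemma computable_in_compose2:
  assumes "computable_in X (\<lambda>x. h (pfst x) (psnd x))" "computable_in X f" "computable_in X g"
  shows "computable_in X (\<lambda>x. h (f x) (g x))"
  using computable_in_comp[OF assms(1) computable_in_pair[OF assms(2,3)]] by simp

lemma empty_reducible: "{} \<le>\<^sub>T X"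
  unfolding turing_reducible_def using computable_in_const[of X 0] by simp

lemma computable_in_empty: "computable_in {} f \<Longrightarrow> computable_in X f"
  by (rule computable_in_trans[OF _ empty_reducible])

section \<open>Decidable and semidecidable predicates\<close>

definition decidable_in :: "nat set \<Rightarrow> (nat \<Rightarrow> bool) \<Rightarrow> bool" where
  "decidable_in X P \<longleftrightarrow> computable_in X (\<lambda>n. of_bool (P n))"

lemma decidable_in_comp: "decidable_in X P \<Longrightarrow> computable_in X f \<Longrightarrow> decidable_in X (\<lambda>x. P (f x))"
  unfolding decidable_in_def by (rule computable_in_comp)

lemma decidable_in_compose2:
  "decidable_in X (\<lambda>x. P (pfst x) (psnd x)) \<Longrightarrow> computable_in X f \<Longrightarrow> computable_in X g
    \<Longrightarrow> decidable_in X (\<lambda>x. P (f x) (g x))"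
  unfolding decidable_in_def by (rule computable_in_compose2)

lemma decidable_in_empty: "decidable_in {} P \<Longrightarrow> decidable_in X P"
  unfolding decidable_in_def by (rule computable_in_empty)

lemma decidable_in_reducible_set: "Y \<le>\<^sub>T X \<Longrightarrow> decidable_in X (\<lambda>n. n \<in> Y)"
  unfolding decidable_in_def turing_reducible_def .

lemma decidable_in_0: 
  assumes "computable_in X f"
  shows "decidable_in X (\<lambda>x. f x = 0)"
proof -
  have "(\<lambda>x. of_bool (f x = 0)) = (\<lambda>x. 1 - f x)" by auto
  then show ?thesis unfolding decidable_in_def
    by (auto intro!: computable_in_minus computable_in_const assms)
qed

lemma decidable_in_not:
  assumes "decidable_in X P"
  shows "decidable_in X (\<lambda>x. \<not> P x)"
  using decidable_in_0[OF assms[unfolded decidable_in_def]] by simp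

lemma computable_in_If:
  assumes "decidable_in X P" "computable_in X f" "computable_in X g"
  shows "computable_in X (\<lambda>x. if P x then f x else g x)"
proof -
  have "(\<lambda>x. if P x then f x else g x) = (\<lambda>x. if of_bool (P x) = (0::nat) then g x else f x)" by auto
  then show ?thesis
    using computable_in_if[OF assms(1)[unfolded decidable_in_def] assms(3,2)] by simp
qed

lemma decidable_in_const: "decidable_in X (\<lambda>x. b)"
  unfolding decidable_in_def by (rule computable_in_const)

lemma decidable_in_If:
  assumes "decidable_in X P" "decidable_in X Q" "decidable_in X R"
  shows "decidable_in X (\<lambda>x. if P x then Q x else R x)"
  using computable_in_If[OF assms[unfolded decidable_in_def[of X Q] decidable_in_def[of X R]]]
  unfolding decidable_in_def by (simp add: if_distrib)

lemma decidable_in_and: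
  assumes "decidable_in X P" "decidable_in X Q"
  shows "decidable_in X (\<lambda>x. P x \<and> Q x)"
  using decidable_in_If[OF assms decidable_in_const[of X False]]
  by (rule back_subst[of "decidable_in X"]) auto

lemma decidable_in_or:
  assumes "decidable_in X P" "decidable_in X Q"
  shows "decidable_in X (\<lambda>x. P x \<or> Q x)"
  using decidable_in_If[OF assms(1) decidable_in_const[of X True] assms(2)]
  by (rule back_subst[of "decidable_in X"]) auto

lemma decidable_in_imp:
  assumes "decidable_in X P" "decidable_in X Q"
  shows "decidable_in X (\<lambda>x. P x \<longrightarrow> Q x)"
  using decidable_in_or[OF decidable_in_not[OF assms(1)] assms(2)]
  by (rule back_subst[of "decidable_in X"]) auto

lemma decidable_in_iff:
  assumes "decidable_in X P" "decidable_in X Q"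
  shows "decidable_in X (\<lambda>x. P x \<longleftrightarrow> Q x)"
  using decidable_in_and[OF decidable_in_imp[OF assms] decidable_in_imp[OF assms(2,1)]]
  by (rule back_subst[of "decidable_in X"]) auto

lemma decidable_in_le:
  assumes "computable_in X f" "computable_in X g"
  shows "decidable_in X (\<lambda>x. f x \<le> g x)"
  using decidable_in_0[OF computable_in_minus[OF assms]] by simp

lemma decidable_in_less:
  assumes "computable_in X f" "computable_in X g"
  shows "decidable_in X (\<lambda>x. f x < g x)"
  using decidable_in_not[OF decidable_in_le[OF assms(2,1)]] by (simp add: not_le)

lemma decidable_in_eq:
  assumes "computable_in X f" "computable_in X g"
  shows "decidable_in X (\<lambda>x. f x = g x)"
  using decidable_in_and[OF decidable_in_le[OF assms] decidable_in_le[OF assms(2,1)]]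
  by (simp add: order_eq_iff)

lemma decidable_in_all_less:
  assumes "computable_in X a" "decidable_in X (\<lambda>x. P (pfst x) (psnd x))"
  shows "decidable_in X (\<lambda>x. \<forall>m<a x. P m x)"
proof -
  have "rec_nat 1 (\<lambda>m y. if P m x then y else 0) n = (of_bool (\<forall>m<n. P m x) :: nat)" for n x
    by (induction n) (auto simp: less_Suc_eq)
  moreover have "computable_in X
      (\<lambda>x. rec_nat ((\<lambda>_. 1) x) (\<lambda>m y. (\<lambda>m y x. if P m x then y else 0) m y x) (a x))"
    by (intro computable_in_rec_nat computable_in_If assms computable_in_const computable_in_pfst
        computable_in_psnd computable_in_id decidable_in_compose2[OF assms(2)])
  ultimately show ?thesis unfolding decidable_in_def by simp
qed

lemma decidable_in_ex_less:
  assumes "computable_in X a" "decidable_in X (\<lambda>x. P (pfst x) (psnd x))"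
  shows "decidable_in X (\<lambda>x. \<exists>m<a x. P m x)"
  using decidable_in_not[OF decidable_in_all_less[OF assms(1) decidable_in_not[OF assms(2)]]]
  by simp

text \<open>The equivalence also determines where the program diverges. Hence the same program
  computes least witnesses and has as its domain the projection of a decidable relation.\<close>

lemma search_program:
  assumes "decidable_in X (\<lambda>x. P (pfst x) (psnd x))"
  shows "\<exists>p. \<forall>m n. runs X p [n] m \<longleftrightarrow> P m n \<and> (\<forall>k<m. \<not> P k n)"
proof -
  obtain pa pp where p: "\<And>x. runs X pa [x] (of_bool (\<not> P (pfst x) (psnd x)))"
      "\<And>m n. runs X pp [m, n] (pair m n)"
    using decidable_in_not[OF assms] computable2_pair[of X]
    unfolding computable2_def computable_in_def decidable_in_def by blast
  let ?q = "Comp pa [Comp pp [Proj 0, Proj 1]]"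
  have q: "runs X ?q [m, n] (of_bool (\<not> P m n))" for m n
  proof (rule runs_Comp1)
    show "runs X (Comp pp [Proj 0, Proj 1]) [m, n] (pair m n)"
      by (rule runs_Comp2[OF _ _ p(2)]) (auto intro!: runs_Proj')
    show "runs X pa [pair m n] (of_bool (\<not> P m n))" using p(1)[of "pair m n"] by simp
  qed
  have "runs X (Mu ?q) [n] m \<longleftrightarrow> P m n \<and> (\<forall>k<m. \<not> P k n)" for m n
  proof
    assume "runs X (Mu ?q) [n] m"
    then have "runs X ?q [m, n] 0" "\<forall>k<m. \<exists>y>0. runs X ?q [k, n] y"
      by (cases rule: runs.cases; auto)+
    with q show "P m n \<and> (\<forall>k<m. \<not> P k n)"
      by (metis (full_types) of_bool_eq(1) of_bool_eq(2) zero_neq_one less_irrefl runs_deterministic)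
  next
    assume "P m n \<and> (\<forall>k<m. \<not> P k n)"
    then show "runs X (Mu ?q) [n] m"
      using q[of m n] q[of _ n] by (intro runs_Mu) (auto, metis of_bool_eq(2) zero_less_one)
  qed
  then show ?thesis by blast
qed

lemma computable_in_Least:
  assumes "decidable_in X (\<lambda>x. P (pfst x) (psnd x))" "\<And>n. \<exists>m. P m n"
  shows "computable_in X (\<lambda>n. LEAST m. P m n)"
proof -
  obtain p where p: "\<And>m n. runs X p [n] m \<longleftrightarrow> P m n \<and> (\<forall>k<m. \<not> P k n)"
    using search_program[OF assms(1)] by blast
  have "runs X p [n] (LEAST m. P m n)" for n
    unfolding p using assms(2)[of n] by (meson LeastI_ex not_less_Least)
  then show ?thesis unfolding computable_in_def by blast
qed

text \<open>With projections of decidable relations as the primary notion, closure under connectives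
  and quantifiers needs only pairing and coded lists, and no interleaving of computations. The
  agreement with \<open>ce_set\<close> is proved in \<open>ce_set_semidecidable\<close> and
  \<open>semidecidable_ce_set\<close>; the latter needs an analysis of halting.\<close>

definition semidecidable_in :: "nat set \<Rightarrow> (nat \<Rightarrow> bool) \<Rightarrow> bool" where
  "semidecidable_in X P \<longleftrightarrow>
     (\<exists>R. decidable_in X (\<lambda>x. R (pfst x) (psnd x)) \<and> (\<forall>n. P n \<longleftrightarrow> (\<exists>s. R s n)))"

lemma semidecidable_inI:
  "decidable_in X (\<lambda>x. R (pfst x) (psnd x)) \<Longrightarrow> (\<And>n. P n \<longleftrightarrow> (\<exists>s. R s n)) \<Longrightarrow> semidecidable_in X P"
  unfolding semidecidable_in_def by blast

lemma semidecidable_inD: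
  assumes "semidecidable_in X P"
  shows "\<exists>R. decidable_in X R \<and> (\<forall>n. P n \<longleftrightarrow> (\<exists>s. R (pair s n)))"
proof -
  from assms[unfolded semidecidable_in_def] show ?thesis
  proof (elim exE conjE)
    fix R assume R: "decidable_in X (\<lambda>x. R (pfst x) (psnd x))" "\<forall>n. P n \<longleftrightarrow> (\<exists>s. R s n)"
    show ?thesis by (rule exI[of _ "\<lambda>x. R (pfst x) (psnd x)"]) (use R in simp)
  qed
qed

lemma semidecidable_in_decidable:
  assumes "decidable_in X P"
  shows "semidecidable_in X P"
  by (rule semidecidable_inI[of X "\<lambda>s n. P n"])
    (auto intro!: decidable_in_comp[OF assms] computable_in_psnd)

lemma semidecidable_in_comp:
  assumes "semidecidable_in X P" "computable_in X f"
  shows "semidecidable_in X (\<lambda>x. P (f x))"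
proof -
  obtain R where R: "decidable_in X R" "\<And>n. P n \<longleftrightarrow> (\<exists>s. R (pair s n))"
    using semidecidable_inD[OF assms(1)] by auto
  show ?thesis
    by (rule semidecidable_inI[of X "\<lambda>s n. R (pair s (f n))"])
      (auto simp: R(2) intro!: decidable_in_comp[OF R(1)] computable_in_pair computable_in_comp[OF assms(2)]
        computable_in_psnd computable_in_pfst)
qed

lemma semidecidable_in_ex:
  assumes "semidecidable_in X (\<lambda>x. P (pfst x) (psnd x))"
  shows "semidecidable_in X (\<lambda>x. \<exists>m. P m x)"
proof -
  obtain R where R: "decidable_in X R"
      "\<And>n. P (pfst n) (psnd n) \<longleftrightarrow> (\<exists>s. R (pair s n))"
    using semidecidable_inD[OF assms] by auto
  show ?thesis
  proof (rule semidecidable_inI[of X "\<lambda>s n. R (pair (pfst s) (pair (psnd s) n))"])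
    show "decidable_in X (\<lambda>x. R (pair (pfst (pfst x)) (pair (psnd (pfst x)) (psnd x))))"
      by (intro decidable_in_comp[OF R(1)] computable_in_pair computable_in_pfst
          computable_in_psnd computable_in_id)
    show "(\<exists>m. P m n) \<longleftrightarrow> (\<exists>s. R (pair (pfst s) (pair (psnd s) n)))" for n
      using R(2)[of "pair _ n"] by (metis pfst_pair psnd_pair)
  qed
qed

lemma semidecidable_in_and:
  assumes "semidecidable_in X P" "semidecidable_in X Q"
  shows "semidecidable_in X (\<lambda>x. P x \<and> Q x)"
proof -
  obtain R where R: "decidable_in X R" "\<And>n. P n \<longleftrightarrow> (\<exists>s. R (pair s n))"
    using semidecidable_inD[OF assms(1)] by auto
  obtain S where S: "decidable_in X S" "\<And>n. Q n \<longleftrightarrow> (\<exists>s. S (pair s n))"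
    using semidecidable_inD[OF assms(2)] by auto
  show ?thesis
  proof (rule semidecidable_inI[of X "\<lambda>s n. R (pair (pfst s) n) \<and> S (pair (psnd s) n)"])
    show "decidable_in X (\<lambda>x. R (pair (pfst (pfst x)) (psnd x)) \<and> S (pair (psnd (pfst x)) (psnd x)))"
      by (intro decidable_in_and decidable_in_comp[OF R(1)] decidable_in_comp[OF S(1)] computable_in_pair
          computable_in_pfst computable_in_psnd computable_in_id)
    show "(P n \<and> Q n) \<longleftrightarrow> (\<exists>s. R (pair (pfst s) n) \<and> S (pair (psnd s) n))" for n
      unfolding R(2) S(2) by (metis pfst_pair psnd_pair)
  qed
qed

lemma semidecidable_in_or:
  assumes "semidecidable_in X P" "semidecidable_in X Q"
  shows "semidecidable_in X (\<lambda>x. P x \<or> Q x)"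
proof -
  obtain R where R: "decidable_in X R" "\<And>n. P n \<longleftrightarrow> (\<exists>s. R (pair s n))"
    using semidecidable_inD[OF assms(1)] by auto
  obtain S where S: "decidable_in X S" "\<And>n. Q n \<longleftrightarrow> (\<exists>s. S (pair s n))"
    using semidecidable_inD[OF assms(2)] by auto
  show ?thesis
    by (rule semidecidable_inI[of X "\<lambda>s n. R (pair s n) \<or> S (pair s n)"])
      (auto simp: R(2) S(2) intro!: decidable_in_or R(1) S(1) simp: R(1) S(1))
qed

lemma semidecidable_in_imp:
  assumes "decidable_in X P" "semidecidable_in X Q"
  shows "semidecidable_in X (\<lambda>x. P x \<longrightarrow> Q x)"
  using semidecidable_in_or[OF semidecidable_in_decidable[OF decidable_in_not[OF assms(1)]] assms(2)]
  by (rule back_subst[of "semidecidable_in X"]) auto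

lemma semidecidable_in_If:
  assumes "decidable_in X P" "semidecidable_in X Q" "semidecidable_in X R"
  shows "semidecidable_in X (\<lambda>x. if P x then Q x else R x)"
  using semidecidable_in_and[OF semidecidable_in_imp[OF assms(1,2)]
      semidecidable_in_imp[OF decidable_in_not[OF assms(1)] assms(3)]]
  by (rule back_subst[of "semidecidable_in X"]) auto

section \<open>Codes of lists and finite sets\<close>

text \<open>A nonempty list has as its code the successor of a pair of its head and the code of its
  tail. Since 0 codes the empty list and \<open>psnd 0 = 0\<close>, the iteration stays at 0 past
  the end, and \<open>lnth\<close> has the default value 0 there.\<close>

definition ldrop :: "nat \<Rightarrow> nat \<Rightarrow> nat" where
  "ldrop c i = rec_nat c (\<lambda>_ y. psnd (y - 1)) i"

definition lnth :: "nat \<Rightarrow> nat \<Rightarrow> nat" where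
  "lnth c i = pfst (ldrop c i - 1)"

definition llen :: "nat \<Rightarrow> nat" where
  "llen c = (LEAST i. ldrop c i = 0)"

lemma pfst_0 [simp]: "pfst 0 = 0" and psnd_0 [simp]: "psnd 0 = 0"
  using pfst_pair[of 0 0] psnd_pair[of 0 0] by (auto simp: prod_encode_def)

lemma ldrop_encode: "ldrop (list_encode xs) i = list_encode (drop i xs)"
proof (induction i)
  case 0
  then show ?case by (simp add: ldrop_def)
next
  case (Suc i)
  have "ldrop (list_encode xs) (Suc i) = psnd (list_encode (drop i xs) - 1)"
    using Suc by (simp add: ldrop_def)
  also have "\<dots> = list_encode (tl (drop i xs))" by (cases "drop i xs") auto
  also have "tl (drop i xs) = drop (Suc i) xs" by (simp add: tl_drop drop_Suc)
  finally show ?case .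
qed

lemma list_encode_eq_0 [simp]: "list_encode xs = 0 \<longleftrightarrow> xs = []"
  by (cases xs) auto

lemma llen_encode [simp]: "llen (list_encode xs) = length xs"
  unfolding llen_def ldrop_encode by (rule Least_equality) auto

lemma lnth_encode: "lnth (list_encode xs) i = (if i < length xs then xs ! i else 0)"
  unfolding lnth_def ldrop_encode
  by (auto simp: Cons_nth_drop_Suc[symmetric])

lemma lnth_encode_less [simp]: "i < length xs \<Longrightarrow> lnth (list_encode xs) i = xs ! i"
  by (simp add: lnth_encode)

lemma llen_decode: "length (list_decode c) = llen c"
  using llen_encode[of "list_decode c"] by simp

lemma nth_decode: "i < llen c \<Longrightarrow> list_decode c ! i = lnth c i"
  using lnth_encode[of "list_decode c" i] by (simp add: llen_decode)

lemma ldrop_ex: "\<exists>i. ldrop c i = 0"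
proof
  show "ldrop c (length (list_decode c)) = 0"
    using ldrop_encode[of "list_decode c" "length (list_decode c)"] by simp
qed

lemma computable_in_ldrop:
  assumes "computable_in X f" "computable_in X g"
  shows "computable_in X (\<lambda>x. ldrop (f x) (g x))"
  unfolding ldrop_def
  by (intro computable_in_rec_nat computable_in_psnd computable_in_pfst computable_in_minus
      computable_in_const computable_in_id assms)

lemma computable_in_lnth:
  assumes "computable_in X f" "computable_in X g"
  shows "computable_in X (\<lambda>x. lnth (f x) (g x))"
  unfolding lnth_def
  by (intro computable_in_ldrop computable_in_pfst computable_in_minus
      computable_in_const computable_in_id assms)

lemma computable_in_llen:
  assumes "computable_in X f"
  shows "computable_in X (\<lambda>x. llen (f x))"
proof (rule computable_in_comp[OF _ assms])
  show "computable_in X llen" unfolding llen_def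
    by (intro computable_in_Least ldrop_ex decidable_in_0 computable_in_ldrop computable_in_pfst
        computable_in_psnd computable_in_id)
qed

lemma decidable_in_set_decode:
  assumes "computable_in X f" "computable_in X g"
  shows "decidable_in X (\<lambda>x. f x \<in> set_decode (g x))"
proof -
  have half: "n div 2 ^ i = rec_nat n (\<lambda>_ y. y div 2) i" for n i :: nat
  proof (induction i)
    case 0
    then show ?case by simp
  next
    case (Suc i)
    have "n div 2 ^ Suc i = n div 2 ^ i div 2" by (metis div_mult2_eq power_Suc2)
    with Suc show ?case by simp
  qed
  have "decidable_in X (\<lambda>x. \<not> (rec_nat (g x) (\<lambda>_ y. y div 2) (f x)) mod 2 = 0)"
    by (intro decidable_in_not decidable_in_0 computable_in_comp[OF computable_in_mod2]
        computable_in_rec_nat assms computable_in_comp[OF computable_in_div2] computable_in_pfst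
        computable_in_psnd computable_in_id)
  then show ?thesis
    by (rule back_subst[of "decidable_in X"])
      (auto simp: set_decode_def half odd_iff_mod_2_eq_one)
qed

lemmas computable_intros =
  computable_in_id computable_in_const computable_in_Suc' computable_in_plus computable_in_minus
  computable_in_pfst computable_in_psnd computable_in_pair computable_in_lnth computable_in_llen
  computable_in_If

lemmas decidable_intros = computable_intros
  decidable_in_const decidable_in_eq decidable_in_less decidable_in_le decidable_in_and
  decidable_in_or decidable_in_not decidable_in_imp decidable_in_iff decidable_in_If
  decidable_in_set_decode decidable_in_all_less decidable_in_ex_less

lemma set_decode_less: "x \<in> set_decode n \<Longrightarrow> x < n"
proof -
  assume "x \<in> set_decode n"
  then have "n div 2 ^ x \<noteq> 0" by (auto simp: set_decode_def intro: ccontr)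
  then have "2 ^ x \<le> n" by (auto simp: div_eq_0_iff not_less)
  then show "x < n" using less_exp[of x] by linarith
qed

text \<open>One coded list \<open>s\<close> collects the witnesses for all \<open>m < a x\<close>,
  so a single unbounded search suffices.\<close>

lemma semidecidable_in_all_less:
  assumes a: "computable_in X a" and P: "semidecidable_in X (\<lambda>x. P (pfst x) (psnd x))"
  shows "semidecidable_in X (\<lambda>x. \<forall>m<a x. P m x)"
proof -
  obtain R where R: "decidable_in X R"
      "\<And>n. P (pfst n) (psnd n) \<longleftrightarrow> (\<exists>s. R (pair s n))"
    using semidecidable_inD[OF P] by auto
  show ?thesis
  proof (rule semidecidable_inI[of X "\<lambda>s x. \<forall>m<a x. R (pair (lnth s m) (pair m x))"])
    show "decidable_in X (\<lambda>x. \<forall>m<a (psnd x). R (pair (lnth (pfst x) m) (pair m (psnd x))))"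
      by (intro decidable_in_comp[OF R(1)] decidable_intros computable_in_comp[OF a])
    fix x
    show "(\<forall>m<a x. P m x) \<longleftrightarrow> (\<exists>s. \<forall>m<a x. R (pair (lnth s m) (pair m x)))" (is "?l = ?r")
    proof
      assume ?l
      then have "\<forall>m<a x. \<exists>s. R (pair s (pair m x))" using R(2)[of "pair _ x"] by simp
      then obtain t where t: "\<forall>m<a x. R (pair (t m) (pair m x))" by metis
      then have "\<forall>m<a x. R (pair (lnth (list_encode (map t [0..<a x])) m) (pair m x))" by simp
      then show ?r by blast
    next
      assume ?r
      then show ?l using R(2)[of "pair _ x"] by auto
    qed
  qed
qed

lemma semidecidable_in_all_set_decode:
  assumes "computable_in X a" and "semidecidable_in X (\<lambda>x. P (pfst x) (psnd x))"
  shows "semidecidable_in X (\<lambda>x. \<forall>m\<in>set_decode (a x). P m x)"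
proof -
  have "semidecidable_in X (\<lambda>x. \<forall>m<a x. m \<in> set_decode (a x) \<longrightarrow> P m x)"
    by (intro semidecidable_in_all_less semidecidable_in_imp assms decidable_intros
        computable_in_comp[OF assms(1)])
  then show ?thesis
    by (rule back_subst[of "semidecidable_in X"]) (auto dest: set_decode_less)
qed

lemmas semidecidable_intros = semidecidable_in_ex
  semidecidable_in_and semidecidable_in_or semidecidable_in_If
  semidecidable_in_all_set_decode semidecidable_in_all_less semidecidable_in_imp

text \<open>A value and a witness of its correctness are searched for as one pair. The least correct
  value itself need not be computable.\<close>

lemma semidecidable_in_uniformize:
  assumes "semidecidable_in X (\<lambda>x. P (pfst x) (psnd x))" "\<And>n. \<exists>y. P n y"
  obtains f where "computable_in X f" "\<And>n. P n (f n)"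
proof -
  obtain R where R: "decidable_in X R"
      "\<And>n. P (pfst n) (psnd n) \<longleftrightarrow> (\<exists>s. R (pair s n))"
    using semidecidable_inD[OF assms(1)] by auto
  have ex: "\<exists>m. R (pair (psnd m) (pair n (pfst m)))" for n
    using assms(2)[of n] R(2)[of "pair n _"] by (metis pfst_pair psnd_pair)
  let ?f = "\<lambda>n. LEAST m. R (pair (psnd m) (pair n (pfst m)))"
  have "computable_in X ?f"
    by (intro computable_in_Least ex decidable_in_comp[OF R(1)] computable_intros)
  then have "computable_in X (\<lambda>n. pfst (?f n))" by (rule computable_in_pfst)
  moreover have "P n (pfst (?f n))" for n
    using LeastI_ex[OF ex[of n]] R(2)[of "pair n (pfst (?f n))"] by auto
  ultimately show ?thesis by (rule that)
qed

lemma computable_in_semidecidable_graph: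
  assumes "semidecidable_in X (\<lambda>x. f (pfst x) = psnd x)"
  shows "computable_in X f"
proof -
  obtain g where g: "computable_in X g" "\<And>n. f n = g n"
    by (rule semidecidable_in_uniformize[of X "\<lambda>n y. f n = y", OF assms]) auto
  have "f = g" by (rule ext) (rule g(2))
  with g(1) show ?thesis by simp
qed

lemma ce_set_semidecidable: 
  assumes "semidecidable_in {} (\<lambda>n. n \<in> S)"
  shows "ce_set S"
proof -
  obtain R where R: "decidable_in {} R" "\<And>n. n \<in> S \<longleftrightarrow> (\<exists>s. R (pair s n))"
    using semidecidable_inD[OF assms] by auto
  obtain p where p: "\<And>m n. runs {} p [n] m \<longleftrightarrow> R (pair m n) \<and> (\<forall>k<m. \<not> R (pair k n))"
    using search_program[of "{}" "\<lambda>m n. R (pair m n)"] R(1) by (simp, blast)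
  have "n \<in> S \<longleftrightarrow> (\<exists>y. runs {} p [n] y)" for n
    unfolding p R(2) by (rule exists_least_iff)
  then show ?thesis unfolding ce_set_def by blast
qed

section \<open>Computations from partial oracles\<close>

text \<open>As a relation between queries and answers, the oracle may leave queries open. A relation
  that grows with a bound yields the use principle; a semidecidable relation makes halting
  semidecidable. The graph of a set gives back \<open>runs\<close>.\<close>

inductive pruns :: "(nat \<Rightarrow> nat \<Rightarrow> bool) \<Rightarrow> prog \<Rightarrow> nat list \<Rightarrow> nat \<Rightarrow> bool"
  for Q :: "nat \<Rightarrow> nat \<Rightarrow> bool" where
  pruns_Zero: "pruns Q Zero xs 0"
| pruns_Succ: "pruns Q Succ [x] (Suc x)"
| pruns_Oracle: "Q x b \<Longrightarrow> pruns Q Oracle [x] b"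
| pruns_Proj: "i < length xs \<Longrightarrow> pruns Q (Proj i) xs (xs ! i)"
| pruns_Comp: "list_all2 (\<lambda>g y. pruns Q g xs y) gs ys \<Longrightarrow> pruns Q f ys z
    \<Longrightarrow> pruns Q (Comp f gs) xs z"
| pruns_PrimRec_0: "pruns Q f xs y \<Longrightarrow> pruns Q (PrimRec f g) (0 # xs) y"
| pruns_PrimRec_Suc: "pruns Q (PrimRec f g) (n # xs) y \<Longrightarrow> pruns Q g (n # y # xs) z
    \<Longrightarrow> pruns Q (PrimRec f g) (Suc n # xs) z"
| pruns_Mu: "pruns Q f (n # xs) 0 \<Longrightarrow> (\<forall>m<n. \<exists>y>0. pruns Q f (m # xs) y)
    \<Longrightarrow> pruns Q (Mu f) xs n"

inductive_cases pruns_ZeroE: "pruns Q Zero xs y"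
inductive_cases pruns_SuccE: "pruns Q Succ xs y"
inductive_cases pruns_OracleE: "pruns Q Oracle xs y"
inductive_cases pruns_ProjE: "pruns Q (Proj i) xs y"
inductive_cases pruns_PrimRec_NilE: "pruns Q (PrimRec f g) [] y"
inductive_cases pruns_MuE: "pruns Q (Mu f) xs y"

lemma runs_imp_pruns:
  assumes Q: "\<And>x. Q x (of_bool (x \<in> X))"
  shows "runs X p xs y \<Longrightarrow> pruns Q p xs y"
proof (induction p xs y rule: runs.induct)
  case (runs_Comp xs gs ys f z)
  then show ?case by (auto intro!: pruns_Comp[of _ _ _ ys] simp: list_all2_conv_all_nth)
next
  case (runs_Mu f n xs)
  then show ?case by (auto intro!: pruns_Mu)
next
  case (runs_Oracle x)
  show ?case by (rule pruns_Oracle) (rule Q)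
qed (auto intro: pruns.intros Q)

lemma pruns_imp_runs:
  assumes Q: "\<And>x b. Q x b \<Longrightarrow> b = of_bool (x \<in> X)"
  shows "pruns Q p xs y \<Longrightarrow> runs X p xs y"
proof (induction p xs y rule: pruns.induct)
  case (pruns_Comp xs gs ys f z)
  then show ?case by (auto intro!: runs_Comp[of _ _ _ ys] simp: list_all2_conv_all_nth)
next
  case (pruns_Mu f n xs)
  then show ?case by (auto intro!: runs_Mu)
next
  case (pruns_Oracle x b)
  then show ?case using runs_Oracle[of X x] Q by simp
qed (auto intro: runs.intros)

text \<open>A halting computation asks finitely many queries, all answered at some stage. Claiming
  the result for every later stage allows the bounds of the subcomputations to be combined by a
  maximum or a sum.\<close>

lemma pruns_use:
  assumes mono: "\<And>u v x b. u \<le> v \<Longrightarrow> Q u x b \<Longrightarrow> Q v x b"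
  shows "pruns (\<lambda>x b. \<exists>u::nat. Q u x b) p xs y \<Longrightarrow> \<exists>u. \<forall>v\<ge>u. pruns (Q v) p xs y"
proof (induction p xs y rule: pruns.induct)
  case (pruns_Oracle x b)
  then show ?case using mono by (blast intro: pruns.pruns_Oracle)
next
  case (pruns_Comp xs gs ys f z)
  then have len: "length gs = length ys" by (auto dest: list_all2_lengthD)
  have "\<forall>i<length gs. \<exists>u. \<forall>v\<ge>u. pruns (Q v) (gs ! i) xs (ys ! i)"
    using pruns_Comp.IH(1) by (auto simp: list_all2_conv_all_nth)
  then obtain u where u: "\<And>i v. i < length gs \<Longrightarrow> v \<ge> u i \<Longrightarrow> pruns (Q v) (gs ! i) xs (ys ! i)"
    by metis
  obtain w where w: "\<And>v. v \<ge> w \<Longrightarrow> pruns (Q v) f ys z" using pruns_Comp.IH(2) by auto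
  have "pruns (Q v) (Comp f gs) xs z" if v: "v \<ge> w + (\<Sum>i<length gs. u i)" for v
  proof (rule pruns.pruns_Comp)
    have "u i \<le> (\<Sum>i<length gs. u i)" if "i < length gs" for i
      using that by (intro member_le_sum) auto
    with v show "list_all2 (\<lambda>g y. pruns (Q v) g xs y) gs ys"
      by (auto simp: list_all2_conv_all_nth len[symmetric] intro!: u) (meson add_leD2 order_trans)
    show "pruns (Q v) f ys z" using v by (intro w) auto
  qed
  then show ?case by blast
next
  case (pruns_PrimRec_Suc f g n xs y z)
  then obtain u w where "\<And>v. v \<ge> u \<Longrightarrow> pruns (Q v) (PrimRec f g) (n # xs) y"
      "\<And>v. v \<ge> w \<Longrightarrow> pruns (Q v) g (n # y # xs) z" by auto
  then have "pruns (Q v) (PrimRec f g) (Suc n # xs) z" if "v \<ge> max u w" for v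
    using that by (auto intro: pruns.pruns_PrimRec_Suc)
  then show ?case by blast
next
  case (pruns_Mu f n xs)
  then have "\<forall>m. \<exists>u. m < n \<longrightarrow> (\<exists>y>0. \<forall>v\<ge>u. pruns (Q v) f (m # xs) y)" by blast
  then obtain u where u: "\<And>m. m < n \<Longrightarrow> \<exists>y>0. \<forall>v\<ge>u m. pruns (Q v) f (m # xs) y" by metis
  obtain w where w: "\<And>v. v \<ge> w \<Longrightarrow> pruns (Q v) f (n # xs) 0" using pruns_Mu.IH(1) by auto
  have "pruns (Q v) (Mu f) xs n" if v: "v \<ge> w + (\<Sum>i<n. u i)" for v
  proof (rule pruns.pruns_Mu)
    have "u m \<le> (\<Sum>i<n. u i)" if "m < n" for m
      using that by (intro member_le_sum) auto
    with v have "u m \<le> v" if "m < n" for m using that by (meson add_leD2 order_trans)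
    then show "\<forall>m<n. \<exists>y>0. pruns (Q v) f (m # xs) y" using u by blast
    show "pruns (Q v) f (n # xs) 0" using v by (intro w) auto
  qed
  then show ?case by blast
qed (blast intro: pruns.intros)+

section \<open>Halting relative to a semidecidable partial oracle\<close>

definition lcons :: "nat \<Rightarrow> nat \<Rightarrow> nat" where "lcons x c = Suc (pair x c)"

definition ltl :: "nat \<Rightarrow> nat" where "ltl c = psnd (c - 1)"

lemma list_decode_lcons [simp]: "list_decode (lcons x c) = x # list_decode c"
  by (simp add: lcons_def)

lemma list_decode_Cons:
  assumes "0 < llen c"
  shows "list_decode c = lnth c 0 # list_decode (ltl c)"
proof (cases "list_decode c")
  case Nil
  then show ?thesis using assms llen_decode[of c] by simp
next
  case (Cons x xs)
  then have "c = list_encode (x # xs)" using list_decode_inverse[of c] by simp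
  then show ?thesis using lnth_encode[of "x # xs" 0] by (simp add: ltl_def)
qed

lemma computable_in_lcons:
  assumes "computable_in X f" "computable_in X g"
  shows "computable_in X (\<lambda>x. lcons (f x) (g x))"
  unfolding lcons_def by (intro computable_intros assms)

lemma computable_in_ltl:
  assumes "computable_in X f"
  shows "computable_in X (\<lambda>x. ltl (f x))"
  unfolding ltl_def by (intro computable_intros assms)

lemma semidecidable_in_all_fixed:
  fixes k :: nat
  assumes "\<And>i. i < k \<Longrightarrow> semidecidable_in X (P i)"
  shows "semidecidable_in X (\<lambda>x. \<forall>i<k. P i x)"
  using assms
proof (induction k)
  case 0
  show ?case by (auto intro!: semidecidable_in_decidable decidable_in_const)
next
  case (Suc k)
  then have "semidecidable_in X (\<lambda>x. (\<forall>i<k. P i x) \<and> P k x)"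
    by (intro semidecidable_in_and) auto
  then show ?case by (rule back_subst[of "semidecidable_in X"]) (auto simp: less_Suc_eq)
qed

text \<open>The intermediate values become one number \<open>d\<close>, so the quantifier over lists
  turns into a search over numbers.\<close>

lemma pruns_Comp_iff: "pruns Q (Comp f gs) xs y \<longleftrightarrow>
  (\<exists>d. llen d = length gs \<and> (\<forall>i<length gs. pruns Q (gs ! i) xs (lnth d i)) \<and>
    pruns Q f (list_decode d) y)" (is "?l \<longleftrightarrow> ?r")
proof
  assume ?l
  then obtain ys where "list_all2 (\<lambda>g y. pruns Q g xs y) gs ys" "pruns Q f ys y"
    by (cases rule: pruns.cases) auto
  then show ?r by (intro exI[of _ "list_encode ys"]) (auto simp: list_all2_conv_all_nth)
next
  assume ?r
  then obtain d where "llen d = length gs" "\<forall>i<length gs. pruns Q (gs ! i) xs (lnth d i)"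
    "pruns Q f (list_decode d) y" by auto
  then show ?l
    by (intro pruns_Comp[of _ _ _ "list_decode d"])
      (auto simp: list_all2_conv_all_nth llen_decode nth_decode)
qed

text \<open>The number \<open>t\<close> codes the successive values of the recursion. Its
  correctness is a local condition, so halting of the recursion reduces to halting of
  \<open>f\<close> and \<open>g\<close> under a bounded quantifier.\<close>

lemma pruns_PrimRec_iff: "pruns Q (PrimRec f g) (n # xs) y \<longleftrightarrow>
  (\<exists>t. pruns Q f xs (lnth t 0) \<and> (\<forall>i<n. pruns Q g (i # lnth t i # xs) (lnth t (Suc i))) \<and>
    y = lnth t n)" (is "?l n y \<longleftrightarrow> ?r n y")
proof
  show "?l n y \<Longrightarrow> ?r n y"
  proof (induction n arbitrary: y)
    case 0
    then have "pruns Q f xs y" by (cases rule: pruns.cases) auto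
    then show ?case by (intro exI[of _ "list_encode [y]"]) (simp add: lnth_encode del: list_encode.simps)
  next
    case (Suc n)
    from Suc.prems obtain z where z: "?l n z" "pruns Q g (n # z # xs) y"
      by (cases rule: pruns.cases) auto
    then obtain t where t: "pruns Q f xs (lnth t 0)" "z = lnth t n"
        "\<And>i. i < n \<Longrightarrow> pruns Q g (i # lnth t i # xs) (lnth t (Suc i))" using Suc.IH by blast
    let ?t = "list_encode (map (lnth t) [0..<Suc n] @ [y])"
    have "lnth ?t i = (if i \<le> n then lnth t i else if i = Suc n then y else 0)" for i
      by (auto simp: lnth_encode nth_append simp del: upt_Suc)
    then show ?case using t z by (intro exI[of _ ?t]) (auto simp: less_Suc_eq)
  qed
next
  assume "?r n y"
  then obtain t where t: "pruns Q f xs (lnth t 0)" "y = lnth t n"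
     "\<And>i. i < n \<Longrightarrow> pruns Q g (i # lnth t i # xs) (lnth t (Suc i))" by blast
  have "i \<le> n \<Longrightarrow> ?l i (lnth t i)" for i
  proof (induction i)
    case 0
    show ?case by (rule pruns_PrimRec_0) (rule t(1))
  next
    case (Suc i)
    then show ?case using t(3)[of i] by (auto intro: pruns_PrimRec_Suc)
  qed
  then show "?l n y" using t(2) by blast
qed

lemma pruns_PrimRec_Nil: "\<not> pruns Q (PrimRec f g) [] y"
  by (auto elim: pruns_PrimRec_NilE)

lemma pruns_Mu_iff: "pruns Q (Mu f) xs n \<longleftrightarrow>
  pruns Q f (n # xs) 0 \<and> (\<forall>m<n. \<exists>y. 0 < y \<and> pruns Q f (m # xs) y)"
  by (auto elim!: pruns_MuE intro!: pruns_Mu)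

lemmas semidecidable_in_eq = semidecidable_in_decidable[OF decidable_in_eq]
lemmas semidecidable_in_less = semidecidable_in_decidable[OF decidable_in_less]
lemmas semidecidable_in_le = semidecidable_in_decidable[OF decidable_in_le]

text \<open>Induction on a fixed program takes the place of a universal machine. The oracle
  parameter, the arguments and the value stay arbitrary computable functions of \<open>z\<close>,
  because the subprograms run with searched numbers added to the input.\<close>

lemma semidecidable_in_pruns:
  assumes Q: "semidecidable_in X (\<lambda>z. Q (pfst z) (pfst (psnd z)) (psnd (psnd z)))"
  shows "computable_in X e \<Longrightarrow> computable_in X c \<Longrightarrow> computable_in X y \<Longrightarrow>
    semidecidable_in X (\<lambda>z. pruns (Q (e z)) p (list_decode (c z)) (y z))"
proof (induction p arbitrary: e c y)
  case Zero
  have eq: "pruns (Q (e z)) Zero (list_decode (c z)) (y z) \<longleftrightarrow> y z = 0" for z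
    by (auto elim!: pruns_ZeroE intro: pruns_Zero)
  show ?case unfolding eq by (intro semidecidable_in_eq computable_in_const Zero)
next
  case Succ
  have eq: "pruns (Q (e z)) Succ (list_decode (c z)) (y z) \<longleftrightarrow>
      llen (c z) = 1 \<and> y z = Suc (lnth (c z) 0)" for z
  proof -
    have "pruns (Q (e z)) Succ (list_decode (c z)) (y z) \<longleftrightarrow>
       length (list_decode (c z)) = 1 \<and> y z = Suc (list_decode (c z) ! 0)"
      by (cases "list_decode (c z)" rule: list.exhaust) (auto elim!: pruns_SuccE intro: pruns_Succ)
    then show ?thesis using nth_decode[of 0 "c z"] by (auto simp: llen_decode)
  qed
  show ?case unfolding eq by (intro semidecidable_in_and semidecidable_in_eq computable_intros Succ)
next
  case Oracle
  have eq: "pruns (Q (e z)) Oracle (list_decode (c z)) (y z) \<longleftrightarrow>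
      llen (c z) = 1 \<and> Q (e z) (lnth (c z) 0) (y z)" for z
  proof -
    have "pruns (Q (e z)) Oracle (list_decode (c z)) (y z) \<longleftrightarrow>
       length (list_decode (c z)) = 1 \<and> Q (e z) (list_decode (c z) ! 0) (y z)"
      by (cases "list_decode (c z)" rule: list.exhaust)
        (auto elim!: pruns_OracleE intro: pruns_Oracle)
    then show ?thesis using nth_decode[of 0 "c z"] by (auto simp: llen_decode)
  qed
  have "computable_in X (\<lambda>z. pair (e z) (pair (lnth (c z) 0) (y z)))"
    by (intro computable_intros Oracle)
  from semidecidable_in_comp[OF Q this]
  have "semidecidable_in X (\<lambda>z. Q (e z) (lnth (c z) 0) (y z))" by simp
  then show ?case unfolding eq
    by (intro semidecidable_in_and semidecidable_in_eq computable_intros Oracle)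
next
  case (Proj i)
  have eq: "pruns (Q (e z)) (Proj i) (list_decode (c z)) (y z) \<longleftrightarrow>
      i < llen (c z) \<and> y z = lnth (c z) i" for z
  proof -
    have "pruns (Q (e z)) (Proj i) (list_decode (c z)) (y z) \<longleftrightarrow>
       i < length (list_decode (c z)) \<and> y z = list_decode (c z) ! i"
      by (auto elim!: pruns_ProjE intro: pruns_Proj)
    then show ?thesis using nth_decode[of i "c z"] by (auto simp: llen_decode)
  qed
  show ?case unfolding eq
    by (intro semidecidable_in_and semidecidable_in_eq semidecidable_in_less computable_intros Proj)
next
  case (Comp f gs)
  note prems = computable_in_comp[OF Comp.prems(1)] computable_in_comp[OF Comp.prems(2)]
    computable_in_comp[OF Comp.prems(3)]
  have "semidecidable_in X (\<lambda>x. pruns (Q (e (psnd x))) (gs ! i) (list_decode (c (psnd x)))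
      (lnth (pfst x) i))" if "i < length gs" for i
    by (intro Comp.IH(2)[OF nth_mem[OF that]] computable_intros prems)
  moreover have "semidecidable_in X (\<lambda>x. pruns (Q (e (psnd x))) f (list_decode (pfst x)) (y (psnd x)))"
    by (intro Comp.IH(1) computable_intros prems)
  ultimately show ?case unfolding pruns_Comp_iff
    by (intro semidecidable_in_ex semidecidable_in_and semidecidable_in_all_fixed
        semidecidable_in_eq computable_intros)
next
  case (PrimRec f g)
  have "pruns (Q (e z)) (PrimRec f g) (list_decode (c z)) (y z) \<longleftrightarrow> 0 < llen (c z) \<and>
      (\<exists>t. pruns (Q (e z)) f (list_decode (ltl (c z))) (lnth t 0) \<and>
        (\<forall>i<lnth (c z) 0. pruns (Q (e z)) g (list_decode (lcons i (lcons (lnth t i) (ltl (c z)))))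
           (lnth t (Suc i))) \<and> y z = lnth t (lnth (c z) 0))" (is "?l z \<longleftrightarrow> ?r z") for z
  proof (cases "0 < llen (c z)")
    case True
    then show ?thesis by (simp add: list_decode_Cons[OF True] pruns_PrimRec_iff)
  next
    case False
    then have "list_decode (c z) = []" using llen_decode[of "c z"] by simp
    with False show ?thesis by (simp add: pruns_PrimRec_Nil)
  qed
  note eq = this
  show ?case unfolding eq
    by (intro semidecidable_in_and semidecidable_in_ex semidecidable_in_all_less PrimRec.IH computable_intros computable_in_lcons
        computable_in_ltl semidecidable_in_eq semidecidable_in_less
        computable_in_comp[OF PrimRec.prems(1)]
        computable_in_comp[OF PrimRec.prems(2)] computable_in_comp[OF PrimRec.prems(3)])
next
  case (Mu f)
  have eq: "pruns (Q (e z)) (Mu f) (list_decode (c z)) (y z) \<longleftrightarrow>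
      pruns (Q (e z)) f (list_decode (lcons (y z) (c z))) 0 \<and>
      (\<forall>m<y z. \<exists>w. 0 < w \<and> pruns (Q (e z)) f (list_decode (lcons m (c z))) w)" for z
    by (simp add: pruns_Mu_iff)
  show ?case unfolding eq
    by (intro semidecidable_in_and semidecidable_in_ex semidecidable_in_all_less Mu.IH computable_intros computable_in_lcons
        semidecidable_in_less
        computable_in_comp[OF Mu.prems(1)]
        computable_in_comp[OF Mu.prems(2)] computable_in_comp[OF Mu.prems(3)])
qed

lemma computable_in_of_bool: "decidable_in X P \<Longrightarrow> computable_in X (\<lambda>x. of_bool (P x))"
  unfolding decidable_in_def .

lemma decidable_in_oracle: "computable_in X f \<Longrightarrow> decidable_in X (\<lambda>x. f x \<in> X)"
  by (rule decidable_in_comp[OF decidable_in_reducible_set[OF turing_reducible_refl]])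

lemma semidecidable_in_runs:
  assumes "computable_in X c" "computable_in X y"
  shows "semidecidable_in X (\<lambda>z. runs X p (list_decode (c z)) (y z))"
proof -
  have eq: "runs X p xs v \<longleftrightarrow> pruns (\<lambda>x b. b = of_bool (x \<in> X)) p xs v" for xs v
    using runs_imp_pruns[of "\<lambda>x b. b = of_bool (x \<in> X)" X]
      pruns_imp_runs[of "\<lambda>x b. b = of_bool (x \<in> X)" X] by auto
  show ?thesis unfolding eq
    by (intro semidecidable_in_pruns[of X "\<lambda>_ x b. b = of_bool (x \<in> X)" "\<lambda>_. 0"] assms
      semidecidable_in_eq computable_in_of_bool decidable_in_oracle computable_intros)
qed

lemma semidecidable_ce_set:
  assumes "ce_set S"
  shows "semidecidable_in {} (\<lambda>n. n \<in> S)"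
proof -
  obtain p where "\<And>n. n \<in> S \<longleftrightarrow> (\<exists>y. runs {} p [n] y)" using assms unfolding ce_set_def by blast
  then have eq: "n \<in> S \<longleftrightarrow> (\<exists>y. runs {} p (list_decode (lcons n 0)) y)" for n by simp
  show ?thesis unfolding eq
    by (intro semidecidable_in_ex semidecidable_in_runs computable_intros computable_in_lcons)
qed

lemma semidecidable_in_empty:
  assumes "semidecidable_in {} P"
  shows "semidecidable_in X P"
  using assms unfolding semidecidable_in_def by (blast intro: decidable_in_empty)

text \<open>An oracle for \<open>Z \<oplus>\<^sub>T X\<close> that knows only the part of \<open>Z\<close> below \<open>u\<close>, given as the finite set
  with canonical index \<open>D\<close>.\<close>

definition join_part :: "nat set \<Rightarrow> nat \<Rightarrow> nat \<Rightarrow> nat \<Rightarrow> nat \<Rightarrow> bool" where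
  "join_part X u D x b \<longleftrightarrow>
     (if x mod 2 = 0 then x div 2 < u \<and> b = of_bool (x div 2 \<in> set_decode D)
      else b = of_bool (x div 2 \<in> X))"

definition agrees :: "nat \<Rightarrow> nat \<Rightarrow> nat set \<Rightarrow> bool" where
  "agrees u D Z \<longleftrightarrow> (\<forall>l<u. l \<in> set_decode D \<longleftrightarrow> l \<in> Z)"

lemma runs_join_part:
  assumes "agrees u D Z" "pruns (join_part X u D) p xs y"
  shows "runs (Z \<oplus>\<^sub>T X) p xs y"
  using assms(1) by (auto intro!: pruns_imp_runs[OF _ assms(2)]
      simp: join_part_def agrees_def mem_set_join split: if_splits)

text \<open>Only the queries to the \<open>Z\<close> half need a bound; the \<open>X\<close> half
  remains available as a whole. The claim covers all larger bounds, so that a bound can later be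
  enlarged to meet further requirements.\<close>

lemma join_part_use:
  assumes "runs (Z \<oplus>\<^sub>T X) p xs y"
  shows "\<exists>u. \<forall>v\<ge>u. \<forall>D. agrees v D Z \<longrightarrow> pruns (join_part X v D) p xs y"
proof -
  \<comment> \<open>\<open>Q u\<close> takes its answers below \<open>u\<close> from
    \<open>Z\<close> itself and is thus monotone in \<open>u\<close>. Every code \<open>D\<close>
    that agrees with \<open>Z\<close> below the bound gives the same relation.\<close>
  define Q where "Q u x b \<longleftrightarrow> (if x mod 2 = 0 then x div 2 < u \<and> b = of_bool (x div 2 \<in> Z)
      else b = of_bool (x div 2 \<in> X))" for u x b :: nat
  have "\<exists>u. Q u x (of_bool (x \<in> Z \<oplus>\<^sub>T X))" for x
    by (rule exI[of _ "Suc (x div 2)"]) (simp add: Q_def mem_set_join)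
  then have "pruns (\<lambda>x b. \<exists>u. Q u x b) p xs y"
    by (rule runs_imp_pruns[of "\<lambda>x b. \<exists>u. Q u x b", OF _ assms])
  moreover have "Q v x b" if "u \<le> v" "Q u x b" for u v x b
    using that unfolding Q_def by (auto simp del: mod_eq_0_iff_dvd even_iff_mod_2_eq_zero cong: if_cong)
  ultimately have "\<exists>u. \<forall>v\<ge>u. pruns (Q v) p xs y"
    using pruns_use[of Q p xs y] by blast
  then obtain u where u: "\<And>v. v \<ge> u \<Longrightarrow> pruns (Q v) p xs y" by blast
  have "Q v = join_part X v D" if "agrees v D Z" for v D
  proof (intro ext)
    fix x b
    have "x div 2 < v \<Longrightarrow> x div 2 \<in> set_decode D \<longleftrightarrow> x div 2 \<in> Z" using that by (simp add: agrees_def)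
    then show "Q v x b = join_part X v D x b"
      unfolding Q_def join_part_def by (cases "x div 2 < v") auto
  qed
  then have "pruns (join_part X v D) p xs y" if "v \<ge> u" "agrees v D Z" for v D
    using u[OF that(1)] that(2) by simp
  then show ?thesis by blast
qed

lemma semidecidable_in_join_part:
  assumes "computable_in X u" "computable_in X d" "computable_in X c" "computable_in X y"
  shows "semidecidable_in X (\<lambda>z. pruns (join_part X (u z) (d z)) p [c z] (y z))"
proof -
  have eq: "pruns (join_part X (u z) (d z)) p [c z] (y z) \<longleftrightarrow>
     pruns ((\<lambda>e. join_part X (pfst e) (psnd e)) (pair (u z) (d z))) p
       (list_decode (lcons (c z) 0)) (y z)" for z by simp
  show ?thesis unfolding eq
    by (intro semidecidable_in_pruns computable_intros computable_in_lcons assms,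
      unfold join_part_def, intro semidecidable_in_decidable decidable_intros
        computable_in_of_bool decidable_in_oracle
        computable_in_comp[OF computable_in_mod2] computable_in_comp[OF computable_in_div2])
qed

section \<open>Renaming the elements in a code of a literal\<close>

primrec ren_tm :: "(nat \<Rightarrow> nat) \<Rightarrow> tm \<Rightarrow> tm" where
  "ren_tm v (Elem a) = Elem (v a)"
| "ren_tm v (Fun s ts) = Fun s (map (ren_tm v) ts)"

primrec ren_atom :: "(nat \<Rightarrow> nat) \<Rightarrow> atom \<Rightarrow> atom" where
  "ren_atom v (Eq t u) = Eq (ren_tm v t) (ren_tm v u)"
| "ren_atom v (Rel r ts) = Rel r (map (ren_tm v) ts)"

primrec ren_literal :: "(nat \<Rightarrow> nat) \<Rightarrow> literal \<Rightarrow> literal" where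
  "ren_literal v (Pos \<phi>) = Pos (ren_atom v \<phi>)"
| "ren_literal v (Neg \<phi>) = Neg (ren_atom v \<phi>)"

lemma psnd_le: "psnd n \<le> n" and pfst_le: "pfst n \<le> n"
  by (metis pair_pfst_psnd le_prod_encode_2, metis pair_pfst_psnd le_prod_encode_1)

lemma list_decode_less: "x \<in> set (list_decode c) \<Longrightarrow> x < c"
proof (induction c rule: list_decode.induct)
  case (2 c)
  obtain a b where ab: "prod_decode c = (a, b)" by (cases "prod_decode c")
  then have c: "c = pair a b" by (metis prod_decode_inverse)
  show ?case
  proof (cases "x = a")
    case True
    then show ?thesis using le_prod_encode_1[of a b] c by simp
  next
    case False
    then have "x < b" using 2 ab by (auto split: prod.splits)
    then show ?thesis using le_prod_encode_2[of b a] c by simp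
  qed
qed simp

function ren_tm_code :: "(nat \<Rightarrow> nat) \<Rightarrow> nat \<Rightarrow> nat" where
  "ren_tm_code v n = (if pfst n = 0 then pair 0 (v (psnd n))
     else pair (pfst n) (list_encode (map (ren_tm_code v) (list_decode (psnd n)))))"
  by pat_completeness auto
termination
  by (relation "measure snd") (auto dest!: list_decode_less intro: less_le_trans[OF _ psnd_le])

declare ren_tm_code.simps [simp del]

text \<open>The first component, the sign of the literal, is kept. The code of a relational atom has
  the form of the code of a compound term, so \<open>ren_tm_code\<close> renames such atoms as
  well.\<close>

definition ren_code :: "(nat \<Rightarrow> nat) \<Rightarrow> nat \<Rightarrow> nat" where
  "ren_code v n = pair (pfst n)
     (if pfst (psnd n) = 0
      then pair 0 (pair (ren_tm_code v (pfst (psnd (psnd n)))) (ren_tm_code v (psnd (psnd (psnd n)))))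
      else ren_tm_code v (psnd n))"

lemma ren_tm_code: "ren_tm_code v (tm_code t) = tm_code (ren_tm v t)"
proof (induction t)
  case (Elem a)
  then show ?case by (simp add: ren_tm_code.simps)
next
  case (Fun s ts)
  then have "map (ren_tm_code v) (map tm_code ts) = map tm_code (map (ren_tm v) ts)" by simp
  then show ?case by (subst ren_tm_code.simps) (simp del: map_map)
qed

lemma ren_code_atom: "ren_code v (pair i (atom_code \<phi>)) = pair i (atom_code (ren_atom v \<phi>))"
proof -
  have "map (ren_tm_code v) (map tm_code ts) = map tm_code (map (ren_tm v) ts)" for ts
    by (simp add: ren_tm_code)
  then show ?thesis
    by (cases \<phi>)
      (auto simp: ren_code_def ren_tm_code ren_tm_code.simps[of v "pair (Suc _) _"] simp del: map_map)
qed

lemma ren_code: "ren_code v (literal_code l) = literal_code (ren_literal v l)"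
  by (cases l) (simp_all add: ren_code_atom)

lemma ren_tm_code_cong:
  "(\<And>a. a \<le> n \<Longrightarrow> v a = w a) \<Longrightarrow> ren_tm_code v n = ren_tm_code w n"
proof (induction n rule: less_induct)
  case (less n)
  have "ren_tm_code v m = ren_tm_code w m" if "m \<in> set (list_decode (psnd n))" for m
    using list_decode_less[OF that] psnd_le[of n] by (intro less) auto
  then have "map (ren_tm_code v) (list_decode (psnd n)) = map (ren_tm_code w) (list_decode (psnd n))"
    by simp
  moreover have "v (psnd n) = w (psnd n)" by (rule less.prems) (rule psnd_le)
  ultimately show ?case by (subst (1 2) ren_tm_code.simps) (simp add: list_encode_eq)
qed

text \<open>Components of pairs and entries of lists are bounded by their codes, so a code bounds
  every element it names. This is why the bits below \<open>u\<close> of the diagram of a copy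
  depend only on the first \<open>u\<close> values of the renaming.\<close>

lemma ren_code_cong:
  assumes "\<And>a. a < u \<Longrightarrow> v a = w a" "n < u"
  shows "ren_code v n = ren_code w n"
proof -
  have "ren_tm_code v m = ren_tm_code w m" if "m \<le> n" for m
    using assms that by (intro ren_tm_code_cong) auto
  then show ?thesis
    unfolding ren_code_def by (simp add: psnd_le order_trans[OF psnd_le] order_trans[OF pfst_le])
qed

lemma ren_tm_code_comp: "ren_tm_code g (ren_tm_code v n) = ren_tm_code (g \<circ> v) n"
proof (induction n rule: less_induct)
  case (less n)
  have "ren_tm_code g (ren_tm_code v m) = ren_tm_code (g \<circ> v) m"
    if "m \<in> set (list_decode (psnd n))" for m
    using list_decode_less[OF that] psnd_le[of n] by (intro less) auto
  then have eq: "map (ren_tm_code g) (map (ren_tm_code v) (list_decode (psnd n))) =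
      map (ren_tm_code (g \<circ> v)) (list_decode (psnd n))"
    by simp
  show ?case
  proof (cases "pfst n = 0")
    case True
    then show ?thesis by (simp add: ren_tm_code.simps)
  next
    case False
    then show ?thesis
      using eq by (simp only: ren_tm_code.simps[of v n] ren_tm_code.simps[of "g \<circ> v" n]
          ren_tm_code.simps[of g "pair _ _"] if_False pfst_pair psnd_pair list_encode_inverse)
  qed
qed

lemma ren_code_comp: "ren_code g (ren_code v n) = ren_code (g \<circ> v) n"
  by (simp add: ren_code_def ren_tm_code_comp) (simp add: ren_tm_code.simps[of v "psnd n"])

text \<open>Since terms and atoms exhaust all numbers, a number fails to code a literal only because
  of its sign component. Renaming preserves that component, which allows
  \<open>atomic_diagram_ren\<close> to speak of arbitrary numbers.\<close>

lemma tm_code_surj: "\<exists>t. tm_code t = n"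
proof (induction n rule: less_induct)
  case (less n)
  obtain s k where n: "n = pair s k" by (rule pair_exhaust)
  show ?case
  proof (cases s)
    case 0
    then show ?thesis using n by (intro exI[of _ "Elem k"]) simp
  next
    case (Suc s')
    have "\<exists>t. tm_code t = m" if "m \<in> set (list_decode k)" for m
      using list_decode_less[OF that] psnd_le[of n] n by (intro less) auto
    then obtain f where f: "\<And>m. m \<in> set (list_decode k) \<Longrightarrow> tm_code (f m) = m" by metis
    then have "map tm_code (map f (list_decode k)) = list_decode k" by (simp add: map_idI)
    then show ?thesis using n Suc
      by (intro exI[of _ "Fun s' (map f (list_decode k))"]) (simp del: map_map)
  qed
qed

lemma atom_code_surj: "\<exists>\<phi>. atom_code \<phi> = n"
proof -
  obtain s k where n: "n = pair s k" by (rule pair_exhaust)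
  show ?thesis
  proof (cases s)
    case 0
    obtain i j where k: "k = pair i j" by (rule pair_exhaust)
    obtain t u where "tm_code t = i" "tm_code u = j" using tm_code_surj by metis
    then show ?thesis using n k 0 by (intro exI[of _ "Eq t u"]) simp
  next
    case (Suc r)
    have "\<exists>ts. map tm_code ts = list_decode k"
      by (metis ex_map_conv tm_code_surj)
    then show ?thesis using n Suc by (metis atom_code.simps(2) list_decode_inverse)
  qed
qed

lemma tm_code_inject: "tm_code t = tm_code t' \<Longrightarrow> t = t'"
proof (induction t arbitrary: t')
  case (Elem a)
  then show ?case by (cases t') auto
next
  case (Fun s ts)
  then obtain ts' where t': "t' = Fun s ts'" by (cases t') auto
  with Fun.prems have "map tm_code ts = map tm_code ts'" by (simp add: list_encode_eq)
  then have "ts = ts'"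
    using Fun.IH by (metis length_map nth_equalityI nth_map nth_mem)
  with t' show ?case by simp
qed

lemma literal_code_inject: "literal_code l = literal_code l' \<Longrightarrow> l = l'"
proof -
  have "map tm_code ts = map tm_code ts' \<Longrightarrow> ts = ts'" for ts ts'
    using tm_code_inject by (metis inj_onI map_injective)
  then have "atom_code \<phi> = atom_code \<psi> \<Longrightarrow> \<phi> = \<psi>" for \<phi> \<psi>
    by (cases \<phi>; cases \<psi>) (auto simp: list_encode_eq dest: tm_code_inject)
  then show "literal_code l = literal_code l' \<Longrightarrow> l = l'"
    by (cases l; cases l') auto
qed

section \<open>Renaming along isomorphisms and the diagrams of copies\<close>

lemma wf_ren_tm [simp]: "wf_tm L (ren_tm v t) \<longleftrightarrow> wf_tm L t"
  by (induction t) auto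

lemma wf_ren_literal [simp]: "wf_literal L (ren_literal v l) \<longleftrightarrow> wf_literal L l"
proof -
  have "wf_atom L (ren_atom v \<phi>) \<longleftrightarrow> wf_atom L \<phi>" for \<phi> by (cases \<phi>) auto
  then show ?thesis by (cases l) auto
qed

lemma tm_value_ren:
  assumes "is_isomorphism L N M g"
  shows "wf_tm L t \<Longrightarrow> tm_value M (ren_tm g t) = g (tm_value N t)"
proof (induction t)
  case (Fun s ts)
  then have "map (tm_value M \<circ> ren_tm g) ts = map g (map (tm_value N) ts)" by auto
  then show ?case using assms Fun.prems unfolding is_isomorphism_def
    by (metis length_map map_map ren_tm.simps(2) tm_value.simps(2) wf_tm.simps(2))
qed simp

lemma sat_ren_literal:
  assumes g: "is_isomorphism L N M g" and wf: "wf_literal L l"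
  shows "sat_literal M (ren_literal g l) \<longleftrightarrow> sat_literal N l"
proof -
  have "sat_atom M (ren_atom g \<phi>) \<longleftrightarrow> sat_atom N \<phi>" if "wf_atom L \<phi>" for \<phi>
  proof (cases \<phi>)
    case (Eq t u)
    have "inj g" using g by (simp add: is_isomorphism_def bij_is_inj)
    then show ?thesis using that Eq by (simp add: tm_value_ren[OF g] inj_eq)
  next
    case (Rel r ts)
    then have "map (tm_value M \<circ> ren_tm g) ts = map g (map (tm_value N) ts)"
      using that by (auto simp: tm_value_ren[OF g])
    then show ?thesis using g that Rel unfolding is_isomorphism_def
      by (metis length_map map_map ren_atom.simps(2) sat_atom.simps(2) wf_atom.simps(2))
  qed
  then show ?thesis using wf by (cases l) auto
qed

lemma atomic_diagram_ren:
  assumes g: "is_isomorphism L N M g"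
  shows "ren_code g n \<in> atomic_diagram L M \<longleftrightarrow> n \<in> atomic_diagram L N"
proof
  assume "n \<in> atomic_diagram L N"
  then obtain l where "n = literal_code l" "wf_literal L l" "sat_literal N l"
    unfolding atomic_diagram_def by blast
  then show "ren_code g n \<in> atomic_diagram L M"
    unfolding atomic_diagram_def using sat_ren_literal[OF g] by (auto simp: ren_code)
next
  assume "ren_code g n \<in> atomic_diagram L M"
  then obtain l' where l': "ren_code g n = literal_code l'" "wf_literal L l'" "sat_literal M l'"
    unfolding atomic_diagram_def by blast
  obtain i k where n: "n = pair i k" by (rule pair_exhaust)
  obtain \<phi> where k: "k = atom_code \<phi>" using atom_code_surj by metis
  have "i = 0 \<or> i = 1" using l'(1) n by (cases l') (auto simp: ren_code_def)
  then have "\<exists>l. n = literal_code l" using n k by (metis literal_code.simps)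
  then obtain l where l: "n = literal_code l" ..
  then have "ren_literal g l = l'" using l'(1) by (auto simp: ren_code intro: literal_code_inject)
  then show "n \<in> atomic_diagram L N"
    using l l' sat_ren_literal[OF g, of l] unfolding atomic_diagram_def by auto
qed

definition diagram_along :: "language \<Rightarrow> struct \<Rightarrow> (nat \<Rightarrow> nat) \<Rightarrow> nat set" where
  "diagram_along L M v = {l. ren_code v l \<in> atomic_diagram L M}"

definition pullback :: "struct \<Rightarrow> (nat \<Rightarrow> nat) \<Rightarrow> struct" where
  "pullback M v = \<lparr>fun_interp = (\<lambda>s xs. inv v (fun_interp M s (map v xs))),
     rel_interp = (\<lambda>r xs. rel_interp M r (map v xs))\<rparr>"

lemma pullback_isomorphism: "bij v \<Longrightarrow> is_isomorphism L (pullback M v) M v"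
  unfolding is_isomorphism_def pullback_def by (simp add: bij_is_surj surj_f_inv_f)

lemma atomic_diagram_pullback:
  "bij v \<Longrightarrow> atomic_diagram L (pullback M v) = diagram_along L M v"
  using atomic_diagram_ren[OF pullback_isomorphism] unfolding diagram_along_def by blast

lemma diagram_along_cong:
  "(\<And>a. a < u \<Longrightarrow> v a = w a) \<Longrightarrow> l < u \<Longrightarrow> l \<in> diagram_along L M v \<longleftrightarrow> l \<in> diagram_along L M w"
  unfolding diagram_along_def using ren_code_cong[of u v w l] by simp

lemma diagram_along_isomorphism:
  "is_isomorphism L N M g \<Longrightarrow> diagram_along L M (g \<circ> v) = diagram_along L N v"
  unfolding diagram_along_def ren_code_comp[symmetric] by (simp add: atomic_diagram_ren)

text \<open>The recursion of \<open>ren_tm_code\<close> nests through lists. It is computed by a search for the table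
  \<open>t\<close> of its values up to \<open>n\<close>, whose correctness is a local condition.\<close>

definition ren_table :: "nat \<Rightarrow> nat \<Rightarrow> nat \<Rightarrow> bool" where
  "ren_table c n t \<longleftrightarrow> (\<forall>m<Suc n.
     if pfst m = 0 then lnth t m = pair 0 (lnth c (psnd m))
     else pfst (lnth t m) = pfst m \<and> llen (psnd (lnth t m)) = llen (psnd m) \<and>
       (\<forall>i<llen (psnd m). lnth (psnd (lnth t m)) i = lnth t (lnth (psnd m) i)))"

lemma list_code_eqI:
  assumes "llen c = length xs" "\<And>i. i < length xs \<Longrightarrow> lnth c i = xs ! i"
  shows "c = list_encode xs"
proof -
  have "list_decode c = xs"
    by (rule nth_equalityI) (use assms in \<open>auto simp: llen_decode nth_decode\<close>)
  then show ?thesis by (metis list_decode_inverse)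
qed

lemma ren_table_sound:
  assumes "ren_table c n t"
  shows "m \<le> n \<Longrightarrow> lnth t m = ren_tm_code (lnth c) m"
proof (induction m rule: less_induct)
  case (less m)
  then have "m < Suc n" by simp
  with assms have t: "if pfst m = 0 then lnth t m = pair 0 (lnth c (psnd m))
     else pfst (lnth t m) = pfst m \<and> llen (psnd (lnth t m)) = llen (psnd m) \<and>
       (\<forall>i<llen (psnd m). lnth (psnd (lnth t m)) i = lnth t (lnth (psnd m) i))"
    unfolding ren_table_def by blast
  show ?case
  proof (cases "pfst m = 0")
    case True
    then show ?thesis using t by (simp add: ren_tm_code.simps)
  next
    case False
    have "psnd (lnth t m) = list_encode (map (ren_tm_code (lnth c)) (list_decode (psnd m)))"
    proof (rule list_code_eqI)
      show "llen (psnd (lnth t m)) = length (map (ren_tm_code (lnth c)) (list_decode (psnd m)))"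
        using t False by (simp add: llen_decode)
      fix i assume "i < length (map (ren_tm_code (lnth c)) (list_decode (psnd m)))"
      then have i: "i < llen (psnd m)" by (simp add: llen_decode)
      then have "lnth (psnd m) i \<in> set (list_decode (psnd m))"
        using nth_decode[OF i] nth_mem[of i "list_decode (psnd m)"] by (simp add: llen_decode)
      then have "lnth (psnd m) i < m" using list_decode_less psnd_le by (meson less_le_trans)
      then have "lnth t (lnth (psnd m) i) = ren_tm_code (lnth c) (lnth (psnd m) i)"
        using less by simp
      then show "lnth (psnd (lnth t m)) i = map (ren_tm_code (lnth c)) (list_decode (psnd m)) ! i"
        using t False i nth_decode[OF i] by (simp add: llen_decode)
    qed
    then show ?thesis
      using t False by (metis pair_pfst_psnd ren_tm_code.simps)
  qed
qed

lemma ren_table_complete: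
  "ren_table c n (list_encode (map (ren_tm_code (lnth c)) [0..<Suc n]))" (is "ren_table c n ?t")
  unfolding ren_table_def
proof (intro allI impI)
  fix m assume m: "m < Suc n"
  have t: "lnth ?t k = ren_tm_code (lnth c) k" if "k \<le> n" for k
    using that by (subst lnth_encode) (simp del: upt_Suc)
  have "lnth ?t (lnth (psnd m) i) = ren_tm_code (lnth c) (list_decode (psnd m) ! i)"
    if i: "i < llen (psnd m)" for i
  proof -
    have "list_decode (psnd m) ! i < psnd m"
      by (rule list_decode_less) (simp add: i llen_decode)
    then have "lnth (psnd m) i \<le> n" using nth_decode[OF i] psnd_le[of m] m by simp
    then show ?thesis using t nth_decode[OF i] by simp
  qed
  then show "if pfst m = 0 then lnth ?t m = pair 0 (lnth c (psnd m))
     else pfst (lnth ?t m) = pfst m \<and> llen (psnd (lnth ?t m)) = llen (psnd m) \<and>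
       (\<forall>i<llen (psnd m). lnth (psnd (lnth ?t m)) i = lnth ?t (lnth (psnd m) i))"
    using t[of m] m by (auto simp: ren_tm_code.simps[of _ m] llen_decode simp del: upt_Suc)
qed

lemma computable_in_ren_tm_code:
  assumes "computable_in X c" "computable_in X n"
  shows "computable_in X (\<lambda>z. ren_tm_code (lnth (c z)) (n z))"
proof (rule computable_in_compose2[OF _ assms])
  have eq: "ren_tm_code (lnth (pfst x)) (psnd x) = y \<longleftrightarrow>
     (\<exists>t. ren_table (pfst x) (psnd x) t \<and> lnth t (psnd x) = y)" for x y
    using ren_table_sound ren_table_complete by (metis order_refl)
  show "computable_in X (\<lambda>x. ren_tm_code (lnth (pfst x)) (psnd x))"
    by (rule computable_in_semidecidable_graph, unfold eq ren_table_def,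
      intro semidecidable_in_ex semidecidable_in_decidable decidable_intros)
qed

lemma computable_in_ren_code:
  assumes "computable_in X c" "computable_in X n"
  shows "computable_in X (\<lambda>z. ren_code (lnth (c z)) (n z))"
  unfolding ren_code_def
  by (intro decidable_intros computable_in_ren_tm_code assms)

lemma is_isomorphism_inv:
  assumes g: "is_isomorphism L N M g"
  shows "is_isomorphism L M N (inv g)"
proof -
  have bij: "bij g" using g by (simp add: is_isomorphism_def)
  show ?thesis
    unfolding is_isomorphism_def
  proof (intro conjI allI impI)
    show "bij (inv g)" using bij by (rule bij_imp_bij_inv)
    fix s and xs :: "nat list" assume "fun_arity L s = Some (length xs)"
    then have "g (fun_interp N s (map (inv g) xs)) = fun_interp M s (map g (map (inv g) xs))"
      using g unfolding is_isomorphism_def by (metis length_map)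
    also have "map g (map (inv g) xs) = xs"
      using bij by (simp add: map_idI bij_is_surj surj_f_inv_f)
    finally show "inv g (fun_interp M s xs) = fun_interp N s (map (inv g) xs)"
      using bij by (metis bij_is_inj inv_f_f)
  next
    fix s and xs :: "nat list" assume "rel_arity L s = Some (length xs)"
    then have "rel_interp N s (map (inv g) xs) = rel_interp M s (map g (map (inv g) xs))"
      using g unfolding is_isomorphism_def by (metis length_map)
    also have "map g (map (inv g) xs) = xs"
      using bij by (simp add: map_idI bij_is_surj surj_f_inv_f)
    finally show "rel_interp M s xs = rel_interp N s (map (inv g) xs)" by simp
  qed
qed

lemma is_isomorphism_comp:
  "is_isomorphism L N M g \<Longrightarrow> is_isomorphism L M K h \<Longrightarrow> is_isomorphism L N K (h \<circ> g)"
  unfolding is_isomorphism_def by (auto intro: bij_comp simp flip: map_map)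

lemma rigid_unique_isomorphism:
  assumes "rigid L M" and g: "is_isomorphism L N M g" and h: "is_isomorphism L N M h"
  shows "g = h"
proof -
  have "g \<circ> inv h = id"
    using assms(1) is_isomorphism_comp[OF is_isomorphism_inv[OF h] g] unfolding rigid_def by blast
  moreover have "bij h" using h by (simp add: is_isomorphism_def)
  ultimately show ?thesis by (metis bij_is_inj comp_assoc comp_id id_comp inv_o_cancel)
qed

section \<open>Existential formulas as finite pieces of diagrams\<close>

definition extends :: "(nat \<Rightarrow> nat) \<Rightarrow> nat list \<Rightarrow> bool" where
  "extends v p \<longleftrightarrow> (\<forall>i<length p. v i = p ! i)"

lemma extends_map: "k \<ge> length p \<Longrightarrow> extends v p \<Longrightarrow> take (length p) (map v [0..<k]) = p"
  by (rule nth_equalityI) (auto simp: extends_def)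

lemma extends_take: "take (length p) r = p \<Longrightarrow> extends v r \<Longrightarrow> extends v p"
  unfolding extends_def by (metis length_take min_less_iff_conj nth_take)

lemma take_trans:
  assumes "take (length p) q = p" "take (length q) r = q"
  shows "take (length p) r = p"
  using assms by (metis length_take min.absorb_iff1 min.cobounded1 take_take)

text \<open>Values are corrected one at a time by a transposition applied after \<open>v\<close>. It
  leaves the earlier values alone, because \<open>p\<close> has no repetitions and \<open>v\<close>
  is injective.\<close>

lemma extends_bij:
  assumes "distinct p"
  obtains v where "bij v" "extends v p"
  using assms
proof (induction p arbitrary: thesis rule: rev_induct)
  case Nil
  then show ?case using bij_id by (auto simp: extends_def)
next
  case (snoc a p)
  then obtain v where v: "bij v" "extends v p" by auto
  let ?w = "transpose (v (length p)) a \<circ> v"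
  have "?w i = p ! i" if i: "i < length p" for i
  proof -
    have "v i = p ! i" using v(2) i by (simp add: extends_def)
    moreover have "p ! i \<noteq> a" using snoc.prems(2) i by auto
    moreover have "v i \<noteq> v (length p)" using v(1) i by (simp add: bij_is_inj inj_eq)
    ultimately show ?thesis by (simp add: transpose_apply_other)
  qed
  then have "extends ?w (p @ [a])" by (auto simp: extends_def nth_append less_Suc_eq)
  moreover have "bij ?w" using v(1) by (auto intro: bij_comp)
  ultimately show ?case using snoc.prems(1) by blast
qed

text \<open>A number \<open>\<langle>m, \<langle>u, D\<rangle>\<rangle>\<close> codes the existential formula, with parameters \<open>p\<close> and
  distinguished variable \<open>x\<^sub>m\<close>, that describes which literals with codes below \<open>u\<close> hold of a tuple
  of distinct elements extending \<open>p\<close>.\<close>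

definition realization ::
  "language \<Rightarrow> struct \<Rightarrow> nat list \<Rightarrow> nat \<Rightarrow> nat \<Rightarrow> nat list \<Rightarrow> bool" where
  "realization L M p \<phi> a r \<longleftrightarrow>
     distinct r \<and> take (length p) r = p \<and> pfst \<phi> < length r \<and> r ! pfst \<phi> = a \<and>
     pfst (psnd \<phi>) \<le> length r \<and>
     agrees (pfst (psnd \<phi>)) (psnd (psnd \<phi>)) (diagram_along L M ((!) r))"

definition realizes :: "language \<Rightarrow> struct \<Rightarrow> nat list \<Rightarrow> nat \<Rightarrow> nat \<Rightarrow> bool" where
  "realizes L M p \<phi> a \<longleftrightarrow> (\<exists>r. realization L M p \<phi> a r)"

text \<open>The number \<open>\<phi>\<close> refers to positions in a tuple and never to elements,
  so it is the same formula in both structures, and a realizing tuple can be transported along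
  \<open>g\<close>.\<close>

lemma realizes_isomorphism:
  assumes g: "is_isomorphism L N M g"
  shows "realizes L M (map g p) \<phi> (g a) \<longleftrightarrow> realizes L N p \<phi> a"
proof -
  have bij: "bij g" using g by (simp add: is_isomorphism_def)
  have imp: "realizes L M (map g p) \<phi> (g a)" if g: "is_isomorphism L N M g" and r: "realizes L N p \<phi> a"
    for N M g p a
  proof -
    from r obtain r where r: "distinct r" "take (length p) r = p" "pfst \<phi> < length r"
      "r ! pfst \<phi> = a" "pfst (psnd \<phi>) \<le> length r"
      "agrees (pfst (psnd \<phi>)) (psnd (psnd \<phi>)) (diagram_along L N ((!) r))"
      unfolding realizes_def realization_def by blast
    have inj: "inj g" using g by (simp add: is_isomorphism_def bij_is_inj)
    have "l \<in> diagram_along L M ((!) (map g r)) \<longleftrightarrow> l \<in> diagram_along L N ((!) r)"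
      if "l < pfst (psnd \<phi>)" for l
    proof -
      have "l \<in> diagram_along L M ((!) (map g r)) \<longleftrightarrow> l \<in> diagram_along L M (g \<circ> (!) r)"
        using that r(5) by (intro diagram_along_cong[of "length r"]) auto
      then show ?thesis by (simp add: diagram_along_isomorphism[OF g])
    qed
    then have "agrees (pfst (psnd \<phi>)) (psnd (psnd \<phi>)) (diagram_along L M ((!) (map g r)))"
      using r(6) by (simp add: agrees_def)
    moreover have "take (length (map g p)) (map g r) = map g p" using r(2) by (metis length_map take_map)
    moreover have "distinct (map g r)" using r(1) inj by (simp add: distinct_map inj_on_subset[OF _ subset_UNIV])
    ultimately show ?thesis unfolding realizes_def realization_def using r
      by (intro exI[of _ "map g r"]) auto
  qed
  from imp[OF g, of p a] imp[OF is_isomorphism_inv[OF g], of "map g p" "g a"] show ?thesis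
    using bij by (auto simp: bij_is_inj)
qed

text \<open>For a given tuple only finitely many bits of the diagram have to be compared. The search
  for a tuple is what makes \<open>realizes\<close> merely semidecidable.\<close>

lemma decidable_in_realization:
  assumes M: "atomic_diagram L M \<le>\<^sub>T X" and f: "computable_in X f" and a: "computable_in X a"
    and c: "computable_in X c"
  shows "decidable_in X (\<lambda>z. realization L M p (f z) (a z) (list_decode (c z)))"
proof -
  let ?p = "list_encode p"
  have eq: "realization L M p \<phi> b (list_decode c) \<longleftrightarrow> (\<forall>i<llen c. \<forall>j<i. lnth c i \<noteq> lnth c j) \<and>
      llen ?p \<le> llen c \<and> (\<forall>i<llen ?p. lnth c i = lnth ?p i) \<and> pfst \<phi> < llen c \<and>
      lnth c (pfst \<phi>) = b \<and> pfst (psnd \<phi>) \<le> llen c \<and>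
      (\<forall>l<pfst (psnd \<phi>). l \<in> set_decode (psnd (psnd \<phi>)) \<longleftrightarrow>
         ren_code (lnth c) l \<in> atomic_diagram L M)" for \<phi> b c
  proof -
    obtain r where c: "c = list_encode r" by (metis list_decode_inverse)
    have "distinct r \<longleftrightarrow> (\<forall>i<length r. \<forall>j<i. lnth (list_encode r) i \<noteq> lnth (list_encode r) j)"
      unfolding distinct_conv_nth by (auto simp: lnth_encode) (metis linorder_neqE_nat)
    moreover have "take (length p) r = p \<longleftrightarrow> length p \<le> length r \<and>
        (\<forall>i<length p. lnth (list_encode r) i = lnth ?p i)"
      by (auto simp: list_eq_iff_nth_eq lnth_encode)
    moreover have "ren_code ((!) r) l = ren_code (lnth (list_encode r)) l"
      if "l < pfst (psnd \<phi>)" "pfst (psnd \<phi>) \<le> length r" for l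
      using that by (intro ren_code_cong[of "length r"]) auto
    ultimately show ?thesis by (auto simp: realization_def agrees_def diagram_along_def c)
  qed
  have M': "decidable_in X (\<lambda>x. g x \<in> atomic_diagram L M)" if "computable_in X g" for g
    by (rule decidable_in_comp[OF decidable_in_reducible_set[OF M] that])
  show ?thesis unfolding eq
    by (intro decidable_intros M' computable_in_ren_code computable_in_comp[OF f]
        computable_in_comp[OF a] computable_in_comp[OF c])
qed

lemma semidecidable_in_realizes:
  assumes M: "atomic_diagram L M \<le>\<^sub>T X" and f: "computable_in X f" and a: "computable_in X a"
  shows "semidecidable_in X (\<lambda>z. realizes L M p (f z) (a z))"
proof -
  have eq: "realizes L M p \<phi> b \<longleftrightarrow> (\<exists>c. realization L M p \<phi> b (list_decode c))" for \<phi> b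
    unfolding realizes_def by (metis list_encode_inverse)
  show ?thesis unfolding eq
    by (intro semidecidable_in_ex semidecidable_in_decidable decidable_in_realization[OF M]
        computable_intros computable_in_comp[OF f] computable_in_comp[OF a])
qed

section \<open>Forcing with finite injective sequences\<close>

text \<open>The programs are enumerated as the requirements that a generic copy has to
  defeat.\<close>

instance prog :: countable
  by countable_datatype

definition copy_computes :: "language \<Rightarrow> struct \<Rightarrow> nat set \<Rightarrow> (nat \<Rightarrow> nat) \<Rightarrow> prog \<Rightarrow> nat \<Rightarrow> nat \<Rightarrow> bool" where
  "copy_computes L M X v e n y \<longleftrightarrow> runs (diagram_along L M v \<oplus>\<^sub>T X) e [n] y"

text \<open>The copy given by \<open>v\<close> has \<open>v\<close> itself as an isomorphism onto
  \<open>M\<close>. Wrong values are excluded for every permutation extending \<open>p\<close>,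
  whereas halting is only demanded densely: each finite injective extension can be continued to a
  permutation for which \<open>e\<close> halts on \<open>n\<close>. Density suffices because a
  halting computation reads only finitely many bits.\<close>

definition forces :: "language \<Rightarrow> struct \<Rightarrow> nat set \<Rightarrow> nat list \<Rightarrow> prog \<Rightarrow> bool" where
  "forces L M X p e \<longleftrightarrow> distinct p \<and>
     (\<forall>v n y. bij v \<longrightarrow> extends v p \<longrightarrow> copy_computes L M X v e n y \<longrightarrow> y = v n) \<and>
     (\<forall>q n. distinct q \<longrightarrow> take (length p) q = p \<longrightarrow>
        (\<exists>v y. bij v \<and> extends v q \<and> copy_computes L M X v e n y))"

lemma agrees_encode: "agrees u (set_encode {l. l < u \<and> l \<in> Z}) Z"
  by (simp add: agrees_def)

lemma copy_computes_use:
  assumes "copy_computes L M X v e n y"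
  shows "\<exists>u. (\<forall>w. (\<forall>l<u. l \<in> diagram_along L M w \<longleftrightarrow> l \<in> diagram_along L M v)
      \<longrightarrow> copy_computes L M X w e n y) \<and>
    (\<forall>w\<ge>u. \<forall>D. agrees w D (diagram_along L M v) \<longrightarrow> pruns (join_part X w D) e [n] y)"
proof -
  obtain u where u: "\<forall>w\<ge>u. \<forall>D. agrees w D (diagram_along L M v)
      \<longrightarrow> pruns (join_part X w D) e [n] y"
    using join_part_use[OF assms[unfolded copy_computes_def]] by blast
  have "copy_computes L M X w e n y"
    if w: "\<forall>l<u. l \<in> diagram_along L M w \<longleftrightarrow> l \<in> diagram_along L M v" for w
  proof -
    let ?D = "set_encode {l. l < u \<and> l \<in> diagram_along L M v}"
    have "pruns (join_part X u ?D) e [n] y" using u agrees_encode by blast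
    moreover have "agrees u ?D (diagram_along L M w)"
      using agrees_encode[of u "diagram_along L M v"] w by (simp add: agrees_def)
    ultimately show ?thesis unfolding copy_computes_def by (rule runs_join_part[rotated])
  qed
  with u show ?thesis by blast
qed

text \<open>Placing \<open>s\<close> in the sequence at step \<open>s\<close> gives surjectivity. It
  also makes the limit total, since a sequence that contains all numbers below \<open>s\<close> has
  length at least \<open>s\<close>.\<close>

lemma bij_limit:
  fixes q :: "nat \<Rightarrow> nat list"
  assumes dist: "\<And>s. distinct (q s)" and step: "\<And>s. take (length (q s)) (q (Suc s)) = q s"
    and mem: "\<And>s. s \<in> set (q (Suc s))"
  obtains v where "bij v" "\<And>s. extends v (q s)"
proof -
  have mono: "s \<le> t \<Longrightarrow> take (length (q s)) (q t) = q s" for s t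
    by (induction rule: dec_induct) (auto intro: take_trans step)
  have sub: "s \<le> t \<Longrightarrow> set (q s) \<subseteq> set (q t)" for s t
    using mono[of s t] by (metis set_take_subset)
  have len: "s \<le> length (q s)" for s
  proof -
    have "i \<in> set (q s)" if "i < s" for i using mem[of i] sub[of "Suc i" s] that by auto
    then have "card {..<s} \<le> card (set (q s))" by (intro card_mono) auto
    then show ?thesis using distinct_card[OF dist[of s]] by simp
  qed
  have nth: "q s ! i = q t ! i" if "i < length (q s)" "i < length (q t)" for s t i
  proof (cases "s \<le> t")
    case True
    then show ?thesis using mono[OF True] nth_take[OF that(1), of "q t"] by simp
  next
    case False
    then show ?thesis using mono[of t s] nth_take[OF that(2), of "q s"] by simp
  qed
  define v where "v i = q (Suc i) ! i" for i
  have ext: "extends v (q s)" for s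
    unfolding extends_def v_def
  proof (intro allI impI)
    fix i assume "i < length (q s)"
    moreover have "i < length (q (Suc i))" using len[of "Suc i"] by simp
    ultimately show "q (Suc i) ! i = q s ! i" by (rule nth[rotated])
  qed
  have "inj v"
  proof (rule injI)
    fix i j assume eq: "v i = v j"
    let ?s = "Suc (max i j)"
    have "i < length (q ?s)" "j < length (q ?s)" using len[of ?s] by auto
    then show "i = j" using eq ext[of ?s] dist[of ?s] by (simp add: extends_def nth_eq_iff_index_eq)
  qed
  moreover have "surj v"
  proof -
    have "\<exists>i. v i = k" for k
      using mem[of k] ext[of "Suc k"] unfolding extends_def in_set_conv_nth by metis
    then show ?thesis unfolding surj_def by metis
  qed
  ultimately show ?thesis using ext by (intro that[of v]) (auto simp: bij_def)
qed

text \<open>Otherwise every program could be defeated by extending the current finite sequence, and a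
  sufficiently generic copy of \<open>M\<close> would have no isomorphism computable from its diagram and \<open>X\<close>.
  By rigidity the isomorphism is the permutation that defines the copy.\<close>

lemma forces_exists:
  assumes rigid: "rigid L M"
    and cat: "\<And>N. isomorphic L N M \<Longrightarrow>
      \<exists>h. is_isomorphism L N M h \<and> computable_in (atomic_diagram L N \<oplus>\<^sub>T X) h"
    and p: "distinct p"
  obtains p' e where "take (length p) p' = p" "forces L M X p' e"
proof (rule ccontr)
  assume "\<not> thesis"
  with that have no: "\<not> forces L M X p' e" if "take (length p) p' = p" for p' e using that by blast
  have defeat: "\<exists>q. distinct q \<and> take (length p') q = p' \<and> s \<in> set q \<and>
      (\<forall>v. bij v \<longrightarrow> extends v q \<longrightarrow> (\<exists>n. \<not> copy_computes L M X v e n (v n)))"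
    if p': "distinct p'" "take (length p) p' = p" for p' e s
  proof -
    have "\<exists>q. distinct q \<and> take (length p') q = p' \<and>
      (\<forall>v. bij v \<longrightarrow> extends v q \<longrightarrow> (\<exists>n. \<not> copy_computes L M X v e n (v n)))"
    proof -
      have "\<not> forces L M X p' e" using no[OF p'(2)] .
      then consider (wrong) v n y where "bij v" "extends v p'" "copy_computes L M X v e n y" "y \<noteq> v n"
        | (diverges) q n where "distinct q" "take (length p') q = p'"
            "\<And>v y. bij v \<Longrightarrow> extends v q \<Longrightarrow> \<not> copy_computes L M X v e n y"
        using p'(1) unfolding forces_def by blast
      then show ?thesis
      proof cases
        case wrong
        obtain u where u: "\<forall>w. (\<forall>l<u. l \<in> diagram_along L M w \<longleftrightarrow> l \<in> diagram_along L M v)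
            \<longrightarrow> copy_computes L M X w e n y" using copy_computes_use[OF wrong(3)] by blast
        \<comment> \<open>The first \<open>u\<close> entries preserve the computation of the wrong
          value \<open>y\<close>, entry \<open>n\<close> preserves the value it is compared with,
          and the remaining length makes room for \<open>p'\<close>.\<close>
        let ?q = "map v [0..<u + Suc n + length p']"
        have "\<not> copy_computes L M X w e n (w n)" if w: "bij w" "extends w ?q" for w
        proof
          have eq: "w i = v i" if "i < u + Suc n + length p'" for i
            using w(2) that by (simp add: extends_def del: upt_Suc)
          have "l \<in> diagram_along L M w \<longleftrightarrow> l \<in> diagram_along L M v" if "l < u" for l
            by (rule diagram_along_cong[of u]) (use that in \<open>auto simp: eq\<close>)
          then have "copy_computes L M X w e n y" using u by blast
          moreover assume "copy_computes L M X w e n (w n)"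
          ultimately have "y = w n" unfolding copy_computes_def by (rule runs_deterministic)
          with wrong(4) eq[of n] show False by simp
        qed
        moreover have "distinct ?q" using wrong(1)
          by (simp add: distinct_map bij_is_inj inj_on_subset[OF _ subset_UNIV] del: upt_Suc)
        moreover have "take (length p') ?q = p'" by (rule extends_map[OF _ wrong(2)]) simp
        ultimately show ?thesis by blast
      next
        case diverges
        then show ?thesis by blast
      qed
    qed
    then obtain q where q: "distinct q" "take (length p') q = p'"
      "\<And>v. bij v \<Longrightarrow> extends v q \<Longrightarrow> \<exists>n. \<not> copy_computes L M X v e n (v n)" by blast
    show ?thesis
    proof (cases "s \<in> set q")
      case True
      then show ?thesis using q by blast
    next
      case False
      \<comment> \<open>A program defeated by all permutations extending \<open>q\<close> stays
        defeated when \<open>s\<close> is appended, so surjectivity can be arranged in the same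
        step.\<close>
      have "take (length q) (q @ [s]) = q" by simp
      then have "extends v q" if "extends v (q @ [s])" for v using extends_take that by blast
      moreover have "take (length p') (q @ [s]) = p'"
        by (rule take_trans[OF q(2)]) simp
      ultimately show ?thesis using q(1,3) False by (intro exI[of _ "q @ [s]"]) auto
    qed
  qed
  \<comment> \<open>Stage \<open>s\<close> defeats the program with number \<open>s\<close> and puts
    \<open>s\<close> into the range.\<close>
  have "\<exists>q. \<forall>s. (distinct (q s) \<and> take (length p) (q s) = p) \<and>
     (take (length (q s)) (q (Suc s)) = q s \<and> s \<in> set (q (Suc s)) \<and>
      (\<forall>v. bij v \<longrightarrow> extends v (q (Suc s)) \<longrightarrow> (\<exists>n. \<not> copy_computes L M X v (from_nat s) n (v n))))"
  proof (rule dependent_nat_choice)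
    show "\<exists>q. distinct q \<and> take (length p) q = p" using p by (intro exI[of _ p]) simp
    fix q s assume "distinct q \<and> take (length p) q = p"
    then show "\<exists>q'. (distinct q' \<and> take (length p) q' = p) \<and>
        (take (length q) q' = q \<and> s \<in> set q' \<and>
         (\<forall>v. bij v \<longrightarrow> extends v q' \<longrightarrow> (\<exists>n. \<not> copy_computes L M X v (from_nat s) n (v n))))"
      using defeat[of q s "from_nat s"] take_trans by blast
  qed
  then obtain q where q: "\<And>s. distinct (q s)" "\<And>s. take (length (q s)) (q (Suc s)) = q s"
    "\<And>s. s \<in> set (q (Suc s))" "\<And>s v. bij v \<Longrightarrow> extends v (q (Suc s)) \<Longrightarrow>
       \<exists>n. \<not> copy_computes L M X v (from_nat s) n (v n)" by blast
  obtain v where v: "bij v" "\<And>s. extends v (q s)" using bij_limit[of q] q(1-3) by blast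
  obtain h where h: "is_isomorphism L (pullback M v) M h"
      "computable_in (atomic_diagram L (pullback M v) \<oplus>\<^sub>T X) h"
    using cat pullback_isomorphism[OF v(1)] unfolding isomorphic_def by blast
  have "h = v" by (rule rigid_unique_isomorphism[OF rigid h(1) pullback_isomorphism[OF v(1)]])
  then obtain e where "\<And>n. copy_computes L M X v e n (v n)"
    using h(2) unfolding computable_in_def copy_computes_def atomic_diagram_pullback[OF v(1)] by blast
  then show False using q(4)[OF v(1) v(2), of "to_nat e"] by simp
qed

text \<open>On a suitable copy extending \<open>p\<close>, the program \<open>e\<close> halts on a
  position \<open>j\<close> of \<open>p\<close> with value \<open>p ! j\<close> after reading
  finitely many bits. A copy over \<open>p0\<close> with the same bits makes \<open>e\<close> output
  the same value, and over \<open>p0\<close> the program is never wrong, so that copy also has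
  \<open>p ! j\<close> at \<open>j\<close>. Collecting the bits for all positions replaces the extra
  parameters by an existential condition over \<open>p0\<close>.\<close>

lemma forces_pins:
  assumes p0: "forces L M X p0 e" and p: "distinct p" "take (length p0) p = p0"
  shows "\<exists>q u. distinct q \<and> take (length p) q = p \<and> u \<le> length q \<and>
    (\<forall>v. bij v \<and> extends v p0 \<and>
      (\<forall>l<u. l \<in> diagram_along L M v \<longleftrightarrow> l \<in> diagram_along L M ((!) q)) \<longrightarrow> extends v p)"
proof -
  have "j \<le> length p \<Longrightarrow> \<exists>q u. distinct q \<and> take (length p) q = p \<and> u \<le> length q \<and>
    (\<forall>v. bij v \<and> extends v p0 \<and>
      (\<forall>l<u. l \<in> diagram_along L M v \<longleftrightarrow> l \<in> diagram_along L M ((!) q)) \<longrightarrow>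
      (\<forall>i<j. v i = p ! i))" for j
  proof (induction j)
    case 0
    then show ?case using p by (intro exI[of _ p] exI[of _ 0]) auto
  next
    case (Suc j)
    from Suc.prems have "j \<le> length p" by simp
    from Suc.IH[OF this] obtain q u where q: "distinct q" "take (length p) q = p" "u \<le> length q"
      "\<forall>v. bij v \<and> extends v p0 \<and>
      (\<forall>l<u. l \<in> diagram_along L M v \<longleftrightarrow> l \<in> diagram_along L M ((!) q)) \<longrightarrow> (\<forall>i<j. v i = p ! i)"
      by blast
    have "take (length p0) q = p0" by (rule take_trans[OF p(2) q(2)])
    then obtain v y where v: "bij v" "extends v q" "copy_computes L M X v e j y"
      using p0 q(1) unfolding forces_def by blast
    have "extends v p0" using v(2) extends_take[OF \<open>take (length p0) q = p0\<close>] by blast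
    then have "y = v j" using p0 v unfolding forces_def by blast
    also have "v j = p ! j"
      using extends_take[OF q(2) v(2)] Suc.prems by (simp add: extends_def)
    finally have y: "y = p ! j" .
    obtain w where w: "\<forall>v'. (\<forall>l<w. l \<in> diagram_along L M v' \<longleftrightarrow> l \<in> diagram_along L M v)
        \<longrightarrow> copy_computes L M X v' e j y" using copy_computes_use[OF v(3)] by blast
    \<comment> \<open>The tuple has to cover the bits read by the new computation, and the new bound
      has to retain the bits that already determine the values before \<open>j\<close>.\<close>
    let ?k = "length q + w" and ?u = "max u w"
    let ?q = "map v [0..<?k]"
    have take: "take (length q) ?q = q" by (rule extends_map[OF _ v(2)]) simp
    have "\<forall>i<Suc j. v' i = p ! i" if v': "bij v'" "extends v' p0"
      "\<And>l. l < ?u \<Longrightarrow> l \<in> diagram_along L M v' \<longleftrightarrow> l \<in> diagram_along L M ((!) ?q)" for v'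
    proof -
      have 1: "l \<in> diagram_along L M v' \<longleftrightarrow> l \<in> diagram_along L M ((!) q)" if "l < u" for l
      proof -
        have "l \<in> diagram_along L M ((!) ?q) \<longleftrightarrow> l \<in> diagram_along L M ((!) q)"
        proof (rule diagram_along_cong[of "length q"])
          show "?q ! a = q ! a" if "a < length q" for a using take that by (metis nth_take)
        qed (use that q(3) in simp)
        then show ?thesis using v'(3)[of l] that by simp
      qed
      have 2: "l \<in> diagram_along L M v' \<longleftrightarrow> l \<in> diagram_along L M v" if "l < w" for l
      proof -
        have "l \<in> diagram_along L M ((!) ?q) \<longleftrightarrow> l \<in> diagram_along L M v"
          by (rule diagram_along_cong[of ?k]) (use that in auto)
        then show ?thesis using v'(3)[of l] that by simp
      qed
      have "copy_computes L M X v' e j y" using w 2 by blast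
      then have "v' j = p ! j" using p0 v' y unfolding forces_def by metis
      moreover have "\<forall>i<j. v' i = p ! i" using q(4) v' 1 by blast
      ultimately show ?thesis by (auto simp: less_Suc_eq)
    qed
    moreover have "distinct ?q" using v(1)
      by (simp add: distinct_map bij_is_inj inj_on_subset[OF _ subset_UNIV])
    moreover have "take (length p) ?q = p" by (rule take_trans[OF q(2) take])
    moreover have "?u \<le> length ?q" using q(3) by simp
    ultimately show ?case by blast
  qed
  from this[OF order_refl] show ?thesis unfolding extends_def by simp
qed

lemma computable_structure_reducible:
  assumes "computable_structure L M"
  shows "atomic_diagram L M \<le>\<^sub>T X"
proof -
  have "atomic_diagram L M \<le>\<^sub>T {}"
    using assms by (simp add: computable_structure_def computable_set_def computable_fun_def
        turing_reducible_def)
  then show ?thesis by (rule turing_reducible_trans[OF _ empty_reducible])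
qed

text \<open>The parameters \<open>p0\<close> come from an arbitrary oracle \<open>X0\<close>, so that they can be chosen before \<open>X\<close>:
  a finite piece of the diagram over \<open>p0\<close> determines the longer sequence that works for \<open>X\<close>.\<close>

lemma forces_defining_formulas:
  assumes M: "computable_structure L M" and rigid: "rigid L M"
    and cat: "\<And>N. isomorphic L N M \<Longrightarrow>
      \<exists>h. is_isomorphism L N M h \<and> computable_in (atomic_diagram L N \<oplus>\<^sub>T X) h"
    and p0: "forces L M X0 p0 e0"
  obtains F where "computable_in X F" "\<And>a b. realizes L M p0 (F a) b \<longleftrightarrow> b = a"
proof -
  have p0': "distinct p0" using p0 by (simp add: forces_def)
  obtain p e where p: "take (length p0) p = p0" "forces L M X p e"
    by (rule forces_exists[OF rigid cat p0'])
  then have p': "distinct p" by (simp add: forces_def)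
  obtain q u where q: "distinct q" "take (length p) q = p" "u \<le> length q"
    "\<forall>v. bij v \<and> extends v p0 \<and>
      (\<forall>l<u. l \<in> diagram_along L M v \<longleftrightarrow> l \<in> diagram_along L M ((!) q)) \<longrightarrow> extends v p"
    using forces_pins[OF p0 p' p(1)] by blast
  \<comment> \<open>The formula keeps the bits below \<open>u\<close> that recover \<open>p\<close>,
    and its own bits suffice for \<open>e\<close> to output \<open>a\<close> on the distinguished
    position. This condition is semidecidable in \<open>X\<close>, so a formula can be found
    uniformly in \<open>a\<close>.\<close>
  define T where "T a \<phi> \<longleftrightarrow> realizes L M q \<phi> a \<and> u \<le> pfst (psnd \<phi>) \<and>
      pruns (join_part X (pfst (psnd \<phi>)) (psnd (psnd \<phi>))) e [pfst \<phi>] a" for a \<phi>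
  have "semidecidable_in X (\<lambda>x. T (pfst x) (psnd x))"
    unfolding T_def
    by (intro semidecidable_in_and semidecidable_in_le semidecidable_in_realizes
        computable_structure_reducible[OF M]
        semidecidable_in_join_part computable_intros)
  moreover have "\<exists>\<phi>. T a \<phi>" for a
  proof -
    obtain v0 where v0: "bij v0" "extends v0 q" using extends_bij[OF q(1)] by blast
    obtain m where m: "v0 m = a" using v0(1) by (metis bij_pointE)
    let ?q = "map v0 [0..<length q + Suc m]"
    have q': "distinct ?q" "take (length q) ?q = q"
      using v0(1) extends_map[OF _ v0(2)]
      by (simp_all add: distinct_map bij_is_inj inj_on_subset[OF _ subset_UNIV] del: upt_Suc)
    then have "take (length p) ?q = p" using take_trans[OF q(2)] by blast
    then obtain v y where v: "bij v" "extends v ?q" "copy_computes L M X v e m y"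
      using p(2) q'(1) unfolding forces_def by blast
    have vq: "extends v q" by (rule extends_take[OF q'(2) v(2)])
    have "extends v p" by (rule extends_take[OF q(2) vq])
    then have "y = v m" using p(2) v unfolding forces_def by blast
    also have "v m = a" using v(2) m by (simp add: extends_def del: upt_Suc)
    finally have y: "y = a" .
    obtain w where w: "\<forall>k\<ge>w. \<forall>D. agrees k D (diagram_along L M v)
        \<longrightarrow> pruns (join_part X k D) e [m] y" using copy_computes_use[OF v(3)] by blast
    \<comment> \<open>Long enough for the tuple to extend \<open>q\<close> and contain position
      \<open>m\<close>, and at least both the bound \<open>u\<close> for recovering \<open>p\<close>
      and the bound \<open>w\<close> for the computation of \<open>a\<close>.\<close>
    let ?k = "length q + Suc m + u + w"
    let ?r = "map v [0..<?k]" and ?D = "set_encode {l. l < ?k \<and> l \<in> diagram_along L M v}"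
    have "pruns (join_part X ?k ?D) e [m] a" using w agrees_encode[of ?k] y by simp
    moreover have "agrees ?k ?D (diagram_along L M ((!) ?r))"
    proof -
      have "l \<in> diagram_along L M ((!) ?r) \<longleftrightarrow> l \<in> diagram_along L M v" if "l < ?k" for l
        by (rule diagram_along_cong[of ?k]) (use that in \<open>auto simp del: upt_Suc\<close>)
      then show ?thesis using agrees_encode[of ?k "diagram_along L M v"] by (simp add: agrees_def)
    qed
    moreover have "distinct ?r" using v(1)
      by (simp add: distinct_map bij_is_inj inj_on_subset[OF _ subset_UNIV] del: upt_Suc)
    moreover have "take (length q) ?r = q" by (rule extends_map[OF _ vq]) simp
    moreover have "?r ! m = a" using \<open>v m = a\<close> by (simp del: upt_Suc)
    ultimately have "T a (pair m (pair ?k ?D))"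
      unfolding T_def realizes_def realization_def psnd_pair pfst_pair
      by (intro conjI exI[of _ ?r]) auto
    then show ?thesis by blast
  qed
  ultimately obtain F where F: "computable_in X F" "\<And>a. T a (F a)"
    using semidecidable_in_uniformize[of X T] by metis
  have "realizes L M p0 (F a) b \<longleftrightarrow> b = a" for a b
  proof -
    let ?m = "pfst (F a)" and ?k = "pfst (psnd (F a))" and ?D = "psnd (psnd (F a))"
    have T: "realizes L M q (F a) a" "u \<le> ?k" "pruns (join_part X ?k ?D) e [?m] a"
      using F(2)[of a] unfolding T_def by auto
    then obtain r where r: "distinct r" "take (length q) r = q" "?m < length r" "r ! ?m = a"
      "?k \<le> length r" "agrees ?k ?D (diagram_along L M ((!) r))"
      unfolding realizes_def realization_def by blast
    have rp: "take (length p0) r = p0"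
      by (rule take_trans[OF take_trans[OF p(1) q(2)] r(2)])
    have "b = a" if "realizes L M p0 (F a) b"
    proof -
      from that obtain s where s: "distinct s" "take (length p0) s = p0" "?m < length s" "s ! ?m = b"
        "?k \<le> length s" "agrees ?k ?D (diagram_along L M ((!) s))"
        unfolding realizes_def realization_def by blast
      \<comment> \<open>Completed to a permutation, the second realization yields a copy. Its bits
        below \<open>u\<close> make it extend \<open>p\<close>; its bits below \<open>?k\<close>
        make \<open>e\<close> output \<open>a\<close>. As \<open>e\<close> is never wrong over
        \<open>p\<close>, this output is the entry \<open>b\<close>.\<close>
      obtain v where v: "bij v" "extends v s" using extends_bij[OF s(1)] by blast
      have "l \<in> diagram_along L M v \<longleftrightarrow> l \<in> diagram_along L M ((!) s)" if "l < ?k" for l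
        using that s(5) v(2) by (intro diagram_along_cong[of "length s"]) (auto simp: extends_def)
      then have agv: "agrees ?k ?D (diagram_along L M v)" using s(6) by (simp add: agrees_def)
      have "l \<in> diagram_along L M v \<longleftrightarrow> l \<in> diagram_along L M ((!) q)" if "l < u" for l
      proof -
        have "l \<in> diagram_along L M ((!) r) \<longleftrightarrow> l \<in> diagram_along L M ((!) q)"
        proof (rule diagram_along_cong[of "length q"])
          show "r ! i = q ! i" if "i < length q" for i using r(2) that by (metis nth_take)
        qed (use that q(3) in simp)
        then show ?thesis using agv r(6) that T(2) by (simp add: agrees_def)
      qed
      then have "extends v p" using q(4) v extends_take[OF s(2) v(2)] by blast
      moreover have "copy_computes L M X v e ?m a"
        unfolding copy_computes_def by (rule runs_join_part[OF agv T(3)])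
      ultimately have "a = v ?m" using p(2) v(1) unfolding forces_def by blast
      also have "v ?m = b" using v(2) s(3,4) by (simp add: extends_def)
      finally show "b = a" by simp
    qed
    moreover have "realizes L M p0 (F a) a" unfolding realizes_def realization_def using r rp by blast
    ultimately show ?thesis by blast
  qed
  with F(1) show ?thesis by (rule that)
qed

section \<open>From rigid structures to differences of c.e. sets\<close>

lemma degree_surj: "\<exists>X. x = degree X"
  by transfer (auto simp: turing_equiv_def intro: turing_reducible_refl)

lemma degree_computes_degree: "degree_computes (degree X) f \<longleftrightarrow> computable_in X f"
  by transfer simp

lemma degree_join_degree: "degree X \<squnion>\<^sub>T degree Y = degree (X \<oplus>\<^sub>T Y)"
  by transfer (simp add: turing_equiv_def turing_reducible_refl)

lemma relatively_computably_categorical_degree: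
  "relatively_computably_categorical (degree X) L M \<longleftrightarrow>
     (\<forall>N. isomorphic L N M \<longrightarrow>
        (\<exists>h. is_isomorphism L N M h \<and> computable_in (atomic_diagram L N \<oplus>\<^sub>T X) h))"
  unfolding relatively_computably_categorical_def structure_degree_def degree_join_degree
    degree_computes_degree ..

lemma uniformly_ce_iff: "uniformly_ce A \<longleftrightarrow> semidecidable_in {} (\<lambda>z. psnd z \<in> A (pfst z))"
proof -
  have "{pair i n | i n. n \<in> A i} = {z. psnd z \<in> A (pfst z)}"
    by (auto; metis pair_pfst_psnd)
  then show ?thesis unfolding uniformly_ce_def
    using ce_set_semidecidable[of "{z. psnd z \<in> A (pfst z)}"]
      semidecidable_ce_set[of "{z. psnd z \<in> A (pfst z)}"] by auto
qed

lemma weak_selector_iff: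
  "weak_selector A B f \<longleftrightarrow> (\<forall>i. set_decode (f i) \<subseteq> A i \<and> \<not> set_decode (f i) \<subseteq> B i)"
  by (simp add: weak_selector_def selector_def finite_subset_codes_def)

lemma computable_in_singleton_code: "computable_in X (\<lambda>k. set_encode {k})"
proof -
  have "set_encode {k} = rec_nat 1 (\<lambda>_ y. y + y) k" for k
  proof -
    have "set_encode {k} = 2 ^ k" by (simp add: set_encode_def)
    also have "\<dots> = rec_nat 1 (\<lambda>_ y. y + y) k" by (induction k) auto
    finally show ?thesis .
  qed
  then show ?thesis by (simp only:) (intro computable_in_rec_nat computable_intros)
qed

text \<open>If no degree makes \<open>M\<close> categorical, empty sets serve, because a finite set
  not contained in the empty set cannot be a subset of it. Otherwise the parameters for one such
  degree define the sequence for all degrees.\<close>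

lemma differences_of_structure:
  assumes M: "computable_structure L M" and rigid: "rigid L M"
  shows "\<exists>A B. computable_difference_sequence A B \<and>
    (\<forall>x. relatively_computably_categorical x L M \<longleftrightarrow>
      (\<exists>f. degree_computes x f \<and> weak_selector A B f))"
proof (cases "\<exists>X. relatively_computably_categorical (degree X) L M")
  case False
  then have "\<not> relatively_computably_categorical x L M" for x using degree_surj[of x] by auto
  moreover have "uniformly_ce (\<lambda>_. {})"
    unfolding uniformly_ce_iff by (simp add: semidecidable_in_decidable decidable_in_const)
  moreover have "\<not> weak_selector (\<lambda>_. {}) (\<lambda>_. {}) f" for f
    by (simp add: weak_selector_iff)
  ultimately show ?thesis unfolding computable_difference_sequence_def by blast
next
  case True
  then obtain X0 where "relatively_computably_categorical (degree X0) L M" ..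
  note cat0 = this[unfolded relatively_computably_categorical_degree, rule_format]
  have "distinct ([] :: nat list)" by simp
  from forces_exists[OF rigid cat0 this] obtain p e where p: "forces L M X0 p e" by blast
  define A where "A a = {\<phi>. realizes L M p \<phi> a}" for a
  define B where "B a = {\<phi>. \<exists>b. b \<noteq> a \<and> realizes L M p \<phi> b}" for a
  have "uniformly_ce A" "uniformly_ce B"
    unfolding uniformly_ce_iff A_def B_def mem_Collect_eq
    by (intro semidecidable_intros semidecidable_in_realizes[OF computable_structure_reducible[OF M]]
        semidecidable_in_decidable[OF decidable_in_not[OF decidable_in_eq]] computable_intros)+
  moreover have "relatively_computably_categorical x L M \<longleftrightarrow>
      (\<exists>f. degree_computes x f \<and> weak_selector A B f)" for x
  proof -
    obtain X where x: "x = degree X" using degree_surj by blast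
    show ?thesis unfolding x degree_computes_degree
    proof
      assume "relatively_computably_categorical (degree X) L M"
      note cat = this[unfolded relatively_computably_categorical_degree, rule_format]
      obtain F where F: "computable_in X F" "\<And>a b. realizes L M p (F a) b \<longleftrightarrow> b = a"
        using forces_defining_formulas[OF M rigid cat p] by blast
      have "computable_in X (\<lambda>a. set_encode {F a})"
        by (rule computable_in_comp[OF computable_in_singleton_code F(1)])
      moreover have "weak_selector A B (\<lambda>a. set_encode {F a})"
        unfolding weak_selector_iff A_def B_def
          set_encode_inverse[OF finite.insertI[OF finite.emptyI]] by (simp add: F(2))
      ultimately show "\<exists>f. computable_in X f \<and> weak_selector A B f" by blast
    next
      assume "\<exists>f. computable_in X f \<and> weak_selector A B f"
      then obtain f where f: "computable_in X f"
        "\<And>a. set_decode (f a) \<subseteq> A a" "\<And>a. \<not> set_decode (f a) \<subseteq> B a"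
        unfolding weak_selector_iff by blast
      show "relatively_computably_categorical (degree X) L M"
        unfolding relatively_computably_categorical_degree
      proof (intro allI impI)
        fix N assume "isomorphic L N M"
        then obtain g where g: "is_isomorphism L N M g" unfolding isomorphic_def ..
        let ?Y = "atomic_diagram L N \<oplus>\<^sub>T X"
        \<comment> \<open>The preimage of the parameters is a fixed finite list, so it may be built
          into the computation for \<open>N\<close> without any oracle.\<close>
        have "map g (map (inv g) p) = p"
          using g by (simp add: is_isomorphism_def map_idI bij_is_surj surj_f_inv_f)
        then have real: "realizes L N (map (inv g) p) \<phi> b \<longleftrightarrow> realizes L M p \<phi> (g b)" for \<phi> b
          using realizes_isomorphism[OF g, of "map (inv g) p" \<phi> b] by simp
        \<comment> \<open>The conjunction of the selected formulas defines \<open>a\<close>. It need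
          not be known which conjunct excludes the other elements.\<close>
        have graph: "g b = a \<longleftrightarrow> (\<forall>\<phi>\<in>set_decode (f a). realizes L N (map (inv g) p) \<phi> b)" for a b
          using f(2,3)[of a] unfolding real A_def B_def by blast
        have fY: "computable_in ?Y f" by (rule computable_in_trans[OF f(1) set_join_upper2])
        have "semidecidable_in ?Y (\<lambda>z. g (pfst z) = psnd z)"
          unfolding graph
          by (intro semidecidable_in_all_set_decode semidecidable_in_realizes[OF set_join_upper1]
              computable_intros computable_in_comp[OF fY])
        then have "computable_in ?Y g" by (rule computable_in_semidecidable_graph)
        with g show "\<exists>h. is_isomorphism L N M h \<and> computable_in ?Y h" by blast
      qed
    qed
  qed
  ultimately show ?thesis unfolding computable_difference_sequence_def by blast
qed

section \<open>From differences of c.e. sets to rigid structures\<close>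

definition binary_language :: language where
  "binary_language = \<lparr>fun_arity = (\<lambda>_. None), rel_arity = (\<lambda>_. Some 2)\<rparr>"

definition binary_struct :: "(nat \<Rightarrow> nat \<Rightarrow> nat \<Rightarrow> bool) \<Rightarrow> struct" where
  "binary_struct P = \<lparr>fun_interp = (\<lambda>_ _. 0), rel_interp = (\<lambda>r xs. P r (xs ! 0) (xs ! 1))\<rparr>"

lemma length_2_conv: "length xs = 2 \<longleftrightarrow> (\<exists>a b. xs = [a, b])"
  by (auto simp: numeral_2_eq_2 length_Suc_conv)

lemma mem_atomic_diagram:
  "pair i (atom_code \<phi>) \<in> atomic_diagram L M \<longleftrightarrow>
     i \<le> 1 \<and> wf_atom L \<phi> \<and> (sat_atom M \<phi> \<longleftrightarrow> i = 0)" (is "?l \<longleftrightarrow> ?r")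
proof
  assume ?l
  then obtain l where l: "pair i (atom_code \<phi>) = literal_code l" "wf_literal L l" "sat_literal M l"
    unfolding atomic_diagram_def by blast
  have "literal_code l = literal_code (if i = 0 then Pos \<phi> else Neg \<phi>)" "i \<le> 1"
    using l(1) by (cases l; auto)+
  then have "l = (if i = 0 then Pos \<phi> else Neg \<phi>)" by (intro literal_code_inject)
  with l \<open>i \<le> 1\<close> show ?r by (auto split: if_splits)
next
  assume r: ?r
  show ?l
  proof (cases "i = 0")
    case True
    then show ?thesis using r unfolding atomic_diagram_def
      by (intro CollectI exI[of _ "Pos \<phi>"]) auto
  next
    case False
    then show ?thesis using r unfolding atomic_diagram_def
      by (intro CollectI exI[of _ "Neg \<phi>"]) auto
  qed
qed

lemma wf_tm_binary: "wf_tm binary_language t \<longleftrightarrow> (\<exists>a. t = Elem a)"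
  by (cases t) (auto simp: binary_language_def)

lemma wf_tm_binary_code: "wf_tm binary_language t \<longleftrightarrow> pfst (tm_code t) = 0"
  by (cases t) (auto simp: binary_language_def)

lemma computable_structure_binary:
  assumes P: "decidable_in {} (\<lambda>x. P (pfst x) (pfst (psnd x)) (psnd (psnd x)))"
  shows "computable_structure binary_language (binary_struct P)"
proof -
  let ?wf = "\<lambda>a. if pfst a = 0 then pfst (pfst (psnd a)) = 0 \<and> pfst (psnd (psnd a)) = 0
     else llen (psnd a) = 2 \<and> pfst (lnth (psnd a) 0) = 0 \<and> pfst (lnth (psnd a) 1) = 0"
  let ?sat = "\<lambda>a. if pfst a = 0 then psnd (pfst (psnd a)) = psnd (psnd (psnd a))
     else P (pfst a - 1) (psnd (lnth (psnd a) 0)) (psnd (lnth (psnd a) 1))"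
  have wf: "wf_atom binary_language \<phi> \<longleftrightarrow> ?wf (atom_code \<phi>)" for \<phi>
  proof (cases \<phi>)
    case (Eq t u)
    then show ?thesis by (simp add: wf_tm_binary_code)
  next
    case (Rel r ts)
    have "rel_arity binary_language r = Some (length ts) \<longleftrightarrow> length ts = 2"
      by (auto simp: binary_language_def)
    moreover have "length ts = 2 \<Longrightarrow> (\<forall>t\<in>set ts. wf_tm binary_language t) \<longleftrightarrow>
        pfst (lnth (list_encode (map tm_code ts)) 0) = 0 \<and>
        pfst (lnth (list_encode (map tm_code ts)) 1) = 0"
      by (auto simp: length_2_conv wf_tm_binary_code lnth_encode simp del: list_encode.simps)
    ultimately show ?thesis using Rel by auto
  qed
  have sat: "sat_atom (binary_struct P) \<phi> \<longleftrightarrow> ?sat (atom_code \<phi>)" if "wf_atom binary_language \<phi>" for \<phi>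
  proof (cases \<phi>)
    case (Eq t u)
    then show ?thesis using that by (auto simp: wf_tm_binary)
  next
    case (Rel r ts)
    with that obtain a b where "ts = [Elem a, Elem b]"
      by (auto simp: binary_language_def length_2_conv wf_tm_binary[unfolded binary_language_def])
    then show ?thesis using Rel
      by (simp add: binary_struct_def lnth_encode del: list_encode.simps)
  qed
  have diag: "n \<in> atomic_diagram binary_language (binary_struct P) \<longleftrightarrow>
     pfst n \<le> 1 \<and> ?wf (psnd n) \<and> (?sat (psnd n) \<longleftrightarrow> pfst n = 0)" for n
  proof -
    obtain i \<phi> where n: "n = pair i (atom_code \<phi>)"
      using atom_code_surj pair_exhaust[of n] by metis
    show ?thesis
      unfolding n mem_atomic_diagram pfst_pair psnd_pair wf[symmetric] using sat[of \<phi>] by argo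
  qed
  have P': "decidable_in {} (\<lambda>x. P (f x) (g x) (h x))"
    if "computable_in {} f" "computable_in {} g" "computable_in {} h" for f g h
    using decidable_in_comp[OF P, of "\<lambda>x. pair (f x) (pair (g x) (h x))"] that
    by (simp add: computable_in_pair)
  have "decidable_in {} (\<lambda>n. n \<in> atomic_diagram binary_language (binary_struct P))"
    unfolding diag by (intro decidable_intros P')
  moreover have "computable_language binary_language"
    by (simp add: computable_language_def wf_language_def binary_language_def computable_fun_def
        computable_in_const)
  ultimately show ?thesis
    unfolding computable_structure_def computable_set_def computable_fun_def decidable_in_def by simp
qed

lemma is_isomorphism_binary:
  assumes "is_isomorphism binary_language N (binary_struct P) g"
  shows "rel_interp N r [a, b] \<longleftrightarrow> P r (g a) (g b)"
  using assms unfolding is_isomorphism_def binary_language_def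
  by (auto simp: binary_struct_def dest!: spec[of _ r] spec[of _ "[a, b]"])

lemma decidable_in_rel_interp:
  assumes Y: "atomic_diagram binary_language N \<le>\<^sub>T X"
    and r: "computable_in X r" and f: "computable_in X f" and g: "computable_in X g"
  shows "decidable_in X (\<lambda>x. rel_interp N (r x) [f x, g x])"
proof -
  have eq: "rel_interp N s [a, b] \<longleftrightarrow>
    pair 0 (pair (Suc s) (Suc (pair (pair 0 a) (Suc (pair (pair 0 b) 0))))) \<in>
      atomic_diagram binary_language N" for s a b
    using mem_atomic_diagram[of 0 "Rel s [Elem a, Elem b]" binary_language N]
    by (simp add: binary_language_def)
  show ?thesis unfolding eq
    by (rule decidable_in_comp[OF decidable_in_reducible_set[OF Y]]) (intro computable_intros r f g)
qed

text \<open>Without function symbols, the bits below \<open>u\<close> involve only equalities and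
  relations among the values at positions below \<open>u\<close>. Two assignments can thus have the
  same bits although no isomorphism links them; this is how a map that behaves well on one finite
  tuple only, such as \<open>shift\<close>, can be used.\<close>

lemma diagram_along_binary:
  assumes vw: "\<And>a b. a < u \<Longrightarrow> b < u \<Longrightarrow> v a = v b \<longleftrightarrow> w a = w b"
      "\<And>r a b. a < u \<Longrightarrow> b < u \<Longrightarrow> P r (v a) (v b) \<longleftrightarrow> P r (w a) (w b)"
    and l: "l < u"
  shows "l \<in> diagram_along binary_language (binary_struct P) v \<longleftrightarrow>
    l \<in> diagram_along binary_language (binary_struct P) w"
proof -
  let ?L = binary_language and ?M = "binary_struct P"
  obtain i \<phi> where n: "l = pair i (atom_code \<phi>)"
    using atom_code_surj pair_exhaust[of l] by metis
  have le: "atom_code \<phi> < u" using l le_prod_encode_2[of "atom_code \<phi>" i] n by simp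
  have elem: "a < u" if "tm_code (Elem a) < u" for a
    using that le_prod_encode_2[of a 0] by simp
  have "wf_atom ?L (ren_atom v' \<phi>) \<longleftrightarrow> wf_atom ?L \<phi>" for v' by (cases \<phi>) auto
  moreover have "sat_atom ?M (ren_atom v \<phi>) \<longleftrightarrow> sat_atom ?M (ren_atom w \<phi>)" if "wf_atom ?L \<phi>"
  proof (cases \<phi>)
    case (Eq t t')
    with that obtain a b where ab: "t = Elem a" "t' = Elem b" by (auto simp: wf_tm_binary)
    have "tm_code t < u" "tm_code t' < u"
      using le Eq le_prod_encode_1[of "tm_code t" "tm_code t'"]
        le_prod_encode_2[of "tm_code t'" "tm_code t"]
        le_prod_encode_2[of "pair (tm_code t) (tm_code t')" 0] by auto
    then show ?thesis using vw(1)[of a b] elem ab Eq by (simp del: tm_code.simps)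
  next
    case (Rel r ts)
    with that obtain a b where ts: "ts = [Elem a, Elem b]"
      by (auto simp: binary_language_def length_2_conv wf_tm_binary[unfolded binary_language_def])
    have "tm_code t < u" if "t \<in> set ts" for t
    proof -
      have "tm_code t < list_encode (map tm_code ts)"
        using list_decode_less[of "tm_code t" "list_encode (map tm_code ts)"] that by simp
      also have "\<dots> \<le> atom_code \<phi>" using le_prod_encode_2 Rel by simp
      finally show ?thesis using le by simp
    qed
    then have "a < u" "b < u" using elem[of a] elem[of b] ts by (simp_all del: tm_code.simps)
    then show ?thesis using vw(2) Rel ts by (simp add: binary_struct_def)
  qed
  ultimately show ?thesis
    unfolding diagram_along_def mem_Collect_eq
    unfolding n ren_code_atom mem_atomic_diagram by blast
qed

text \<open>An element \<open>\<langle>i, \<langle>k, s\<rangle>\<rangle>\<close> belongs to the \<open>k\<close>-th position of the component \<open>i\<close>. For \<open>s = 0\<close> it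
  is the \<open>k\<close>-th element of a chain of type \<open>\<omega>\<close>. For \<open>s = \<langle>n, t\<rangle> + 1\<close> it is a witness that the
  \<open>k\<close>-th element of the chain carries the label \<open>n\<close>, provided that this label appears at stage \<open>t\<close>,
  and otherwise a dummy that is named by a relation symbol of its own. Formulas cannot refer to the
  stage of a witness.\<close>

definition elt :: "nat \<Rightarrow> nat \<Rightarrow> nat \<Rightarrow> nat" where "elt i k s = pair i (pair k s)"

definition component :: "nat \<Rightarrow> nat" where "component z = pfst z"

definition pos :: "nat \<Rightarrow> nat" where "pos z = pfst (psnd z)"

definition kind :: "nat \<Rightarrow> nat" where "kind z = psnd (psnd z)"

definition lab :: "nat \<Rightarrow> nat" where "lab z = pfst (kind z - 1)"

lemma elt_simps [simp]:
  "component (elt i k s) = i" "pos (elt i k s) = k" "kind (elt i k s) = s" "elt (component z) (pos z) (kind z) = z"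
  by (simp_all add: elt_def component_def pos_def kind_def)

lemma elt_eq_iff: "z = w \<longleftrightarrow> component z = component w \<and> pos z = pos w \<and> kind z = kind w"
  by (metis elt_simps(4))

lemma computable_in_elt:
  assumes "computable_in X f"
  shows "computable_in X (\<lambda>x. component (f x))" "computable_in X (\<lambda>x. pos (f x))"
    "computable_in X (\<lambda>x. kind (f x))" "computable_in X (\<lambda>x. lab (f x))"
  unfolding component_def pos_def kind_def lab_def by (intro computable_intros assms)+

text \<open>A component \<open>i\<close> belongs to the index \<open>pfst i\<close> of the sequence,
  so each index owns the infinitely many components \<open>pair (pfst i) j\<close>. Uniqueness of
  the stage leaves one witness for each label at each position, as rigidity requires.\<close>

locale labelled_chains =
  fixes stage :: "nat \<Rightarrow> nat \<Rightarrow> nat \<Rightarrow> nat \<Rightarrow> bool" and A B :: "nat \<Rightarrow> nat set"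
  assumes stage_unique: "stage i k n t \<Longrightarrow> stage i k n t' \<Longrightarrow> t = t'"
    and stage_ex: "(\<exists>t. stage i k n t) \<longleftrightarrow> n \<in> (if k = 0 then A (pfst i) else B (pfst i))"
    and stage_dec: "decidable_in {} (\<lambda>x. stage (pfst x) (pfst (psnd x)) (pfst (psnd (psnd x)))
      (psnd (psnd (psnd x))))"
    and ce: "uniformly_ce A"
begin

definition witness :: "nat \<Rightarrow> bool" where
  "witness z \<longleftrightarrow> kind z \<noteq> 0 \<and> stage (component z) (pos z) (lab z) (psnd (kind z - 1))"

definition dummy :: "nat \<Rightarrow> bool" where
  "dummy z \<longleftrightarrow> kind z \<noteq> 0 \<and> \<not> witness z"

text \<open>The tag \<open>pfst r\<close> selects names of dummies, names of chains, successor, or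
  labels; unary properties are relations on the diagonal. Tags above 3 repeat the label relations,
  so that every number is a relation symbol.\<close>

definition R :: "nat \<Rightarrow> nat \<Rightarrow> nat \<Rightarrow> bool" where
  "R r z w \<longleftrightarrow>
     (if pfst r = 0 then z = w \<and> w = psnd r \<and> dummy w
      else if pfst r = 1 then z = w \<and> kind w = 0 \<and> component w = psnd r
      else if pfst r = 2 then kind z = 0 \<and> kind w = 0 \<and> component w = component z \<and> pos w = Suc (pos z)
      else kind z = 0 \<and> witness w \<and> component w = component z \<and> pos w = pos z \<and> lab w = psnd r)"

lemma R_simps:
  "R (pair 0 m) z w \<longleftrightarrow> z = w \<and> w = m \<and> dummy w"
  "R (pair 1 m) z w \<longleftrightarrow> z = w \<and> kind w = 0 \<and> component w = m"
  "R (pair 2 m) z w \<longleftrightarrow> kind z = 0 \<and> kind w = 0 \<and> component w = component z \<and> pos w = Suc (pos z)"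
  "R (pair 3 m) z w \<longleftrightarrow> kind z = 0 \<and> witness w \<and> component w = component z \<and> pos w = pos z \<and> lab w = m"
  by (auto simp: R_def)

abbreviation M :: struct where "M \<equiv> binary_struct R"

lemma decidable_in_witness:
  assumes "computable_in X f"
  shows "decidable_in X (\<lambda>x. witness (f x))"
proof (rule decidable_in_comp[OF _ assms], rule decidable_in_empty)
  have "decidable_in {} (\<lambda>z. stage (component z) (pos z) (lab z) (psnd (kind z - 1)))"
    using decidable_in_comp[OF stage_dec, of "\<lambda>z. pair (component z) (pair (pos z)
      (pair (lab z) (psnd (kind z - 1))))"]
    unfolding lab_def kind_def component_def pos_def by (simp add: computable_intros)
  then show "decidable_in {} witness"
    unfolding witness_def[abs_def] unfolding kind_def
    by (intro decidable_in_and decidable_in_not decidable_in_eq computable_intros)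
qed

lemma computable_M: "computable_structure binary_language M"
  unfolding R_def[abs_def] dummy_def
  by (rule computable_structure_binary, unfold kind_def component_def pos_def lab_def,
      intro decidable_intros decidable_in_witness)

lemma witness_unique:
  assumes "witness z" "witness w" "component z = component w" "pos z = pos w" "lab z = lab w"
  shows "z = w"
proof -
  have "psnd (kind z - 1) = psnd (kind w - 1)"
    using assms stage_unique unfolding witness_def by metis
  then have "kind z - 1 = kind w - 1" using assms(5) unfolding lab_def by (metis pair_pfst_psnd)
  then have "kind z = kind w" using assms unfolding witness_def by (cases "kind z"; cases "kind w") auto
  with assms show ?thesis by (simp add: elt_eq_iff[of z w])
qed

lemma witness_lab: "witness z \<Longrightarrow> lab z \<in> (if pos z = 0 then A (pfst (component z)) else B (pfst (component z)))"
  using stage_ex[of "component z" "pos z" "lab z"] unfolding witness_def by blast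

lemma witness_ex:
  assumes "n \<in> (if k = 0 then A (pfst i) else B (pfst i))"
  shows "\<exists>w. witness w \<and> component w = i \<and> pos w = k \<and> lab w = n"
proof -
  obtain t where "stage i k n t" using assms stage_ex by blast
  then show ?thesis by (intro exI[of _ "elt i k (Suc (pair n t))"]) (simp add: witness_def lab_def)
qed

text \<open>An automorphism keeps each chain and its successor relation, hence adds a constant to
  the positions; surjectivity makes this constant 0. A witness is then fixed by its chain element
  and label, a dummy by its name.\<close>

lemma rigid_M: "rigid binary_language M"
  unfolding rigid_def
proof (intro allI impI)
  fix h assume h: "is_isomorphism binary_language M M h"
  then have bij: "bij h" by (simp add: is_isomorphism_def)
  have R: "R r z w \<longleftrightarrow> R r (h z) (h w)" for r z w
    using is_isomorphism_binary[OF h, of r z w] by (simp add: binary_struct_def)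
  have chain: "kind z = 0 \<Longrightarrow> kind (h z) = 0 \<and> component (h z) = component z" for z
    using R[of "pair 1 (component z)" z z] unfolding R_simps by simp
  have succ: "pos (h (elt i k 0)) = pos (h (elt i 0 0)) + k" for i k
  proof (induction k)
    case (Suc k)
    have "pos (h (elt i (Suc k) 0)) = Suc (pos (h (elt i k 0)))"
      using R[of "pair 2 0" "elt i k 0" "elt i (Suc k) 0"] unfolding R_simps by simp
    with Suc show ?case by simp
  qed simp
  have first: "pos (h (elt i 0 0)) = 0" for i
  proof -
    obtain z where z: "h z = elt i 0 0" using bij by (metis bij_pointE)
    have "kind z = 0" "component z = i"
      using R[of "pair 1 i" z z] z unfolding R_simps by auto
    then have "z = elt i (pos z) 0" by (metis elt_simps(4))
    with succ[of i "pos z"] z show ?thesis by (metis add_is_0 elt_simps(2))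
  qed
  have chain_id: "h z = z" if "kind z = 0" for z
  proof -
    have "z = elt (component z) (pos z) 0" using that by (metis elt_simps(4))
    then have "pos (h z) = pos z" using succ[of "component z" "pos z"] first by simp
    then show ?thesis using chain[OF that] that by (simp add: elt_eq_iff[of "h z" z])
  qed
  have "h z = z" for z
  proof (cases "kind z = 0")
    case True
    then show ?thesis by (rule chain_id)
  next
    case False
    show ?thesis
    proof (cases "witness z")
      case True
      let ?c = "elt (component z) (pos z) 0"
      have "R (pair 3 (lab z)) ?c z" using True by (simp add: R_simps)
      then have "R (pair 3 (lab z)) ?c (h z)" using R[of "pair 3 (lab z)" ?c z] chain_id[of ?c] by simp
      then have "witness (h z)" "component (h z) = component z" "pos (h z) = pos z" "lab (h z) = lab z"
        unfolding R_simps elt_simps by blast+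
      then show ?thesis using witness_unique[of "h z" z] True by blast
    next
      case nw: False
      then have "R (pair 0 z) z z" using False by (simp add: R_simps dummy_def)
      then show ?thesis using R[of "pair 0 z" z z] by (simp add: R_simps)
    qed
  qed
  then show "h = id" by auto
qed

text \<open>Moves the component \<open>i\<close> one step along its chain. On elements whose labels all lie in \<open>B\<close> this
  preserves the relations, so no existential formula that involves only such labels separates the
  first element of the chain from the second.\<close>

definition shift :: "nat \<Rightarrow> nat \<Rightarrow> nat" where
  "shift i z = (if component z \<noteq> i \<or> dummy z then z
     else if kind z = 0 then elt i (Suc (pos z)) 0
     else SOME w. witness w \<and> component w = i \<and> pos w = Suc (pos z) \<and> lab w = lab z)"

text \<open>Every position after the first carries exactly the labels in \<open>B (pfst i)\<close>.
  The assumption therefore guarantees the witness at the next position that the choice in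
  \<open>shift\<close> asks for.\<close>

lemma shift:
  assumes "witness z \<longrightarrow> component z = i \<longrightarrow> lab z \<in> B (pfst i)"
  shows "component (shift i z) = component z" "witness (shift i z) \<longleftrightarrow> witness z"
    "kind (shift i z) = 0 \<longleftrightarrow> kind z = 0" "dummy (shift i z) \<longleftrightarrow> dummy z"
    "witness z \<Longrightarrow> lab (shift i z) = lab z"
    "pos (shift i z) = (if component z = i \<and> \<not> dummy z then Suc (pos z) else pos z)"
    "dummy z \<Longrightarrow> shift i z = z"
proof -
  have "(component (shift i z) = component z \<and> (witness (shift i z) \<longleftrightarrow> witness z) \<and>
    (kind (shift i z) = 0 \<longleftrightarrow> kind z = 0) \<and> (witness z \<longrightarrow> lab (shift i z) = lab z) \<and>
    pos (shift i z) = (if component z = i \<and> \<not> dummy z then Suc (pos z) else pos z))"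
  proof (cases "component z = i \<and> witness z")
    case True
    let ?Q = "\<lambda>w. witness w \<and> component w = i \<and> pos w = Suc (pos z) \<and> lab w = lab z"
    have "\<exists>w. ?Q w" using witness_ex[of "lab z" "Suc (pos z)" i] assms True by simp
    then have "?Q (SOME w. ?Q w)" by (rule someI_ex)
    moreover have kz: "kind z \<noteq> 0" using True by (simp add: witness_def)
    moreover have "shift i z = (SOME w. ?Q w)"
      using True kz by (simp add: shift_def dummy_def)
    ultimately have "?Q (shift i z)" by simp
    then show ?thesis using True by (auto simp: dummy_def witness_def)
  next
    case False
    then show ?thesis by (auto simp: shift_def dummy_def witness_def)
  qed
  then show "component (shift i z) = component z" "witness (shift i z) \<longleftrightarrow> witness z"
    "kind (shift i z) = 0 \<longleftrightarrow> kind z = 0" "dummy (shift i z) \<longleftrightarrow> dummy z"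
    "witness z \<Longrightarrow> lab (shift i z) = lab z"
    "pos (shift i z) = (if component z = i \<and> \<not> dummy z then Suc (pos z) else pos z)"
    "dummy z \<Longrightarrow> shift i z = z"
    by (auto simp: dummy_def shift_def)
qed

lemma shift_inj:
  assumes z: "witness z \<longrightarrow> component z = i \<longrightarrow> lab z \<in> B (pfst i)"
    and w: "witness w \<longrightarrow> component w = i \<longrightarrow> lab w \<in> B (pfst i)"
    and eq: "shift i z = shift i w"
  shows "z = w"
proof (cases "dummy z")
  case True
  then show ?thesis using shift[OF z] shift[OF w] eq by metis
next
  case False
  have component: "component z = component w" using shift(1)[OF z] shift(1)[OF w] eq by simp
  have "dummy z \<longleftrightarrow> dummy w" using shift(4)[OF z] shift(4)[OF w] eq by simp
  then have pos: "pos z = pos w" using shift(6)[OF z] shift(6)[OF w] eq component by (auto split: if_splits)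
  show ?thesis
  proof (cases "kind z = 0")
    case True
    then have "kind w = 0" using shift(3)[OF z] shift(3)[OF w] eq by simp
    with True component pos show ?thesis by (simp add: elt_eq_iff[of z w])
  next
    case kz: False
    with False have wz: "witness z" by (simp add: dummy_def)
    have ww: "witness w" using wz shift(2)[OF z] shift(2)[OF w] eq by metis
    have "lab z = lab w" using shift(5)[OF z wz] shift(5)[OF w ww] eq by metis
    from wz ww component pos this show ?thesis by (rule witness_unique)
  qed
qed

text \<open>Elements related by successor or by a label lie in one component and are not dummies, so
  either both positions move by one or neither does. The diagonal relations need
  injectivity.\<close>

lemma R_shift:
  assumes z: "witness z \<longrightarrow> component z = i \<longrightarrow> lab z \<in> B (pfst i)"
    and w: "witness w \<longrightarrow> component w = i \<longrightarrow> lab w \<in> B (pfst i)"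
  shows "R r (shift i z) (shift i w) \<longleftrightarrow> R r z w"
proof -
  have inj: "shift i z = shift i w \<longleftrightarrow> z = w" using shift_inj[OF z w] by blast
  have "kind z = 0 \<Longrightarrow> pos (shift i z) = (if component z = i then Suc (pos z) else pos z)"
    "kind w = 0 \<or> witness w \<Longrightarrow> pos (shift i w) = (if component w = i then Suc (pos w) else pos w)"
    using shift(6)[OF z] shift(6)[OF w] by (auto simp: dummy_def)
  then have "kind z = 0 \<Longrightarrow> kind w = 0 \<or> witness w \<Longrightarrow> component w = component z \<Longrightarrow>
      pos (shift i w) = Suc (pos (shift i z)) \<longleftrightarrow> pos w = Suc (pos z)"
    "kind z = 0 \<Longrightarrow> kind w = 0 \<or> witness w \<Longrightarrow> component w = component z \<Longrightarrow>
      pos (shift i w) = pos (shift i z) \<longleftrightarrow> pos w = pos z"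
    by simp_all
  moreover have "shift i w = m \<and> dummy w \<longleftrightarrow> w = m \<and> dummy w" for m
    using shift(7)[OF w] by metis
  ultimately show ?thesis
    unfolding R_def inj shift(1-4)[OF z] shift(1-4)[OF w] using shift(5)[OF w]
    by (intro if_cong refl; metis)
qed

text \<open>Otherwise the shifted tuple would realize the same formula with the second element of
  the chain in place of the first. The parameters stay fixed under the shift because they avoid the
  component \<open>i\<close>.\<close>

lemma labels_not_subset:
  assumes F: "\<And>b. realizes binary_language M p \<phi> b \<Longrightarrow> b = elt i 0 0"
    and p: "\<And>z. z \<in> set p \<Longrightarrow> component z \<noteq> i"
    and r: "realization binary_language M p \<phi> (elt i 0 0) r"
  shows "\<exists>z\<in>set r. witness z \<and> component z = i \<and> pos z = 0 \<and> lab z \<notin> B (pfst i)"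
proof (rule ccontr)
  assume no: "\<not> ?thesis"
  \<comment> \<open>Witnesses at later positions have labels in \<open>B\<close> anyway, so the
    negated claim about position 0 covers all witnesses in the tuple.\<close>
  have lab: "witness z \<longrightarrow> component z = i \<longrightarrow> lab z \<in> B (pfst i)" if "z \<in> set r" for z
    using no that witness_lab[of z] by (cases "pos z = 0") auto
  have r': "distinct r" "take (length p) r = p" "pfst \<phi> < length r" "r ! pfst \<phi> = elt i 0 0"
    "pfst (psnd \<phi>) \<le> length r"
    "agrees (pfst (psnd \<phi>)) (psnd (psnd \<phi>)) (diagram_along binary_language M ((!) r))"
    using r unfolding realization_def by auto
  let ?s = "map (shift i) r"
  have "l \<in> diagram_along binary_language M ((!) ?s) \<longleftrightarrow> l \<in> diagram_along binary_language M ((!) r)"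
    if "l < pfst (psnd \<phi>)" for l
  proof (rule diagram_along_binary[of "length r"])
    fix a b assume ab: "a < length r" "b < length r"
    then show "?s ! a = ?s ! b \<longleftrightarrow> r ! a = r ! b"
      using shift_inj[OF lab lab, of "r ! a" "r ! b"] by auto
    show "R s (?s ! a) (?s ! b) \<longleftrightarrow> R s (r ! a) (r ! b)" for s
      using R_shift[OF lab lab, of "r ! a" "r ! b"] ab by auto
  qed (use that r'(5) in simp)
  then have "agrees (pfst (psnd \<phi>)) (psnd (psnd \<phi>)) (diagram_along binary_language M ((!) ?s))"
    using r'(6) by (simp add: agrees_def)
  moreover have "distinct ?s"
    using r'(1) shift_inj[OF lab lab] by (auto simp: distinct_map inj_on_def)
  moreover have "take (length p) ?s = p"
  proof -
    have "map (shift i) p = p" using p by (intro map_idI) (simp add: shift_def)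
    then show ?thesis by (simp add: take_map r'(2))
  qed
  moreover have "?s ! pfst \<phi> = elt i 1 0" using r'(3,4) by (simp add: shift_def dummy_def)
  ultimately have "realizes binary_language M p \<phi> (elt i 1 0)"
    unfolding realizes_def realization_def using r' by (intro exI[of _ ?s]) simp
  from F[OF this] have "pos (elt i 1 0) = pos (elt i 0 0)" by simp
  then show False by simp
qed

section \<open>Weak selectors and categoricity of the labelled chains\<close>

lemma weak_selector_if_categorical:
  assumes "relatively_computably_categorical (degree X) binary_language M"
  shows "\<exists>f. computable_in X f \<and> weak_selector A B f"
proof -
  let ?L = binary_language
  note cat = assms[unfolded relatively_computably_categorical_degree, rule_format]
  have "distinct ([] :: nat list)" by simp
  from forces_exists[OF rigid_M cat this] obtain p e where p: "forces ?L M X p e" by blast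
  obtain F where F: "computable_in X F" "\<And>a b. realizes ?L M p (F a) b \<longleftrightarrow> b = a"
    using forces_defining_formulas[OF computable_M rigid_M cat p] by blast
  \<comment> \<open>Each parameter, and hence its component, is smaller than \<open>j\<close>,
    whereas \<open>pair i j\<close> is at least \<open>j\<close>. This single \<open>j\<close> works
    for every \<open>i\<close>.\<close>
  define j where "j = Suc (sum_list p)"
  have comp_p: "component z \<noteq> pair i j" if "z \<in> set p" for z i
  proof -
    have "component z \<le> z" by (simp add: component_def pfst_le)
    also have "z < j" using member_le_sum_list[OF that] by (simp add: j_def)
    also have "j \<le> pair i j" by (rule le_prod_encode_2)
    finally show ?thesis by simp
  qed
  define u where "u i = elt (pair i j) 0 0" for i
  \<comment> \<open>The finite set \<open>d\<close> is searched for together with a realizing tuple.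
    It must contain the labels of all first-position witnesses in the tuple; one of these lies
    outside \<open>B i\<close>. Additional labels are harmless as long as they belong to
    \<open>A i\<close>.\<close>
  define W where "W i d \<longleftrightarrow> (\<forall>n\<in>set_decode d. n \<in> A i) \<and>
    (\<exists>c. realization ?L M p (F (u i)) (u i) (list_decode c) \<and>
      (\<forall>k<llen c. witness (lnth c k) \<and> component (lnth c k) = pair i j \<and> pos (lnth c k) = 0 \<longrightarrow>
         lab (lnth c k) \<in> set_decode d))" for i d
  have u: "computable_in X (\<lambda>x. u (g x))" if "computable_in X g" for g
    unfolding u_def elt_def by (intro computable_intros that)
  have "semidecidable_in X (\<lambda>z. psnd z \<in> A (pfst z))"
    using ce unfolding uniformly_ce_iff by (rule semidecidable_in_empty)
  then have A: "semidecidable_in X (\<lambda>x. h x \<in> A (g x))"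
    if "computable_in X g" "computable_in X h" for g h
    using semidecidable_in_comp[of X _ "\<lambda>x. pair (g x) (h x)"] that by (force intro: computable_in_pair)
  have "semidecidable_in X (\<lambda>x. W (pfst x) (psnd x))"
    unfolding W_def component_def pos_def lab_def kind_def
    by (intro semidecidable_in_and semidecidable_in_all_set_decode semidecidable_in_ex A
        semidecidable_in_decidable[OF decidable_in_all_less]
        semidecidable_in_decidable[OF decidable_in_realization]
        computable_structure_reducible[OF computable_M] computable_in_comp[OF F(1)] u
        decidable_intros decidable_in_witness)
  moreover have "\<exists>d. W i d" for i
  proof -
    obtain r where r: "realization ?L M p (F (u i)) (u i) r"
      using F(2)[of "u i" "u i"] unfolding realizes_def by blast
    let ?S = "lab ` {z \<in> set r. witness z \<and> component z = pair i j \<and> pos z = 0}"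
    have "set_decode (set_encode ?S) = ?S" by (rule set_encode_inverse) simp
    moreover have "n \<in> A i" if "n \<in> ?S" for n
    proof -
      from that obtain z where "witness z" "component z = pair i j" "pos z = 0" "n = lab z" by blast
      then show ?thesis using witness_lab[of z] by simp
    qed
    ultimately have "W i (set_encode ?S)"
      unfolding W_def using r by (intro conjI exI[of _ "list_encode r"]) auto
    then show ?thesis by blast
  qed
  ultimately obtain f where f: "computable_in X f" "\<And>i. W i (f i)"
    using semidecidable_in_uniformize[of X W] by metis
  have "weak_selector A B f"
    unfolding weak_selector_iff
  proof (intro allI conjI)
    fix i
    obtain c where c: "realization ?L M p (F (u i)) (u i) (list_decode c)"
      "\<And>k. k < llen c \<Longrightarrow> witness (lnth c k) \<Longrightarrow> component (lnth c k) = pair i j \<Longrightarrow> pos (lnth c k) = 0 \<Longrightarrow>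
         lab (lnth c k) \<in> set_decode (f i)"
      using f(2)[of i] unfolding W_def by blast
    show "set_decode (f i) \<subseteq> A i" using f(2)[of i] unfolding W_def by blast
    have "\<exists>z\<in>set (list_decode c). witness z \<and> component z = pair i j \<and> pos z = 0 \<and> lab z \<notin> B (pfst (pair i j))"
      using c(1) F(2) comp_p unfolding u_def by (intro labels_not_subset[of p "F (elt (pair i j) 0 0)"]) auto
    then obtain z where z: "z \<in> set (list_decode c)" "witness z" "component z = pair i j" "pos z = 0"
      "lab z \<notin> B i" by auto
    then obtain k where "k < llen c" "z = lnth c k"
      by (metis in_set_conv_nth llen_decode nth_decode)
    then show "\<not> set_decode (f i) \<subseteq> B i" using c(2)[of k] z by blast
  qed
  with f(1) show ?thesis by blast
qed

text \<open>Within its chain the first element is recognized by carrying all labels in the selected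
  set: one of them lies outside \<open>B\<close>, so no later element carries them all. Successors
  then locate the other chain elements, after which witnesses are found by their labels and dummies
  by their names. All these conditions are semidecidable, which suffices for the graph of a total
  function.\<close>

lemma categorical_if_weak_selector:
  assumes f: "computable_in X f" and ws: "weak_selector A B f"
  shows "relatively_computably_categorical (degree X) binary_language M"
  unfolding relatively_computably_categorical_degree
proof (intro allI impI)
  let ?L = binary_language
  fix N assume "isomorphic ?L N M"
  then obtain g where g: "is_isomorphism ?L N M g" unfolding isomorphic_def ..
  then have bij: "bij g" by (simp add: is_isomorphism_def)
  have inv: "g (inv g z) = z" for z using bij by (simp add: bij_is_surj surj_f_inv_f)
  let ?Y = "atomic_diagram ?L N \<oplus>\<^sub>T X"
  have N: "rel_interp N r [a, b] \<longleftrightarrow> R r (g a) (g b)" for r a b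
    by (rule is_isomorphism_binary[OF g])
  have fA: "set_decode (f i) \<subseteq> A i" and fB: "\<not> set_decode (f i) \<subseteq> B i" for i
    using ws unfolding weak_selector_iff by auto
  define C where "C b i k \<longleftrightarrow> (\<exists>c. rel_interp N (pair 1 i) [lnth c 0, lnth c 0] \<and>
     (\<forall>n\<in>set_decode (f (pfst i)). \<exists>w. rel_interp N (pair 3 n) [lnth c 0, w]) \<and>
     (\<forall>m<k. rel_interp N (pair 2 0) [lnth c m, lnth c (Suc m)]) \<and> b = lnth c k)" for b i k
  have C: "C b i k \<longleftrightarrow> g b = elt i k 0" for b i k
  proof
    assume "C b i k"
    then obtain c where c0: "R (pair 1 i) (g (lnth c 0)) (g (lnth c 0))"
      and c': "\<forall>n\<in>set_decode (f (pfst i)). \<exists>w. R (pair 3 n) (g (lnth c 0)) (g w)"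
        "\<forall>m<k. R (pair 2 0) (g (lnth c m)) (g (lnth c (Suc m)))" "b = lnth c k"
      unfolding C_def N by blast
    from c0 have c: "kind (g (lnth c 0)) = 0" "component (g (lnth c 0)) = i"
      unfolding R_simps by auto
    have "pos (g (lnth c 0)) = 0"
    proof (rule ccontr)
      assume "pos (g (lnth c 0)) \<noteq> 0"
      then have "n \<in> B (pfst i)" if n: "n \<in> set_decode (f (pfst i))" for n
        using bspec[OF c'(1) n] witness_lab c(2) unfolding R_simps by metis
      then show False using fB by blast
    qed
    then have "m \<le> k \<Longrightarrow> g (lnth c m) = elt i m 0" for m
    proof (induction m)
      case 0
      then show ?case using c by (simp add: elt_eq_iff[of "g _"])
    next
      case (Suc m)
      then show ?case using c'(2)[rule_format, of m] by (simp add: elt_eq_iff[of "g _"] R_simps)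
    qed
    then show "g b = elt i k 0" using c'(3) by blast
  next
    assume b: "g b = elt i k 0"
    let ?c = "list_encode (map (\<lambda>m. inv g (elt i m 0)) [0..<Suc k])"
    have c: "lnth ?c m = inv g (elt i m 0)" if "m \<le> k" for m
      using that by (subst lnth_encode) (simp del: upt_Suc)
    have "\<exists>w. R (pair 3 n) (elt i 0 0) (g w)" if n: "n \<in> set_decode (f (pfst i))" for n
    proof -
      obtain w where "witness w \<and> component w = i \<and> pos w = 0 \<and> lab w = n"
        using witness_ex[of n 0 i] subsetD[OF fA n] by auto
      then show ?thesis by (intro exI[of _ "inv g w"]) (simp add: inv R_simps)
    qed
    moreover have "R (pair 1 i) (elt i 0 0) (elt i 0 0)"
      "R (pair 2 0) (elt i m 0) (elt i (Suc m) 0)" for m unfolding R_simps by simp_all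
    moreover have "b = inv g (elt i k 0)" using b bij by (metis bij_is_inj inv_f_f)
    ultimately show "C b i k"
      unfolding C_def N by (intro exI[of _ ?c]) (simp add: c inv del: upt_Suc)
  qed
  have graph: "g b = a \<longleftrightarrow>
    (if kind a = 0 then C b (component a) (pos a)
     else if witness a then
       (\<exists>b'. C b' (component a) (pos a) \<and> rel_interp N (pair 3 (lab a)) [b', b])
     else rel_interp N (pair 0 a) [b, b])" for a b
  proof -
    consider "kind a = 0" | "kind a \<noteq> 0" "witness a" | "kind a \<noteq> 0" "\<not> witness a" by blast
    then show ?thesis
    proof cases
      case 1
      then have "elt (component a) (pos a) 0 = a" by (metis elt_simps(4))
      with 1 show ?thesis by (simp add: C)
    next
      case 2
      let ?c = "elt (component a) (pos a) 0"
      have "R (pair 3 (lab a)) ?c (g b) \<longleftrightarrow> g b = a"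
        using 2 witness_unique[of "g b" a] by (auto simp: R_simps)
      moreover have "(\<exists>b'. g b' = ?c \<and> R (pair 3 (lab a)) (g b') (g b)) \<longleftrightarrow>
          R (pair 3 (lab a)) ?c (g b)"
        using inv[of ?c] by metis
      ultimately show ?thesis using 2 by (simp add: C N)
    next
      case 3
      then show ?thesis by (auto simp: N R_simps dummy_def)
    qed
  qed
  have fY: "computable_in ?Y f" by (rule computable_in_trans[OF f set_join_upper2])
  note rel = semidecidable_in_decidable[OF decidable_in_rel_interp[OF set_join_upper1]]
  have Cs: "semidecidable_in ?Y (\<lambda>x. C (b x) (i x) (k x))"
    if "computable_in ?Y b" "computable_in ?Y i" "computable_in ?Y k" for b i k
    unfolding C_def
    by (intro semidecidable_in_and semidecidable_in_ex semidecidable_in_all_set_decode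
        semidecidable_in_all_less semidecidable_in_eq rel computable_intros
        computable_in_comp[OF fY] computable_in_comp[OF that(1)] computable_in_comp[OF that(2)]
        computable_in_comp[OF that(3)])
  have "semidecidable_in ?Y (\<lambda>z. g (pfst z) = psnd z)"
    unfolding graph
    by (intro semidecidable_in_If semidecidable_in_and semidecidable_in_ex Cs rel
        decidable_in_witness decidable_in_eq computable_in_elt computable_intros)
  then have "computable_in ?Y g" by (rule computable_in_semidecidable_graph)
  with g show "\<exists>h. is_isomorphism ?L N M h \<and> computable_in ?Y h" by blast
qed

end

lemma structure_of_differences:
  assumes "computable_difference_sequence A B"
  shows "\<exists>L M. computable_structure L M \<and> rigid L M \<and>
    (\<forall>x. relatively_computably_categorical x L M \<longleftrightarrow>
      (\<exists>f. degree_computes x f \<and> weak_selector A B f))"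
proof -
  have ce: "uniformly_ce A" "uniformly_ce B"
    using assms by (auto simp: computable_difference_sequence_def)
  obtain RA where RA: "decidable_in {} RA" "\<And>z. psnd z \<in> A (pfst z) \<longleftrightarrow> (\<exists>s. RA (pair s z))"
    using semidecidable_inD[OF ce(1)[unfolded uniformly_ce_iff]] by auto
  obtain RB where RB: "decidable_in {} RB" "\<And>z. psnd z \<in> B (pfst z) \<longleftrightarrow> (\<exists>s. RB (pair s z))"
    using semidecidable_inD[OF ce(2)[unfolded uniformly_ce_iff]] by auto
  define S where "S i k n t \<longleftrightarrow>
    (if k = 0 then RA (pair t (pair (pfst i) n)) else RB (pair t (pair (pfst i) n)))" for i k n t :: nat
  \<comment> \<open>Only the least stage of an enumeration counts, which turns possibly many stages
    for a label into exactly one.\<close>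
  define stage where "stage i k n t \<longleftrightarrow> S i k n t \<and> (\<forall>s<t. \<not> S i k n s)" for i k n t
  interpret labelled_chains stage A B
  proof
    show "t = t'" if "stage i k n t" "stage i k n t'" for i k n t t'
      using that unfolding stage_def by (metis linorder_neqE_nat)
    show "(\<exists>t. stage i k n t) \<longleftrightarrow> n \<in> (if k = 0 then A (pfst i) else B (pfst i))" for i k n
    proof -
      have "(\<exists>t. stage i k n t) \<longleftrightarrow> (\<exists>t. S i k n t)"
        unfolding stage_def by (rule exists_least_iff[symmetric])
      also have "\<dots> \<longleftrightarrow> n \<in> (if k = 0 then A (pfst i) else B (pfst i))"
        using RA(2)[of "pair (pfst i) n"] RB(2)[of "pair (pfst i) n"] by (simp add: S_def)
      finally show ?thesis .
    qed
    show "decidable_in {} (\<lambda>x. stage (pfst x) (pfst (psnd x)) (pfst (psnd (psnd x)))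
      (psnd (psnd (psnd x))))"
      unfolding stage_def S_def
      by (intro decidable_in_and decidable_in_all_less decidable_in_not decidable_in_If
          decidable_in_eq decidable_in_comp[OF RA(1)] decidable_in_comp[OF RB(1)] computable_intros)
    show "uniformly_ce A" by (rule ce(1))
  qed
  have "relatively_computably_categorical x binary_language M \<longleftrightarrow>
      (\<exists>f. degree_computes x f \<and> weak_selector A B f)" for x
  proof -
    obtain X where "x = degree X" using degree_surj by blast
    then show ?thesis
      using weak_selector_if_categorical[of X] categorical_if_weak_selector[of X]
      by (auto simp: degree_computes_degree)
  qed
  with computable_M rigid_M show ?thesis by blast
qed

theorem theorem1:
  shows
    "(\<forall>(L :: language) (M :: struct). computable_structure L M \<and> rigid L M \<longrightarrow>
        (\<exists>A B. computable_difference_sequence A B \<and>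
           (\<forall>x :: turing_degree. relatively_computably_categorical x L M \<longleftrightarrow>
              (\<exists>f. degree_computes x f \<and> weak_selector A B f)))) \<and>
     (\<forall>A B. computable_difference_sequence A B \<longrightarrow>
        (\<exists>(L :: language) (M :: struct). computable_structure L M \<and> rigid L M \<and>
           (\<forall>x :: turing_degree. relatively_computably_categorical x L M \<longleftrightarrow>
              (\<exists>f. degree_computes x f \<and> weak_selector A B f))))"
  using differences_of_structure structure_of_differences by blast

end
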